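(* Let $G$ be a connected finite simple graph on at least $5$ vertices. Then there exists a multiplicity $\mu$ on $\mathcal{A}_G$ with $\mu(H)\ge1$ for all $H\in\mathcal{A}_G$ such that $(\mathcal{A}_G,\mu)$ is free if and only if $G$ is (isomorphic to) a path-graph, a cycle-graph, an almost-path-graph, or a path-with-triangle-graph. In particular, every other connected graph with at least $5$ vertices yields a totally non-free connected subgraph arrangement.
   Context: For a finite simple graph $G$ with vertex set $N=\{1,\dots,n\}$ and $I\subseteq N$, $G[I]$ denotes the induced subgraph on $I$. The connected subgraph arrangement is $\mathcal{A}_G=\{H_I:\emptyset\ne I\subseteq N,\ G[I]\text{ connected}\}$ in $\mathbb{Q}^n$, where $H_I=\ker(\sum_{i\in I}x_i)$. For a multiplicity $\mu:\mathcal{A}\to\mathbb{Z}_{\ge0}$, $D(\mathcal{A},\mu)=\{\theta\in\mathrm{Der}(S):\theta(\alpha_H)\in\alpha_H^{\mu(H)}S\ \forall H\}$ with $S=\mathbb{Q}[x_1,\dots,x_n]$; $(\mathcal{A},\mu)$ is free if $D(\mathcal{A},\mu)$ is a free $S$-module; $\mathcal{A}$ is totally non-free if $(\mathcal{A},\mu)$ is non-free for every $\mu$ with $\mu\ge1$ everywhere. Graph families: the path-graph $P_n$ has vertices $1,\dots,n$ and edges $\{i,i+1\}$ ($1\le i<n$); the cycle-graph $C_n$ ($n\ge3$) is $P_n$ plus the edge $\{n,1\}$; the almost-path-graph $A_{n,k}$ ($1\le k\le n$) is $P_n$ together with an extra vertex $n+1$ and the edge $\{k,n+1\}$; the path-with-triangle-graph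 $\Delta_{n,k}$ ($1\le k\le n-1$) is $P_n$ together with an extra vertex $n+1$ and edges $\{k,n+1\}$, $\{k+1,n+1\}$. *)

theory Defs
  imports
    "HOL-Analysis.Finite_Cartesian_Product"
    "HOL-Library.Poly_Mapping"
    "HOL-Library.Function_Algebras"
    "Graph_Theory.Graph_Theory"
begin

section \<open>The polynomial ring and its derivations\<close>

text \<open>
  The ring $S = \mathbb{Q}[x_v : v \in V]$ for a finite type $V$ of variables:
  finitely supported maps from monomials (exponent vectors) to coefficients, with the
  convolution product.
\<close>
type_synonym 'v qpoly = "('v \<Rightarrow>\<^sub>0 nat) \<Rightarrow>\<^sub>0 rat"

definition Const :: "rat \<Rightarrow> 'v qpoly" where
  "Const c = Poly_Mapping.single 0 c"

definition Var :: "'v \<Rightarrow> 'v qpoly" where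
  "Var v = Poly_Mapping.single (Poly_Mapping.single v 1) 1"

text \<open>The \<open>\<rat>\<close>-linear maps on $S$ satisfying the Leibniz rule.\<close>
definition derivations :: "('v qpoly \<Rightarrow> 'v qpoly) set" where
  "derivations = {\<theta>. (\<forall>p q. \<theta> (p + q) = \<theta> p + \<theta> q) \<and>
     (\<forall>c p. \<theta> (Const c * p) = Const c * \<theta> p) \<and>
     (\<forall>p q. \<theta> (p * q) = \<theta> p * q + p * \<theta> q)}"

text \<open>The $S$-module of all maps $S \to S$, of which the derivations are a submodule.\<close>
definition der_scale :: "'v qpoly \<Rightarrow> ('v qpoly \<Rightarrow> 'v qpoly) \<Rightarrow> 'v qpoly \<Rightarrow> 'v qpoly" where
  "der_scale f \<theta> = (\<lambda>p. f * \<theta> p)"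

interpretation der: module der_scale
  by standard (auto simp: der_scale_def fun_eq_iff algebra_simps)

definition free_submodule :: "('v qpoly \<Rightarrow> 'v qpoly) set \<Rightarrow> bool" where
  "free_submodule M \<longleftrightarrow> (\<exists>B. der.independent B \<and> der.span B = M)"


section \<open>Multiarrangements\<close>

definition linear_form :: "rat ^ 'v::finite \<Rightarrow> 'v qpoly" where
  "linear_form c = (\<Sum>v\<in>UNIV. Const (c $ v) * Var v)"

definition form_kernel :: "rat ^ 'v::finite \<Rightarrow> (rat ^ 'v) set" where
  "form_kernel c = {x. (\<Sum>v\<in>UNIV. c $ v * x $ v) = 0}"

definition defining_form :: "(rat ^ 'v::finite) set \<Rightarrow> 'v qpoly \<Rightarrow> bool" where
  "defining_form H \<alpha> \<longleftrightarrow> (\<exists>c. c \<noteq> 0 \<and> \<alpha> = linear_form c \<and> H = form_kernel c)"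

text \<open>
  A multiplicity is given by a function on all sets of vectors; only its values on the
  members of the arrangement matter. The form $\alpha_H$ is determined by $H$ up to a nonzero
  scalar, and the divisibility condition is invariant under rescaling it, so it may be imposed
  on all defining forms of $H$ at once.
\<close>
definition multi_derivations ::
    "(rat ^ 'v::finite) set set \<Rightarrow> ((rat ^ 'v) set \<Rightarrow> nat) \<Rightarrow> ('v qpoly \<Rightarrow> 'v qpoly) set" where
  "multi_derivations \<A> \<mu> = {\<theta> \<in> derivations.
     \<forall>H\<in>\<A>. \<forall>\<alpha>. defining_form H \<alpha> \<longrightarrow> \<alpha> ^ \<mu> H dvd \<theta> \<alpha>}"

lemma multi_derivations_subspace: "der.subspace (multi_derivations \<A> \<mu>)"
  by (rule der.subspaceI)
    (auto simp: multi_derivations_def derivations_def der_scale_def algebra_simps)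

definition multi_free :: "(rat ^ 'v::finite) set set \<Rightarrow> ((rat ^ 'v) set \<Rightarrow> nat) \<Rightarrow> bool" where
  "multi_free \<A> \<mu> \<longleftrightarrow> free_submodule (multi_derivations \<A> \<mu>)"

definition totally_non_free :: "(rat ^ 'v::finite) set set \<Rightarrow> bool" where
  "totally_non_free \<A> \<longleftrightarrow> (\<forall>\<mu>. (\<forall>H\<in>\<A>. \<mu> H \<ge> 1) \<longrightarrow> \<not> multi_free \<A> \<mu>)"


section \<open>Connected subgraph arrangements\<close>

text \<open>
  A finite simple graph is a \<^locale>\<open>pair_graph\<close>: a finite loop-free digraph whose set of
  arcs is symmetric, i.e. each edge is represented by its two orientations.
\<close>

definition subset_hyperplane :: "'v set \<Rightarrow> (rat ^ 'v::finite) set" where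
  "subset_hyperplane I = {x. (\<Sum>i\<in>I. x $ i) = 0}"

definition connected_subgraph_arrangement ::
    "'v::finite pair_pre_digraph \<Rightarrow> (rat ^ 'v) set set" where
  "connected_subgraph_arrangement G =
     {subset_hyperplane I | I. I \<noteq> {} \<and> I \<subseteq> pverts G \<and>
        Digraph_Component.connected (induce_subgraph (with_proj G) I)}"

lemma defining_form_subset_hyperplane:
  fixes I :: "'v::finite set"
  assumes "I \<noteq> {}"
  shows "defining_form (subset_hyperplane I) (\<Sum>i\<in>I. Var i)"
proof -
  let ?c = "(\<chi> v. if v \<in> I then 1 else 0) :: rat ^ 'v"
  have "?c \<noteq> 0"
    using assms by (auto simp: vec_eq_iff)
  moreover have "(\<Sum>i\<in>I. Var i) = linear_form ?c"
    unfolding linear_form_def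
    by (rule sum.mono_neutral_cong_left) (auto simp: Const_def single_one)
  moreover have "(\<Sum>i\<in>I. x $ i) = (\<Sum>v\<in>UNIV. ?c $ v * x $ v)" for x :: "rat ^ 'v"
    by (rule sum.mono_neutral_cong_left) auto
  then have "subset_hyperplane I = form_kernel ?c"
    unfolding subset_hyperplane_def form_kernel_def by simp
  ultimately show ?thesis
    unfolding defining_form_def by blast
qed


section \<open>The graph families\<close>

definition undirected :: "nat set \<Rightarrow> (nat \<times> nat) set \<Rightarrow> nat pair_pre_digraph" where
  "undirected V E = \<lparr>pverts = V, parcs = E \<union> E\<inverse>\<rparr>"

definition path_edges :: "nat \<Rightarrow> (nat \<times> nat) set" where
  "path_edges n = {(i, i + 1) | i. 1 \<le> i \<and> i < n}"

definition path_graph :: "nat \<Rightarrow> nat pair_pre_digraph" where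
  "path_graph n = undirected {1..n} (path_edges n)"

definition cycle_graph :: "nat \<Rightarrow> nat pair_pre_digraph" where
  "cycle_graph n = undirected {1..n} (path_edges n \<union> {(n, 1)})"

definition almost_path_graph :: "nat \<Rightarrow> nat \<Rightarrow> nat pair_pre_digraph" where
  "almost_path_graph n k = undirected {1..n + 1} (path_edges n \<union> {(k, n + 1)})"

definition path_with_triangle_graph :: "nat \<Rightarrow> nat \<Rightarrow> nat pair_pre_digraph" where
  "path_with_triangle_graph n k =
     undirected {1..n + 1} (path_edges n \<union> {(k, n + 1), (k + 1, n + 1)})"

definition is_path_graph :: "'v pair_pre_digraph \<Rightarrow> bool" where
  "is_path_graph G \<longleftrightarrow> (\<exists>n\<ge>1. digraph_iso (with_proj G) (with_proj (path_graph n)))"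

definition is_cycle_graph :: "'v pair_pre_digraph \<Rightarrow> bool" where
  "is_cycle_graph G \<longleftrightarrow> (\<exists>n\<ge>3. digraph_iso (with_proj G) (with_proj (cycle_graph n)))"

definition is_almost_path_graph :: "'v pair_pre_digraph \<Rightarrow> bool" where
  "is_almost_path_graph G \<longleftrightarrow> (\<exists>n k. 1 \<le> k \<and> k \<le> n \<and>
     digraph_iso (with_proj G) (with_proj (almost_path_graph n k)))"

definition is_path_with_triangle_graph :: "'v pair_pre_digraph \<Rightarrow> bool" where
  "is_path_with_triangle_graph G \<longleftrightarrow> (\<exists>n k. 1 \<le> k \<and> k < n \<and>
     digraph_iso (with_proj G) (with_proj (path_with_triangle_graph n k)))"

end

theory Submission
  imports Defs "HOL-Computational_Algebra.Polynomial" "HOL-Analysis.Cartesian_Space"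
begin

text \<open>
  Non-freeness is detected locally. Suppose that the indicator vector of a connected
  set is a linear combination, with at least three nonzero coefficients, of independent indicators
  of connected sets, and that no further connected set has its indicator in their span. At a
  generic point of the corresponding flat the arrangement is then locally generic. Some
  polynomial lies outside the ideal of the powers \<open>\<alpha>\<^sub>i ^ \<mu>\<^sub>i\<close> of the independent forms, but its products
  with three of these forms lie inside. It yields three derivations with a linear relation whose
  coefficients are these three forms; in a free module such a relation comes from the Koszul
  complex, which would put the polynomial into the ideal.

  Such configurations occur in a graph containing a hub (a connected set with four neighbouring
  connected sets), an induced cycle with a suitable attachment, a net or a spider with three legs
  of length two. A graph without these is analysed along a longest induced path: every vertex
  outside sees either one interior vertex or two consecutive vertices of the path, and there is
  at most one such vertex, unless the graph is a cycle.

  For the families, the partial sums \<open>y\<^sub>j = x\<^sub>1 + \<dots> + x\<^sub>j\<close> turn the arrangement into a cone over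
  a deformation of the braid arrangement, with the forms \<open>y\<^sub>j - y\<^sub>i\<close>, \<open>w\<close> and \<open>y\<^sub>i - y\<^sub>j - w\<close>
  for some pairs \<open>i < j\<close>. Interpolating the values of a derivation at the \<open>y\<^sub>i\<close> by a polynomial and
  passing to difference quotients with step \<open>w\<close> yields an explicit basis for multiplicity one.
\<close>

text \<open>Arbitrary exponents are harmless because the obstruction uses only two properties of the
  powers. Exponents at least one make all of them vanish at the generic point, so the ideal they
  generate there is proper. Each of the three forms has a power in this ideal, so a polynomial
  outside it can be multiplied by these forms until all three push it in. Three nonzero coefficients
  mean at least four hyperplanes in the relation; this is the point, since multiarrangements of rank
  two are always free. Localization takes place inside the polynomial ring, by multiplying with
  polynomials that do not vanish at the point.

  Closedness of the circuit is the delicate demand on the graph. As indicators take only the values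
  0 and 1, the coefficients of a further connected set can be read off at a few vertices;
  connectivity removes what arithmetic leaves over.

  Five vertices enter where four of them span a diamond or a complete graph: the obstruction then
  uses a further vertex adjacent to them. For the families a single multiplicity suffices, and a
  path counts as an almost-path whose extra vertex prolongs it.\<close>

abbreviation lookup :: "('a \<Rightarrow>\<^sub>0 'b::zero) \<Rightarrow> 'a \<Rightarrow> 'b" where
  "lookup \<equiv> Poly_Mapping.lookup"

abbreviation keys :: "('a \<Rightarrow>\<^sub>0 'b::zero) \<Rightarrow> 'a set" where
  "keys \<equiv> Poly_Mapping.keys"

abbreviation single :: "'a \<Rightarrow> 'b::zero \<Rightarrow> ('a \<Rightarrow>\<^sub>0 'b)" where
  "single \<equiv> Poly_Mapping.single"

section \<open>Evaluation of polynomials\<close>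

text \<open>Evaluation has several targets: the rationals (points), the polynomial ring
  (substitutions) and univariate polynomials over it (derivations). Hence the map on coefficients is
  a parameter.\<close>

definition rat_hom :: "(rat \<Rightarrow> 'b::comm_ring_1) \<Rightarrow> bool" where
  "rat_hom h \<longleftrightarrow> h 0 = 0 \<and> h 1 = 1 \<and> (\<forall>a b. h (a + b) = h a + h b) \<and> (\<forall>a b. h (a * b) = h a * h b)"

lemma rat_homD:
  assumes "rat_hom h"
  shows "h 0 = 0" "h 1 = 1" "h (a + b) = h a + h b" "h (a * b) = h a * h b"
  using assms by (auto simp: rat_hom_def)

lemma Const_0 [simp]: "Const 0 = 0"
  and Const_1 [simp]: "Const 1 = 1"
  and Const_add: "Const (a + b) = Const a + Const b"
  and Const_mult: "Const (a * b) = Const a * Const b"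
  by (simp_all add: Const_def single_one single_add mult_single)

lemma Const_minus: "Const (- a) = - Const a"
  by (simp add: Const_def single_uminus)

lemma Const_diff: "Const (a - b) = Const a - Const b"
  by (simp add: Const_def single_diff)

lemma rat_hom_Const: "rat_hom Const"
  by (simp add: rat_hom_def Const_add Const_mult)

lemma rat_hom_id: "rat_hom (\<lambda>a. a)"
  by (simp add: rat_hom_def)

definition mon_eval :: "('v \<Rightarrow> 'b::comm_ring_1) \<Rightarrow> ('v \<Rightarrow>\<^sub>0 nat) \<Rightarrow> 'b" where
  "mon_eval \<phi> m = (\<Prod>v\<in>keys m. \<phi> v ^ lookup m v)"

definition peval :: "(rat \<Rightarrow> 'b::comm_ring_1) \<Rightarrow> ('v \<Rightarrow> 'b) \<Rightarrow> 'v qpoly \<Rightarrow> 'b" where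
  "peval h \<phi> p = (\<Sum>m\<in>keys p. h (lookup p m) * mon_eval \<phi> m)"

lemma mon_eval_superset:
  assumes "finite A" "keys m \<subseteq> A"
  shows "mon_eval \<phi> m = (\<Prod>v\<in>A. \<phi> v ^ lookup m v)"
  unfolding mon_eval_def using assms
  by (intro prod.mono_neutral_left) (auto simp: in_keys_iff)

lemma mon_eval_add: "mon_eval \<phi> (m + m') = mon_eval \<phi> m * mon_eval \<phi> m'"
proof -
  let ?A = "keys m \<union> keys m'"
  have "keys (m + m') \<subseteq> ?A" by (rule Poly_Mapping.keys_add)
  then show ?thesis
    by (simp add: mon_eval_superset[of ?A] lookup_add power_add prod.distrib)
qed

lemma mon_eval_simps [simp]:
  "mon_eval \<phi> 0 = 1" "mon_eval \<phi> (single v k) = \<phi> v ^ k"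
  by (auto simp: mon_eval_def)

lemma poly_mapping_expand:
  fixes p :: "'a \<Rightarrow>\<^sub>0 'b::comm_monoid_add"
  shows "p = (\<Sum>m\<in>keys p. single m (lookup p m))"
proof (rule poly_mapping_eqI)
  fix k
  have "lookup (\<Sum>m\<in>keys p. single m (lookup p m)) k
      = (\<Sum>m\<in>keys p. if m = k then lookup p m else 0)"
    by (simp add: lookup_sum lookup_single when_def)
  also have "\<dots> = lookup p k"
    by (simp add: in_keys_iff)
  finally show "lookup p k = lookup (\<Sum>m\<in>keys p. single m (lookup p m)) k" by simp
qed

context
  fixes h :: "rat \<Rightarrow> 'b::comm_ring_1" and \<phi> :: "'v \<Rightarrow> 'b"
  assumes h: "rat_hom h"
begin

lemma peval_superset:
  assumes "finite A" "keys p \<subseteq> A"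
  shows "peval h \<phi> p = (\<Sum>m\<in>A. h (lookup p m) * mon_eval \<phi> m)"
  unfolding peval_def using assms
  by (intro sum.mono_neutral_left) (auto simp: in_keys_iff rat_homD[OF h])

lemma peval_0: "peval h \<phi> 0 = 0"
  by (simp add: peval_def)

lemma peval_add: "peval h \<phi> (p + q) = peval h \<phi> p + peval h \<phi> q"
proof -
  let ?A = "keys p \<union> keys q"
  have "keys (p + q) \<subseteq> ?A" by (rule Poly_Mapping.keys_add)
  then show ?thesis
    by (simp add: peval_superset[of ?A] lookup_add rat_homD[OF h] distrib_right sum.distrib)
qed

lemma peval_sum: "peval h \<phi> (\<Sum>i\<in>I. f i) = (\<Sum>i\<in>I. peval h \<phi> (f i))"
  by (induction I rule: infinite_finite_induct) (simp_all add: peval_add peval_0)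

lemma peval_single: "peval h \<phi> (single m a) = h a * mon_eval \<phi> m"
  by (simp add: peval_superset[of "{m}"])

lemma peval_mult: "peval h \<phi> (p * q) = peval h \<phi> p * peval h \<phi> q"
proof -
  have 1: "peval h \<phi> (single m a * single m' b) = peval h \<phi> (single m a) * peval h \<phi> (single m' b)"
    for m a m' b
    by (simp add: mult_single peval_single rat_homD[OF h] mon_eval_add algebra_simps)
  have "peval h \<phi> (p * q) = peval h \<phi> ((\<Sum>m\<in>keys p. single m (lookup p m)) * (\<Sum>m\<in>keys q. single m (lookup q m)))"
    using poly_mapping_expand[of p] poly_mapping_expand[of q] by simp
  also have "\<dots> = peval h \<phi> (\<Sum>m\<in>keys p. single m (lookup p m)) * peval h \<phi> (\<Sum>m\<in>keys q. single m (lookup q m))"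
    by (simp add: sum_product peval_sum 1)
  finally show ?thesis
    using poly_mapping_expand[of p] poly_mapping_expand[of q] by simp
qed

lemma peval_Const: "peval h \<phi> (Const a) = h a"
  by (simp add: Const_def peval_single)

lemma peval_1: "peval h \<phi> 1 = 1"
  using peval_Const[of 1] by (simp add: rat_homD[OF h])

lemma peval_Var: "peval h \<phi> (Var v) = \<phi> v"
  by (simp add: Var_def peval_single rat_homD[OF h])

lemma peval_minus: "peval h \<phi> (- p) = - peval h \<phi> p"
  using peval_add[of p "- p"] by (simp add: peval_0 add_eq_0_iff)

lemma peval_diff: "peval h \<phi> (p - q) = peval h \<phi> p - peval h \<phi> q"
  using peval_add[of p "- q"] by (simp add: peval_minus)

lemma peval_power: "peval h \<phi> (p ^ k) = peval h \<phi> p ^ k"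
  by (induction k) (simp_all add: peval_1 peval_mult)

lemma peval_prod: "peval h \<phi> (\<Prod>i\<in>I. f i) = (\<Prod>i\<in>I. peval h \<phi> (f i))"
  by (induction I rule: infinite_finite_induct) (simp_all add: peval_mult peval_1)

end

lemmas peval_hom = peval_0 peval_1 peval_add peval_mult peval_minus peval_diff peval_sum
  peval_prod peval_power peval_Const peval_Var

lemma peval_linear_form:
  assumes "rat_hom h"
  shows "peval h \<phi> (linear_form c) = (\<Sum>v\<in>UNIV. h (c $ v) * \<phi> v)"
  by (simp add: linear_form_def peval_hom[OF assms])

text \<open>Monomials are products of variables, so constants and variables generate the ring.
  Identities between homomorphisms or derivations thereby reduce to the generators.\<close>

lemma qpoly_induct [case_names Const Var add mult]:
  assumes "\<And>a. P (Const a)" "\<And>v. P (Var v)"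
    and "\<And>p q. P p \<Longrightarrow> P q \<Longrightarrow> P (p + q)" "\<And>p q. P p \<Longrightarrow> P q \<Longrightarrow> P (p * q)"
  shows "P p"
proof -
  have pow: "P (Var v ^ k)" for v k
  proof (induction k)
    case 0
    then show ?case using assms(1)[of 1] by simp
  next
    case (Suc k)
    then show ?case using assms(2,4) by simp
  qed
  have Var_pow: "Var v ^ k = single (single v k) 1" for v k
  proof (induction k)
    case (Suc k)
    then show ?case
      by (simp add: Var_def mult_single flip: single_add)
  qed simp
  have mon: "P (single (\<Sum>v\<in>A. single v (f v)) 1)" if "finite A" for A and f :: "'a \<Rightarrow> nat"
    using that
  proof (induction A rule: finite_induct)
    case empty
    then show ?case using assms(1)[of 1] by simp
  next
    case (insert v A)
    have "single (\<Sum>v\<in>insert v A. single v (f v)) 1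
        = Var v ^ f v * single (\<Sum>v\<in>A. single v (f v)) (1::rat)"
      using insert by (simp add: Var_pow mult_single)
    then show ?case using insert pow assms(4) by simp
  qed
  have "P (single m a)" for m a
  proof -
    have "single m a = Const a * single m 1"
      by (simp add: Const_def mult_single)
    then show ?thesis
      using assms(1,4) mon[of "keys m" "lookup m"] poly_mapping_expand[of m] by simp
  qed
  note single = this
  have "P (\<Sum>m\<in>A. single m (f m))" if "finite A" for A f
    using that
  proof (induction A rule: finite_induct)
    case empty
    then show ?case using assms(1)[of 0] by simp
  qed (use assms(3) single in simp)
  then show ?thesis
    using poly_mapping_expand[of p] by (metis finite_keys)
qed

lemma peval_peval:
  assumes "rat_hom h"
  shows "peval h \<phi> (peval Const \<psi> p) = peval h (\<lambda>v. peval h \<phi> (\<psi> v)) p"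
  by (induction p rule: qpoly_induct)
    (simp_all add: peval_hom[OF assms] peval_hom[OF rat_hom_Const])

lemma peval_Const_Var [simp]: "peval Const Var p = p"
  by (induction p rule: qpoly_induct) (simp_all add: peval_hom[OF rat_hom_Const])

text \<open>The library makes a polynomial ring an integral domain only when its variables are linearly
  ordered, hence the ordered copy of a finite type.\<close>

typedef (overloaded) 'v ordered = "UNIV :: 'v set" morphisms unord ord ..

instantiation ordered :: (finite) linorder
begin

definition ordered_rank :: "'a ordered \<Rightarrow> nat" where
  "ordered_rank = (SOME f. inj f)"

definition less_eq_ordered :: "'a ordered \<Rightarrow> 'a ordered \<Rightarrow> bool" where
  "less_eq_ordered a b \<longleftrightarrow> ordered_rank a \<le> ordered_rank b"

definition less_ordered :: "'a ordered \<Rightarrow> 'a ordered \<Rightarrow> bool" where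
  "less_ordered a b \<longleftrightarrow> ordered_rank a < ordered_rank b"

instance
proof -
  have "finite (UNIV :: 'a ordered set)"
    by (metis (full_types) ex_new_if_finite finite finite_imageI rangeI top_greatest type_definition.Abs_image type_definition_ordered)
  then have "inj (ordered_rank :: 'a ordered \<Rightarrow> nat)"
    unfolding ordered_rank_def by (metis finite_imp_inj_to_nat_seg someI_ex)
  then show "OFCLASS('a ordered, linorder_class)"
    by intro_classes (auto simp: less_eq_ordered_def less_ordered_def dest: injD)
qed

end

lemma unord_ord [simp]: "unord (ord v) = v" "ord (unord v') = v'"
  by (simp_all add: ord_inverse unord_inverse)

definition to_ordered :: "'v qpoly \<Rightarrow> 'v::finite ordered qpoly" where
  "to_ordered = peval Const (\<lambda>v. Var (ord v))"

definition from_ordered :: "'v::finite ordered qpoly \<Rightarrow> 'v qpoly" where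
  "from_ordered = peval Const (\<lambda>v. Var (unord v))"

lemma from_to_ordered [simp]: "from_ordered (to_ordered p) = p"
  by (simp add: from_ordered_def to_ordered_def peval_peval rat_hom_Const peval_Var)

lemma to_from_ordered [simp]: "to_ordered (from_ordered p) = p"
  by (simp add: from_ordered_def to_ordered_def peval_peval rat_hom_Const peval_Var)

lemma to_ordered_eq_iff [simp]: "to_ordered p = to_ordered q \<longleftrightarrow> p = q"
  by (metis from_to_ordered)

lemma to_ordered_mult: "to_ordered (p * q) = to_ordered p * to_ordered q"
  and to_ordered_0: "to_ordered 0 = 0"
  by (simp_all add: to_ordered_def peval_hom[OF rat_hom_Const])

lemma to_ordered_dvd_iff [simp]: "to_ordered p dvd to_ordered q \<longleftrightarrow> p dvd q"
proof
  assume "to_ordered p dvd to_ordered q"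
  then obtain r where "to_ordered q = to_ordered p * r" ..
  then have "to_ordered q = to_ordered (p * from_ordered r)"
    by (simp add: to_ordered_mult)
  then show "p dvd q" by simp
qed (auto simp: dvd_def to_ordered_mult)

text \<open>Transport along the isomorphism \<open>to_ordered\<close>, whose target is an integral
  domain.\<close>

lemma qpoly_mult_eq_0_iff: "p * q = 0 \<longleftrightarrow> p = 0 \<or> q = (0 :: 'v::finite qpoly)"
proof -
  have 0: "to_ordered r = 0 \<longleftrightarrow> r = 0" for r :: "'v qpoly"
    using to_ordered_eq_iff[of r 0] unfolding to_ordered_0 .
  show ?thesis
    using 0[of "p * q"] 0[of p] 0[of q] by (simp add: to_ordered_mult)
qed

lemma qpoly_mult_left_cancel: "p \<noteq> 0 \<Longrightarrow> p * q = p * r \<longleftrightarrow> q = (r :: 'v::finite qpoly)"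
  using qpoly_mult_eq_0_iff[of p "q - r"] by (auto simp: algebra_simps)

section \<open>Linear forms\<close>

definition dot :: "rat ^ 'v::finite \<Rightarrow> rat ^ 'v \<Rightarrow> rat" where
  "dot c x = (\<Sum>v\<in>UNIV. c $ v * x $ v)"

abbreviation pt_eval :: "rat ^ 'v::finite \<Rightarrow> 'v qpoly \<Rightarrow> rat" where
  "pt_eval x \<equiv> peval (\<lambda>a. a) (($) x)"

lemma pt_eval_linear_form [simp]: "pt_eval x (linear_form c) = dot c x"
  by (simp add: peval_linear_form rat_hom_id dot_def)

lemma linear_form_nonzero: "dot c x \<noteq> 0 \<Longrightarrow> linear_form c \<noteq> 0"
  by (metis pt_eval_linear_form peval_0 rat_hom_id)

lemma linear_form_neq_0: "c \<noteq> 0 \<Longrightarrow> linear_form c \<noteq> 0"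
proof -
  assume "c \<noteq> 0"
  then obtain v where "c $ v \<noteq> 0" by (auto simp: vec_eq_iff)
  then have "dot c (axis v 1) \<noteq> 0"
    by (simp add: dot_def axis_def if_distrib[of "\<lambda>x. _ * x"] cong: if_cong)
  then show ?thesis by (rule linear_form_nonzero)
qed

lemma linear_form_add: "linear_form (c + d) = linear_form c + linear_form d"
  and linear_form_minus: "linear_form (- c) = - linear_form c"
  and linear_form_diff: "linear_form (c - d) = linear_form c - linear_form d"
  and linear_form_scale: "linear_form (a *s c) = Const a * linear_form c"
  and linear_form_0 [simp]: "linear_form 0 = 0"
  by (simp_all add: linear_form_def Const_add Const_minus Const_mult Const_diff distrib_right
      sum.distrib sum_distrib_left sum_negf left_diff_distrib sum_subtractf mult.assoc)

lemma dvd_peval_diff: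
  assumes "\<And>v. \<alpha> dvd \<phi> v - Var v"
  shows "\<alpha> dvd peval Const \<phi> p - p"
proof (induction p rule: qpoly_induct)
  case (add p q)
  then have "\<alpha> dvd (peval Const \<phi> p - p) + (peval Const \<phi> q - q)" by (rule dvd_add)
  then show ?case by (simp add: peval_hom[OF rat_hom_Const] algebra_simps)
next
  case (mult p q)
  then have "\<alpha> dvd (peval Const \<phi> p - p) * peval Const \<phi> q + p * (peval Const \<phi> q - q)"
    by simp
  then show ?case by (simp add: peval_hom[OF rat_hom_Const] algebra_simps)
qed (use assms in \<open>simp_all add: peval_hom[OF rat_hom_Const]\<close>)

text \<open>The residue ring modulo \<open>c\<close> is realised inside the polynomial ring:
  \<open>\<sigma>\<close> solves \<open>c = 0\<close> for a variable with nonzero coefficient and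
  substitutes the solution. In this way residues live in a domain and residues of linear forms stay
  linear.\<close>

lemma linear_form_elim:
  fixes c :: "rat ^ 'v::finite"
  assumes "c \<noteq> 0"
  shows "\<exists>\<sigma>. (\<forall>d. \<exists>d'. \<sigma> (linear_form d) = linear_form d' \<and> (\<forall>x. dot c x = 0 \<longrightarrow> dot d' x = dot d x)) \<and>
    (\<forall>p q. \<sigma> (p * q) = \<sigma> p * \<sigma> q) \<and> (\<forall>p q. \<sigma> (p - q) = \<sigma> p - \<sigma> q) \<and>
    (\<forall>p. linear_form c dvd \<sigma> p - p) \<and> (\<forall>p. linear_form c dvd p \<longrightarrow> \<sigma> p = 0)"
proof -
  obtain u where u: "c $ u \<noteq> 0" using assms by (auto simp: vec_eq_iff)
  define \<phi> where "\<phi> v = (if v = u then Var u - Const (1 / c $ u) * linear_form c else Var v)" for v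
  define \<sigma> where "\<sigma> = peval Const \<phi>"
  have \<phi>: "\<phi> v = Var v - (if v = u then Const (1 / c $ u) * linear_form c else 0)" for v
    by (simp add: \<phi>_def)
  have lin: "\<sigma> (linear_form d) = linear_form (d - (d $ u / c $ u) *s c)" for d
  proof -
    have "\<sigma> (linear_form d) = (\<Sum>v\<in>UNIV. Const (d $ v) * \<phi> v)"
      by (simp add: \<sigma>_def peval_linear_form rat_hom_Const)
    also have "\<dots> = linear_form d - Const (d $ u) * (Const (1 / c $ u) * linear_form c)"
      unfolding \<phi> linear_form_def[of d]
      by (simp add: right_diff_distrib sum_subtractf if_distrib[of "\<lambda>x. _ * x"] cong: if_cong)
    also have "\<dots> = linear_form (d - (d $ u / c $ u) *s c)"
      by (simp add: linear_form_diff linear_form_scale flip: mult.assoc Const_mult)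
    finally show ?thesis .
  qed
  have cc: "\<sigma> (linear_form c) = 0"
    using u by (simp add: lin)
  show ?thesis
  proof (intro exI[of _ \<sigma>] conjI allI impI)
    fix d
    have "dot (d - (d $ u / c $ u) *s c) x = dot d x" if "dot c x = 0" for x
    proof -
      have "dot (d - (d $ u / c $ u) *s c) x = dot d x - (d $ u / c $ u) * dot c x"
        by (simp add: dot_def sum_subtractf left_diff_distrib sum_distrib_left mult.assoc)
      then show ?thesis using that by simp
    qed
    then show "\<exists>d'. \<sigma> (linear_form d) = linear_form d' \<and> (\<forall>x. dot c x = 0 \<longrightarrow> dot d' x = dot d x)"
      using lin by blast
  next
    fix p
    show "linear_form c dvd \<sigma> p - p"
      unfolding \<sigma>_def by (rule dvd_peval_diff) (simp add: \<phi>_def)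
    show "linear_form c dvd p \<Longrightarrow> \<sigma> p = 0"
      using cc by (auto simp: dvd_def \<sigma>_def peval_hom[OF rat_hom_Const])
  qed (simp_all add: \<sigma>_def peval_hom[OF rat_hom_Const])
qed

text \<open>The residue of \<open>d\<close> modulo \<open>c\<close> is nonzero, because its value at
  \<open>x\<close> is still \<open>dot d x\<close>, and residues have no zero divisors. The point
  \<open>x\<close> certifies that the two forms are not proportional.\<close>

lemma linear_form_coprime:
  fixes c d :: "rat ^ 'v::finite"
  assumes dvd: "linear_form c dvd linear_form d * f" and "c \<noteq> 0"
    and x: "dot c x = 0" "dot d x \<noteq> 0"
  shows "linear_form c dvd f"
proof -
  obtain \<sigma> where lin: "\<forall>d. \<exists>d'. \<sigma> (linear_form d) = linear_form d' \<and> (\<forall>x. dot c x = 0 \<longrightarrow> dot d' x = dot d x)"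
    and mult: "\<forall>p q. \<sigma> (p * q) = \<sigma> p * \<sigma> q"
    and diff: "\<forall>p. linear_form c dvd \<sigma> p - p"
    and dvd0: "\<forall>p. linear_form c dvd p \<longrightarrow> \<sigma> p = 0"
    using linear_form_elim[OF \<open>c \<noteq> 0\<close>] by (elim exE conjE) (rule that)
  have "\<sigma> (linear_form d) \<noteq> 0"
    using lin[rule_format, of d] x linear_form_nonzero by metis
  moreover have "\<sigma> (linear_form d) * \<sigma> f = 0"
    using dvd0[rule_format, OF dvd] mult by simp
  ultimately have "\<sigma> f = 0"
    by (simp add: qpoly_mult_eq_0_iff)
  then show ?thesis
    using diff[rule_format, of f] by simp
qed

lemma dot_simps [simp]:
  "dot (c + d) x = dot c x + dot d x" "dot (c - d) x = dot c x - dot d x" "dot (- c) x = - dot c x"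
  "dot (a *s c) x = a * dot c x" "dot 0 x = 0"
  "dot c (x + y) = dot c x + dot c y" "dot c (x - y) = dot c x - dot c y" "dot c (a *s x) = a * dot c x" "dot c 0 = 0"
  by (simp_all add: dot_def algebra_simps sum.distrib sum_subtractf sum_negf sum_distrib_left)

lemma dot_sum: "dot (\<Sum>i\<in>I. f i) x = (\<Sum>i\<in>I. dot (f i) x)"
  by (induction I rule: infinite_finite_induct) simp_all

lemma dot_separates:
  fixes v :: "rat ^ 'v::finite"
  assumes "v \<notin> vec.span T"
  shows "\<exists>x. dot v x \<noteq> 0 \<and> (\<forall>t\<in>T. dot t x = 0)"
proof -
  obtain B where B: "B \<subseteq> T" "vec.independent B" "T \<subseteq> vec.span B"
    by (rule vec.maximal_independent_subset)
  have v: "v \<notin> vec.span B"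
    using assms B(1) vec.span_mono by blast
  then have "vec.independent (insert v B)"
    using B(2) by (simp add: vec.independent_insertI)
  then obtain f :: "rat ^ 'v \<Rightarrow> rat ^ 'v" where f: "Vector_Spaces.linear (*s) (*s) f"
      "\<forall>b\<in>insert v B. f b = (if b = v then axis undefined 1 else 0)"
    using vec.linear_independent_extend[of "insert v B" "\<lambda>b. if b = v then axis undefined 1 else 0"] by blast
  \<comment> \<open>Only one row of the endomorphism \<open>f\<close> matters, at an arbitrary
    coordinate: it represents a functional that is 1 at \<open>v\<close> and 0 on
    \<open>B\<close>.\<close>
  define x where "x = (\<chi> w. matrix f $ undefined $ w)"
  have dot: "dot c x = f c $ undefined" for c
  proof -
    have "dot c x = (matrix f *v c) $ undefined"
      by (simp add: dot_def x_def matrix_vector_mult_def mult.commute)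
    then show ?thesis using f(1) by (simp add: matrix_works)
  qed
  show ?thesis
  proof (intro exI[of _ x] conjI ballI)
    show "dot v x \<noteq> 0" using f(2) by (simp add: dot)
    fix t assume "t \<in> T"
    then have "t \<in> vec.span B" using B by blast
    then show "dot t x = 0"
    proof (induction rule: vec.span_induct_alt)
      case (step c b y)
      have "b \<noteq> v" using v step.hyps vec.span_base by blast
      then have "dot b x = 0" using f(2) step.hyps by (simp add: dot)
      then show ?case using step by simp
    qed simp
  qed
qed

text \<open>A space over an infinite field is not a finite union of hyperplanes. In the induction
  step one moves from a point \<open>x\<close> that is good for the old forms in a direction
  \<open>y\<close> on which the new form is nonzero; each form vanishes for at most one parameter on
  this line.\<close>

lemma dot_avoid:
  fixes L :: "(rat ^ 'v::finite) set"
  assumes "finite L" and "\<And>v. v \<in> L \<Longrightarrow> \<exists>x\<in>W. dot v x \<noteq> 0"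
    and "0 \<in> W" "\<And>x y a. x \<in> W \<Longrightarrow> y \<in> W \<Longrightarrow> x + a *s y \<in> W"
  shows "\<exists>x\<in>W. \<forall>v\<in>L. dot v x \<noteq> 0"
  using assms(1,2)
proof (induction L)
  case empty
  then show ?case using assms(3) by auto
next
  case (insert v L)
  obtain x where x: "x \<in> W" "\<forall>u\<in>L. dot u x \<noteq> 0" using insert by auto
  obtain y where y: "y \<in> W" "dot v y \<noteq> 0" using insert by auto
  have "finite {a. dot u x + a * dot u y = 0}" if "u \<in> insert v L" for u
  proof (cases "dot u y = 0")
    case True
    then show ?thesis using that x y by auto
  next
    case False
    then have "{a. dot u x + a * dot u y = 0} \<subseteq> {- dot u x / dot u y}"
      by (auto simp: field_simps)
    then show ?thesis by (rule finite_subset) simp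
  qed
  then have fin: "finite (\<Union>u\<in>insert v L. {a. dot u x + a * dot u y = 0})"
    using insert.hyps by blast
  obtain a where "a \<notin> (\<Union>u\<in>insert v L. {a. dot u x + a * dot u y = 0})"
    using ex_new_if_finite[OF infinite_UNIV_char_0 fin] by (elim exE) (rule that)
  then have "\<forall>u\<in>insert v L. dot u (x + a *s y) \<noteq> 0" by auto
  then show ?case using assms(4)[OF x(1) y(1)] by blast
qed

section \<open>Derivations\<close>

lemma derivationsD:
  assumes "\<theta> \<in> derivations"
  shows "\<theta> (p + q) = \<theta> p + \<theta> q" "\<theta> (Const c * p) = Const c * \<theta> p" "\<theta> (p * q) = \<theta> p * q + p * \<theta> q"
  using assms by (auto simp: derivations_def)

lemma derivation_Const: "\<theta> \<in> derivations \<Longrightarrow> \<theta> (Const a) = 0"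
  using derivationsD(3)[of \<theta> 1 1] derivationsD(2)[of \<theta> a 1] by simp

lemma derivation_sum:
  assumes "\<theta> \<in> derivations"
  shows "\<theta> (\<Sum>i\<in>I. f i) = (\<Sum>i\<in>I. \<theta> (f i))"
proof -
  have "\<theta> 0 = 0" using derivation_Const[OF assms, of 0] by simp
  then show ?thesis
    by (induction I rule: infinite_finite_induct) (simp_all add: derivationsD(1)[OF assms])
qed

lemma derivation_linear_form:
  assumes "\<theta> \<in> derivations"
  shows "\<theta> (linear_form c) = (\<Sum>v\<in>UNIV. Const (c $ v) * \<theta> (Var v))"
  by (simp add: linear_form_def derivation_sum[OF assms] derivationsD(2)[OF assms])

lemma derivation_eqI:
  assumes "\<theta> \<in> derivations" "\<theta>' \<in> derivations" "\<And>v. \<theta> (Var v) = \<theta>' (Var v)"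
  shows "\<theta> = \<theta>'"
proof
  fix p
  show "\<theta> p = \<theta>' p"
    by (induction p rule: qpoly_induct)
      (simp_all add: assms(3) derivation_Const[OF assms(1)] derivation_Const[OF assms(2)]
        derivationsD[OF assms(1)] derivationsD[OF assms(2)])
qed

text \<open>The derivation with prescribed values on the variables, read off from the substitution
  \<open>x\<^sub>v \<mapsto> x\<^sub>v + \<epsilon> f\<^sub>v\<close> as the coefficient of \<open>\<epsilon>\<close>.\<close>

definition der_with :: "('v \<Rightarrow> 'v qpoly) \<Rightarrow> 'v qpoly \<Rightarrow> 'v qpoly" where
  "der_with f p = coeff (peval (\<lambda>a. [:Const a:]) (\<lambda>v. [:Var v, f v:]) p) 1"

lemma rat_hom_pConst: "rat_hom (\<lambda>a. [:Const a:])"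
  by (simp add: rat_hom_def Const_add Const_mult one_pCons)

lemma der_with_derivation: "der_with f \<in> derivations"
proof -
  let ?e = "peval (\<lambda>a. [:Const a:]) (\<lambda>v. [:Var v, f v:])"
  note hom = peval_hom[OF rat_hom_pConst]
  have 0: "coeff (?e p) 0 = p" for p
    by (induction p rule: qpoly_induct) (simp_all add: hom coeff_mult_0)
  have 1: "coeff (a * b) 1 = coeff a 1 * coeff b 0 + coeff a 0 * coeff b 1" for a b :: "'a qpoly poly"
    by (simp add: coeff_mult)
  show ?thesis
    unfolding derivations_def der_with_def
    by (auto simp only: hom 1 0 mem_Collect_eq coeff_add) (simp_all add: algebra_simps coeff_pCons)
qed

lemma der_with_Var [simp]: "der_with f (Var v) = f v"
  by (simp add: der_with_def peval_hom[OF rat_hom_pConst])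

section \<open>Hyperplanes of subsets\<close>

definition ind :: "'v set \<Rightarrow> rat ^ 'v::finite" where
  "ind I = (\<chi> v. if v \<in> I then 1 else 0)"

lemma ind_nth [simp]: "ind I $ v = (if v \<in> I then 1 else 0)"
  by (simp add: ind_def)

lemma ind_inject [simp]: "ind I = ind J \<longleftrightarrow> I = J"
  by (auto simp: vec_eq_iff split: if_splits)

lemma ind_eq_0_iff [simp]: "ind I = 0 \<longleftrightarrow> I = {}"
  by (auto simp: vec_eq_iff)

lemma linear_form_ind: "linear_form (ind I) = (\<Sum>i\<in>I. Var i)"
  unfolding linear_form_def by (rule sum.mono_neutral_cong_right) auto

lemma form_kernel_dot: "form_kernel c = {x. dot c x = 0}"
  by (simp add: form_kernel_def dot_def)

lemma subset_hyperplane_dot: "subset_hyperplane I = {x. dot (ind I) x = 0}"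
proof -
  have "dot (ind I) x = (\<Sum>i\<in>I. x $ i)" for x
    unfolding dot_def by (rule sum.mono_neutral_cong_right) auto
  then show ?thesis by (simp add: subset_hyperplane_def)
qed

lemma dot_axis: "dot c (axis v 1) = c $ v"
  by (simp add: dot_def axis_def if_distrib[of "\<lambda>x. _ * x"] cong: if_cong)

lemma form_kernel_eqD:
  assumes "form_kernel c = form_kernel d" "d \<noteq> 0" "c \<noteq> 0"
  obtains a where "a \<noteq> 0" "c = a *s d"
proof -
  obtain u where u: "d $ u \<noteq> 0" using \<open>d \<noteq> 0\<close> by (auto simp: vec_eq_iff)
  have eq: "c $ v = c $ u / d $ u * d $ v" for v
  proof -
    \<comment> \<open>This vector lies in the kernel of \<open>d\<close>; applying \<open>c\<close>
      to it compares the coordinates \<open>u\<close> and \<open>v\<close>.\<close>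
    have "axis v 1 + (- (d $ v / d $ u)) *s axis u 1 \<in> form_kernel c"
      unfolding assms(1) using u by (simp add: form_kernel_dot dot_axis)
    then show ?thesis using u by (simp add: form_kernel_dot dot_axis field_simps)
  qed
  have c: "c = (c $ u / d $ u) *s d"
    unfolding vec_eq_iff vector_smult_component using eq by blast
  have "c $ u / d $ u \<noteq> 0" using c \<open>c \<noteq> 0\<close> by (metis vec.scale_zero_left)
  then show thesis using c by (rule that)
qed

definition subset_arrangement :: "'v set set \<Rightarrow> (rat ^ 'v::finite) set set" where
  "subset_arrangement \<F> = subset_hyperplane ` \<F>"

lemma Const_dvd_one: "a \<noteq> 0 \<Longrightarrow> Const a dvd 1"
  by (rule dvdI[of _ _ "Const (1 / a)"]) (simp flip: Const_mult)

text \<open>All defining forms of a hyperplane are multiples of the indicator form by nonzero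
  constants, which are units, so one divisibility test per hyperplane is enough.\<close>

lemma multi_derivations_subset_arrangement:
  fixes \<F> :: "'v::finite set set"
  assumes "{} \<notin> \<F>"
  shows "\<theta> \<in> multi_derivations (subset_arrangement \<F>) \<mu> \<longleftrightarrow> \<theta> \<in> derivations \<and>
    (\<forall>I\<in>\<F>. linear_form (ind I) ^ \<mu> (subset_hyperplane I) dvd \<theta> (linear_form (ind I)))"
proof -
  have "(\<forall>\<alpha>. defining_form (subset_hyperplane I) \<alpha> \<longrightarrow> \<alpha> ^ k dvd \<theta> \<alpha>) \<longleftrightarrow>
      linear_form (ind I) ^ k dvd \<theta> (linear_form (ind I))"
    if "I \<in> \<F>" "\<theta> \<in> derivations" for I :: "'v set" and k
  proof
    have I: "I \<noteq> {}" using that assms by auto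
    assume "\<forall>\<alpha>. defining_form (subset_hyperplane I) \<alpha> \<longrightarrow> \<alpha> ^ k dvd \<theta> \<alpha>"
    then show "linear_form (ind I) ^ k dvd \<theta> (linear_form (ind I))"
      using defining_form_subset_hyperplane[OF I] by (simp add: linear_form_ind)
  next
    have I: "I \<noteq> {}" using that assms by auto
    assume *: "linear_form (ind I) ^ k dvd \<theta> (linear_form (ind I))"
    show "\<forall>\<alpha>. defining_form (subset_hyperplane I) \<alpha> \<longrightarrow> \<alpha> ^ k dvd \<theta> \<alpha>"
    proof (intro allI impI)
      fix \<alpha> :: "'v qpoly" assume "defining_form (subset_hyperplane I) \<alpha>"
      then obtain c where c: "c \<noteq> 0" "\<alpha> = linear_form c" "subset_hyperplane I = form_kernel c"
        by (auto simp: defining_form_def)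
      have "form_kernel c = form_kernel (ind I)"
        using c(3) by (simp add: subset_hyperplane_dot form_kernel_dot)
      then obtain a where a: "a \<noteq> 0" "c = a *s ind I"
        using form_kernel_eqD c(1) I by (metis ind_eq_0_iff)
      have \<alpha>: "\<alpha> = Const a * linear_form (ind I)"
        by (simp add: c(2) a(2) linear_form_scale)
      have "Const a ^ k dvd 1" using Const_dvd_one[OF a(1)] dvd_power_same[of "Const a" 1 k] by simp
      then have "Const a ^ k * linear_form (ind I) ^ k dvd 1 * \<theta> (linear_form (ind I))"
        using * by (rule mult_dvd_mono)
      then have "\<alpha> ^ k dvd \<theta> (linear_form (ind I))"
        by (simp add: \<alpha> power_mult_distrib)
      then show "\<alpha> ^ k dvd \<theta> \<alpha>"
        unfolding \<alpha> derivationsD(2)[OF that(2)] by simp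
    qed
  qed
  then show ?thesis
    unfolding multi_derivations_def subset_arrangement_def by auto
qed

lemma connected_subgraph_arrangement_eq:
  "connected_subgraph_arrangement G = subset_arrangement
     {I. I \<noteq> {} \<and> I \<subseteq> pverts G \<and> Digraph_Component.connected (induce_subgraph (with_proj G) I)}"
  by (auto simp: connected_subgraph_arrangement_def subset_arrangement_def)

section \<open>Free modules of derivations\<close>

text \<open>Turns an indexed basis into a basis set: two equal members at different indices would
  satisfy a relation with coefficients 1 and -1, so the indexing is injective.\<close>

lemma free_submoduleI:
  fixes b :: "'i \<Rightarrow> 'v qpoly \<Rightarrow> 'v qpoly"
  assumes "finite T" "der.subspace M" "\<And>s. s \<in> T \<Longrightarrow> b s \<in> M"
    and span: "\<And>\<theta>. \<theta> \<in> M \<Longrightarrow> \<exists>c. \<theta> = (\<Sum>s\<in>T. der_scale (c s) (b s))"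
    and indep: "\<And>c. (\<Sum>s\<in>T. der_scale (c s) (b s)) = 0 \<Longrightarrow> \<forall>s\<in>T. c s = 0"
  shows "free_submodule M"
proof -
  have inj: "inj_on b T"
  proof (rule inj_onI, rule ccontr)
    fix s t assume st: "s \<in> T" "t \<in> T" "b s = b t" "s \<noteq> t"
    let ?c = "\<lambda>r. if r = s then 1 else if r = t then - 1 else 0 :: 'v qpoly"
    have "(\<Sum>r\<in>T. der_scale (?c r) (b r)) = (\<Sum>r\<in>{s, t}. der_scale (?c r) (b r))"
      using st assms(1) by (intro sum.mono_neutral_right) (auto simp: der.scale_zero_left)
    also have "\<dots> = 0" using st by (simp add: der.scale_one der.scale_minus_left)
    finally show False using indep[of ?c] st(1) by auto
  qed
  have "der.independent (b ` T)"
  proof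
    assume "der.dependent (b ` T)"
    then obtain u where u: "(\<Sum>v\<in>b ` T. der_scale (u v) v) = 0" "\<exists>v\<in>b ` T. u v \<noteq> 0"
      using assms(1) by (auto simp: der.dependent_finite)
    then have "(\<Sum>s\<in>T. der_scale (u (b s)) (b s)) = 0"
      by (simp add: sum.reindex[OF inj])
    from indep[OF this] show False using u(2) by auto
  qed
  moreover have "der.span (b ` T) = M"
  proof
    show "der.span (b ` T) \<subseteq> M" using assms(2,3) by (intro der.span_minimal) auto
    show "M \<subseteq> der.span (b ` T)"
    proof
      fix \<theta> assume "\<theta> \<in> M"
      then obtain c where "\<theta> = (\<Sum>s\<in>T. der_scale (c s) (b s))" using span by blast
      then show "\<theta> \<in> der.span (b ` T)"
        by (simp add: der.span_sum der.span_scale der.span_base)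
    qed
  qed
  ultimately show ?thesis unfolding free_submodule_def by blast
qed

text \<open>Exactness of the Koszul complex passes from the ring to free modules.\<close>

lemma free_submodule_koszul:
  assumes "free_submodule M" and "p \<in> M" "q \<in> M" "r \<in> M"
    and eq: "der_scale z p - der_scale y q + der_scale x r = 0"
    and coeff: "\<And>f g h. z * f - y * g + x * h = 0 \<Longrightarrow> \<exists>a b. f = y * a - x * b"
  shows "\<exists>A\<in>M. \<exists>B\<in>M. p = der_scale y A - der_scale x B"
proof -
  obtain B where B: "der.independent B" "der.span B = M"
    using assms(1) by (auto simp: free_submodule_def)
  let ?R = "der.representation B"
  have mem: "p \<in> der.span B" "q \<in> der.span B" "r \<in> der.span B"
    using B assms by auto
  \<comment> \<open>The relation holds in every coordinate of the basis, where the hypothesis on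
    ring elements applies; the result is reassembled over the finite support of
    \<open>p\<close>.\<close>
  have "z * ?R p b - y * ?R q b + x * ?R r b = 0" for b
  proof -
    have "?R (der_scale z p - der_scale y q + der_scale x r) b = z * ?R p b - y * ?R q b + x * ?R r b"
      using B(1) mem by (simp add: der.representation_add der.representation_diff
          der.representation_scale der.span_scale der.span_diff)
    then show ?thesis by (simp add: eq der.representation_zero)
  qed
  then have "\<forall>b. \<exists>c d. ?R p b = y * c - x * d"
    using coeff by blast
  then obtain c d where cd: "\<And>b. ?R p b = y * c b - x * d b"
    by metis
  define T where "T = {b. ?R p b \<noteq> 0}"
  have T: "finite T" "T \<subseteq> B"
    unfolding T_def by (auto simp: der.finite_representation dest: der.representation_ne_zero)
  have "p = (\<Sum>b\<in>T. der_scale (?R p b) b)"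
    unfolding T_def using der.sum_nonzero_representation_eq[OF B(1) mem(1)] by simp
  also have "\<dots> = der_scale y (\<Sum>b\<in>T. der_scale (c b) b) - der_scale x (\<Sum>b\<in>T. der_scale (d b) b)"
    by (simp add: cd der.scale_sum_right der.scale_left_diff_distrib sum_subtractf)
  finally show ?thesis
    using B(2) T(2) by (metis (no_types, lifting) der.span_base der.span_scale der.span_sum subset_iff)
qed

section \<open>Generic localizations obstruct freeness\<close>

lemma derivations_subspace: "der.subspace derivations"
  by (rule der.subspaceI) (auto simp: derivations_def der_scale_def algebra_simps)

text \<open>Three independent forms are a regular sequence: modulo \<open>c1\<close> the relation
  says that \<open>c2\<close> divides \<open>c3 * f\<close>, hence \<open>f\<close>. The points
  \<open>e2\<close> and \<open>e3\<close> certify the independence.\<close>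

lemma linear_form_koszul:
  fixes c1 c2 c3 :: "rat ^ 'v::finite"
  assumes e2: "dot c1 e2 = 0" "dot c2 e2 \<noteq> 0" and e3: "dot c1 e3 = 0" "dot c2 e3 = 0" "dot c3 e3 \<noteq> 0"
    and c1: "c1 \<noteq> 0"
    and eq: "linear_form c3 * f - linear_form c2 * g + linear_form c1 * h = 0"
  shows "\<exists>a b. f = linear_form c2 * a - linear_form c1 * b"
proof -
  obtain \<sigma> where lin: "\<forall>d. \<exists>d'. \<sigma> (linear_form d) = linear_form d' \<and> (\<forall>x. dot c1 x = 0 \<longrightarrow> dot d' x = dot d x)"
    and mult: "\<forall>p q. \<sigma> (p * q) = \<sigma> p * \<sigma> q"
    and diff: "\<forall>p q. \<sigma> (p - q) = \<sigma> p - \<sigma> q"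
    and dvd: "\<forall>p. linear_form c1 dvd \<sigma> p - p"
    and dvd0: "\<forall>p. linear_form c1 dvd p \<longrightarrow> \<sigma> p = 0"
    using linear_form_elim[OF c1] by (elim exE conjE) (rule that)
  obtain d2 where d2: "\<sigma> (linear_form c2) = linear_form d2" "\<forall>x. dot c1 x = 0 \<longrightarrow> dot d2 x = dot c2 x"
    using lin by blast
  obtain d3 where d3: "\<sigma> (linear_form c3) = linear_form d3" "\<forall>x. dot c1 x = 0 \<longrightarrow> dot d3 x = dot c3 x"
    using lin by blast
  have "linear_form c3 * f - linear_form c2 * g = linear_form c1 * (- h)"
    using eq by (simp add: algebra_simps add_eq_0_iff)
  then have "\<sigma> (linear_form c3 * f - linear_form c2 * g) = 0"
    using dvd0 by simp
  then have "linear_form d3 * \<sigma> f = linear_form d2 * \<sigma> g"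
    by (simp add: mult diff d2(1) d3(1))
  then have "linear_form d2 dvd linear_form d3 * \<sigma> f" by simp
  then have "linear_form d2 dvd \<sigma> f"
    by (rule linear_form_coprime[where x = e3]) (use d2(2) d3(2) e2 e3 in auto)
  then obtain k where k: "\<sigma> f = linear_form d2 * k" ..
  obtain a where a: "\<sigma> f - f = linear_form c1 * a" using dvd by blast
  obtain b where b: "linear_form d2 - linear_form c2 = linear_form c1 * b"
    using dvd[rule_format, of "linear_form c2"] by (auto simp: d2(1))
  have "linear_form d2 = linear_form c2 + linear_form c1 * b"
    using b by (simp add: algebra_simps)
  then have "f = linear_form c2 * k - linear_form c1 * (a - b * k)"
    using a k by (simp add: algebra_simps)
  then show ?thesis by blast
qed

text \<open>The exponent is the last one before the powers of \<open>\<alpha>\<close> carry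
  \<open>s\<close> into \<open>J\<close>. Here \<open>J\<close> stands for membership in an
  ideal.\<close>

lemma maximal_power_not_in:
  fixes \<alpha> :: "'a::comm_monoid_mult"
  assumes "\<not> J s" "J (\<alpha> ^ m * s)"
  shows "\<exists>i. \<not> J (\<alpha> ^ i * s) \<and> J (\<alpha> * (\<alpha> ^ i * s))"
  using assms(2)
proof (induction m)
  case (Suc m)
  then show ?case by (cases "J (\<alpha> ^ m * s)") (auto simp: mult.assoc)
qed (use assms in simp)

text \<open>By \<open>closed\<close>, the hyperplanes through a generic point of the flat are
  exactly those of \<open>insert I0 \<S>\<close>. Members of \<open>\<S>\<close> with coefficient
  zero are allowed; they lie outside the circuit and are independent of it.\<close>

lemma not_multi_free_if_generic_localization:
  fixes \<F> :: "'v::finite set set"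
  assumes \<F>: "{} \<notin> \<F>" "\<S> \<subseteq> \<F>" "I0 \<in> \<F>"
    and indep: "\<And>l. (\<Sum>I\<in>\<S>. l I *s ind I) = 0 \<Longrightarrow> \<forall>I\<in>\<S>. l I = 0"
    and I0: "ind I0 = (\<Sum>I\<in>\<S>. a I *s ind I)"
    and I: "I1 \<in> \<S>" "I2 \<in> \<S>" "I3 \<in> \<S>" "I1 \<noteq> I2" "I1 \<noteq> I3" "I2 \<noteq> I3" "a I1 \<noteq> 0" "a I2 \<noteq> 0" "a I3 \<noteq> 0"
    and closed: "\<And>I l. I \<in> \<F> \<Longrightarrow> ind I = (\<Sum>J\<in>\<S>. l J *s ind J) \<Longrightarrow> I \<in> insert I0 \<S>"
    and \<mu>: "\<And>H. H \<in> subset_arrangement \<F> \<Longrightarrow> \<mu> H \<ge> 1"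
  shows "\<not> multi_free (subset_arrangement \<F>) \<mu>"
proof
  assume free: "multi_free (subset_arrangement \<F>) \<mu>"
  define M where "M = multi_derivations (subset_arrangement \<F>) \<mu>"
  have fin: "finite \<S>" "finite \<F>" by simp_all
  define m where "m I = \<mu> (subset_hyperplane I)" for I :: "'v set"
  have m: "m I \<ge> 1" if "I \<in> \<F>" for I
    using \<mu> that by (auto simp: m_def subset_arrangement_def)
  define \<alpha> where "\<alpha> I = linear_form (ind I)" for I :: "'v set"
  define \<beta> where "\<beta> I = \<alpha> I ^ m I" for I
  have M_iff: "\<theta> \<in> M \<longleftrightarrow> \<theta> \<in> derivations \<and> (\<forall>I\<in>\<F>. \<beta> I dvd \<theta> (\<alpha> I))" for \<theta>
    unfolding M_def \<beta>_def \<alpha>_def m_def by (rule multi_derivations_subset_arrangement[OF \<F>(1)])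

  have in_span: "\<exists>l. v = (\<Sum>J\<in>T. l J *s ind J)" if "v \<in> vec.span (ind ` T)" for v :: "rat ^ 'v" and T
  proof -
    have v: "v \<in> vec.span (ind ` T)" by (rule that)
    have "finite (ind ` T)" by simp
    then have "v \<in> range (\<lambda>u. \<Sum>w\<in>ind ` T. u w *s w)"
      using v by (simp only: vec.span_finite)
    then obtain u where "v = (\<Sum>w\<in>ind ` T. u w *s w)" by (elim rangeE) (rule that)
    also have "\<dots> = (\<Sum>J\<in>T. u (ind J) *s ind J)"
      by (subst sum.reindex) (auto simp: inj_on_def)
    finally show ?thesis by (rule exI[of _ "\<lambda>J. u (ind J)"])
  qed

  \<comment> \<open>Vectors dual to the forms of \<open>\<S>\<close>. They allow a derivation to be
    prescribed by its values on these forms, and they certify coprimality later on.\<close>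
  have "\<exists>x. dot (ind J) x = 1 \<and> (\<forall>I\<in>\<S> - {J}. dot (ind I) x = 0)" if J: "J \<in> \<S>" for J
  proof -
    have "ind J \<notin> vec.span (ind ` (\<S> - {J}))"
    proof
      assume "ind J \<in> vec.span (ind ` (\<S> - {J}))"
      then obtain l where l: "ind J = (\<Sum>I\<in>\<S> - {J}. l I *s ind I)" using in_span by blast
      let ?l = "l(J := - 1)"
      have "(\<Sum>I\<in>\<S>. ?l I *s ind I) = ?l J *s ind J + (\<Sum>I\<in>\<S> - {J}. ?l I *s ind I)"
        using J by (simp add: sum.remove)
      also have "(\<Sum>I\<in>\<S> - {J}. ?l I *s ind I) = ind J"
        unfolding l by (rule sum.cong) auto
      finally have "(\<Sum>I\<in>\<S>. ?l I *s ind I) = 0" by simp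
      then show False using indep[of ?l] J by auto
    qed
    then obtain x where x: "dot (ind J) x \<noteq> 0" "\<forall>t\<in>ind ` (\<S> - {J}). dot t x = 0"
      using dot_separates by blast
    then show ?thesis
      by (intro exI[of _ "(1 / dot (ind J) x) *s x"]) auto
  qed
  then obtain e where e: "\<And>J. J \<in> \<S> \<Longrightarrow> dot (ind J) (e J) = 1"
      "\<And>J I. J \<in> \<S> \<Longrightarrow> I \<in> \<S> \<Longrightarrow> I \<noteq> J \<Longrightarrow> dot (ind I) (e J) = 0"
    by (metis (no_types, lifting) DiffI singletonD)
  have e_I0: "dot (ind I0) (e J) = a J" if "J \<in> \<S>" for J
  proof -
    have "dot (ind I0) (e J) = (\<Sum>I\<in>\<S>. a I * dot (ind I) (e J))"
      by (simp add: I0 dot_sum)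
    also have "\<dots> = (\<Sum>I\<in>\<S>. if I = J then a I else 0)"
      using e that by (intro sum.cong) auto
    finally show ?thesis using that by simp
  qed

  \<comment> \<open>The flat. Every form outside \<open>insert I0 \<S>\<close> is nonzero somewhere
    on it because it is not in the span of \<open>\<S>\<close>; a common point \<open>p0\<close> of
    non-vanishing is the generic point.\<close>
  define W where "W = {x. \<forall>I\<in>\<S>. dot (ind I) x = 0}"
  have "\<exists>x\<in>W. \<forall>v\<in>ind ` (\<F> - insert I0 \<S>). dot v x \<noteq> 0"
  proof (rule dot_avoid)
    fix v assume "v \<in> ind ` (\<F> - insert I0 \<S>)"
    then obtain I where I: "v = ind I" "I \<in> \<F>" "I \<notin> insert I0 \<S>" by auto
    then have "v \<notin> vec.span (ind ` \<S>)" using closed in_span by blast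
    then show "\<exists>x\<in>W. dot v x \<noteq> 0"
      using dot_separates[of v "ind ` \<S>"] by (auto simp: W_def)
  qed (auto simp: W_def)
  then obtain p0 where p0: "\<And>I. I \<in> \<S> \<Longrightarrow> dot (ind I) p0 = 0"
      "\<And>I. I \<in> \<F> \<Longrightarrow> I \<notin> insert I0 \<S> \<Longrightarrow> dot (ind I) p0 \<noteq> 0"
    by (auto simp: W_def)
  have p0_I0: "dot (ind I0) p0 = 0"
    by (simp add: I0 dot_sum p0(1))
  note pt_hom = peval_hom[OF rat_hom_id, of _ ]

  \<comment> \<open>Here \<open>u I\<close> stands for the quotient of the value of a derivation at
    \<open>\<alpha> I\<close> by \<open>\<beta> I\<close>. The quotients for \<open>\<S>\<close> are
    free; since the form of \<open>I0\<close> is a combination of those of \<open>\<S>\<close>, its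
    condition reads \<open>\<phi> u = 0\<close>. So local derivations are syzygies of the
    powers.\<close>
  define \<phi> where "\<phi> u = (\<Sum>I\<in>\<S>. Const (a I) * \<beta> I * u I) - \<beta> I0 * u I0" for u :: "'v set \<Rightarrow> 'v qpoly"
  have \<phi>_mult: "\<phi> (\<lambda>I. x * u I) = x * \<phi> u" for x u
    by (simp add: \<phi>_def sum_distrib_left right_diff_distrib mult.left_commute)
  have \<phi>_add: "\<phi> (\<lambda>I. u I + w I) = \<phi> u + \<phi> w" for u w
    by (simp add: \<phi>_def distrib_left sum.distrib)
  have \<phi>_diff: "\<phi> (\<lambda>I. u I - w I) = \<phi> u - \<phi> w" for u w
    by (simp add: \<phi>_def right_diff_distrib sum_subtractf)
  \<comment> \<open>The image of \<open>\<phi>\<close>, an ideal, localized at \<open>p0\<close> and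
    pulled back: \<open>Q\<close> is the denominator.\<close>
  define J where "J f \<longleftrightarrow> (\<exists>Q u. pt_eval p0 Q \<noteq> 0 \<and> Q * f = \<phi> u)" for f
  have J_mult: "J (g * f)" if J: "J f" for f g
  proof -
    obtain Q u where "pt_eval p0 Q \<noteq> 0" "Q * f = \<phi> u" using J by (auto simp: J_def)
    then have "pt_eval p0 Q \<noteq> 0 \<and> Q * (g * f) = \<phi> (\<lambda>I. g * u I)"
      by (metis \<phi>_mult mult.left_commute)
    then show ?thesis unfolding J_def by blast
  qed
  have \<alpha>_p0: "pt_eval p0 (\<alpha> I) = dot (ind I) p0" for I
    by (simp add: \<alpha>_def)
  \<comment> \<open>Positivity of the multiplicities enters here: all generators of the ideal vanish
    at \<open>p0\<close>, so it is proper.\<close>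
  have \<beta>_p0: "pt_eval p0 (\<beta> I) = 0" if "I \<in> insert I0 \<S>" for I
    using that p0 p0_I0 m[of I] \<F> by (auto simp: \<beta>_def pt_hom \<alpha>_p0)
  have "\<not> J 1"
  proof
    assume "J 1"
    then obtain Q u where Q: "pt_eval p0 Q \<noteq> 0" "Q = \<phi> u" by (auto simp: J_def)
    have "pt_eval p0 (\<phi> u) = 0"
      by (simp add: \<phi>_def pt_hom \<beta>_p0)
    then show False using Q by simp
  qed
  have J_\<beta>: "J (\<alpha> I ^ m I * s)" if "I \<in> \<S>" "a I \<noteq> 0" "I \<noteq> I0" for I s
  proof -
    have one: "Const (a I) * Const (1 / a I) = 1" using that by (simp flip: Const_mult)
    have "Const (a I) * \<beta> I * (Const (1 / a I) * s) = (Const (a I) * Const (1 / a I)) * (\<beta> I * s)"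
      by (simp only: ac_simps)
    then have "Const (a I) * \<beta> I * (Const (1 / a I) * s) = \<alpha> I ^ m I * s"
      unfolding one mult_1 by (simp only: \<beta>_def)
    then have "\<phi> (\<lambda>I'. if I' = I then Const (1 / a I) * s else 0) = (\<Sum>I'\<in>\<S>. if I' = I then \<alpha> I ^ m I * s else 0)"
      unfolding \<phi>_def using that(3) by (simp add: if_distrib[of "\<lambda>x. _ * x"] cong: if_cong)
    also have "\<dots> = 1 * (\<alpha> I ^ m I * s)" using that by simp
    finally show ?thesis unfolding J_def by (metis one_neq_zero peval_1 rat_hom_id)
  qed
  have notin: "I0 \<notin> \<S>"
  proof
    assume "I0 \<in> \<S>"
    let ?l = "\<lambda>I. a I - (if I = I0 then 1 else 0)"
    have "(\<Sum>I\<in>\<S>. ?l I *s ind I) = ind I0 - (\<Sum>I\<in>\<S>. if I = I0 then ind I else 0)"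
      unfolding I0 sum_subtractf[symmetric] by (intro sum.cong) (auto simp: vec_eq_iff algebra_simps)
    also have "\<dots> = 0" using \<open>I0 \<in> \<S>\<close> by simp
    finally have "\<forall>I\<in>\<S>. ?l I = 0" by (rule indep)
    then show False using I by (metis diff_zero)
  qed
  \<comment> \<open>Starting from 1, multiplication by maximal powers of the three forms in turn
    keeps the products already in \<open>J\<close> there. The final \<open>s\<close> lies outside
    \<open>J\<close> and all three forms carry it into \<open>J\<close>.\<close>
  obtain s1 where s1: "\<not> J s1" "J (\<alpha> I1 * s1)"
    using maximal_power_not_in[of J 1, OF \<open>\<not> J 1\<close> J_\<beta>] I notin by metis
  obtain s2 where s2: "\<not> J s2" "J (\<alpha> I1 * s2)" "J (\<alpha> I2 * s2)"
    using maximal_power_not_in[of J s1, OF s1(1) J_\<beta>[of I2]] I notin s1(2) J_mult by (metis mult.left_commute)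
  obtain s where s: "\<not> J s" "J (\<alpha> I1 * s)" "J (\<alpha> I2 * s)" "J (\<alpha> I3 * s)"
    using maximal_power_not_in[of J s2, OF s2(1) J_\<beta>[of I3]] I notin s2(2,3) J_mult by (metis mult.left_commute)
  obtain Q1 u1 where 1: "pt_eval p0 Q1 \<noteq> 0" "Q1 * (\<alpha> I1 * s) = \<phi> u1" using s(2) by (auto simp: J_def)
  obtain Q2 u2 where 2: "pt_eval p0 Q2 \<noteq> 0" "Q2 * (\<alpha> I2 * s) = \<phi> u2" using s(3) by (auto simp: J_def)
  obtain Q3 u3 where 3: "pt_eval p0 Q3 \<noteq> 0" "Q3 * (\<alpha> I3 * s) = \<phi> u3" using s(4) by (auto simp: J_def)
  define R where "R = Q1 * Q2 * Q3"
  have R: "pt_eval p0 R \<noteq> 0" using 1 2 3 by (simp add: R_def pt_hom)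
  define s' where "s' = R * s"
  define u v t where "u = (\<lambda>I. Q2 * Q3 * u1 I)" and "v = (\<lambda>I. Q1 * Q3 * u2 I)" and "t = (\<lambda>I. Q1 * Q2 * u3 I)"
  have uvt: "\<phi> u = \<alpha> I1 * s'" "\<phi> v = \<alpha> I2 * s'" "\<phi> t = \<alpha> I3 * s'"
    unfolding u_def v_def t_def \<phi>_mult 1(2)[symmetric] 2(2)[symmetric] 3(2)[symmetric] s'_def R_def
    by (simp_all add: algebra_simps)

  \<comment> \<open>Nonzero at \<open>p0\<close>, so harmless locally; as a factor it makes a local
    derivation meet the conditions at all hyperplanes that miss \<open>p0\<close>.\<close>
  define Q where "Q = (\<Prod>I\<in>\<F> - insert I0 \<S>. \<beta> I)"
  have Q: "pt_eval p0 Q \<noteq> 0"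
    using p0(2) by (auto simp: Q_def \<beta>_def pt_hom \<alpha>_p0)
  define \<Theta> where "\<Theta> p = der_with (\<lambda>w. \<Sum>K\<in>\<S>. Const (e K $ w) * \<beta> K * (Q * p K))" for p
  have \<Theta>_der: "\<Theta> p \<in> derivations" for p
    by (simp add: \<Theta>_def der_with_derivation)
  have \<Theta>_lin: "\<Theta> p (linear_form c) = (\<Sum>K\<in>\<S>. Const (dot c (e K)) * \<beta> K * (Q * p K))" for p c
  proof -
    have Const_sum: "Const (\<Sum>w\<in>A. f w) = (\<Sum>w\<in>A. Const (f w))" for A :: "'v set" and f
      by (induction A rule: infinite_finite_induct) (simp_all add: Const_add)
    have "\<Theta> p (linear_form c) = (\<Sum>w\<in>UNIV. \<Sum>K\<in>\<S>. Const (c $ w) * (Const (e K $ w) * \<beta> K * (Q * p K)))"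
      using derivation_linear_form[OF \<Theta>_der] by (simp add: \<Theta>_def sum_distrib_left)
    also have "\<dots> = (\<Sum>K\<in>\<S>. \<Sum>w\<in>UNIV. Const (c $ w) * (Const (e K $ w) * \<beta> K * (Q * p K)))"
      by (rule sum.swap)
    also have "\<dots> = (\<Sum>K\<in>\<S>. Const (dot c (e K)) * \<beta> K * (Q * p K))"
      by (simp add: dot_def Const_sum Const_mult sum_distrib_right mult.assoc)
    finally show ?thesis .
  qed
  have \<Theta>_S: "\<Theta> p (\<alpha> I) = \<beta> I * (Q * p I)" if "I \<in> \<S>" for p I
  proof -
    have "\<Theta> p (\<alpha> I) = (\<Sum>K\<in>\<S>. if K = I then \<beta> K * (Q * p K) else 0)"
      unfolding \<alpha>_def[of I] \<Theta>_lin using e that by (intro sum.cong) auto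
    then show ?thesis using that by simp
  qed
  have \<Theta>_I0: "\<Theta> p (\<alpha> I0) = \<beta> I0 * (Q * p I0)" if "\<phi> p = 0" for p
  proof -
    have "\<Theta> p (\<alpha> I0) = Q * (\<Sum>K\<in>\<S>. Const (a K) * \<beta> K * p K)"
      unfolding \<alpha>_def[of I0] \<Theta>_lin by (simp add: e_I0 sum_distrib_left algebra_simps)
    then show ?thesis using that by (simp add: \<phi>_def algebra_simps)
  qed
  have \<Theta>_M: "\<Theta> p \<in> M" if "\<phi> p = 0" for p
    unfolding M_iff
  proof (intro conjI ballI \<Theta>_der)
    fix I assume "I \<in> \<F>"
    show "\<beta> I dvd \<Theta> p (\<alpha> I)"
    proof (cases "I \<in> insert I0 \<S>")
      case True
      then show ?thesis using \<Theta>_S \<Theta>_I0[OF that] by auto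
    next
      case False
      then have "\<beta> I dvd Q" unfolding Q_def using \<open>I \<in> \<F>\<close> by (intro dvd_prodI) auto
      then show ?thesis unfolding \<alpha>_def[of I] \<Theta>_lin by (intro dvd_sum) auto
    qed
  qed
  \<comment> \<open>As \<open>u\<close>, \<open>v\<close>, \<open>t\<close> are sent to
    \<open>s'\<close> times the three forms, these Koszul combinations are syzygies, and they
    satisfy the Koszul relation among themselves.\<close>
  define p q r where "p = (\<lambda>I. \<alpha> I2 * u I - \<alpha> I1 * v I)" and "q = (\<lambda>I. \<alpha> I3 * u I - \<alpha> I1 * t I)"
    and "r = (\<lambda>I. \<alpha> I3 * v I - \<alpha> I2 * t I)"
  have syz: "\<phi> p = 0" "\<phi> q = 0" "\<phi> r = 0"
    by (simp_all add: p_def q_def r_def \<phi>_diff \<phi>_mult uvt mult.left_commute)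
  have "der_scale (\<alpha> I3) (\<Theta> p) - der_scale (\<alpha> I2) (\<Theta> q) + der_scale (\<alpha> I1) (\<Theta> r) = 0" (is "?d = 0")
  proof (rule derivation_eqI)
    show "?d \<in> derivations"
      by (intro der.subspace_add[OF derivations_subspace] der.subspace_diff[OF derivations_subspace]
          der.subspace_scale[OF derivations_subspace] \<Theta>_der)
    show "0 \<in> derivations" by (rule der.subspace_0[OF derivations_subspace])
    fix w
    have "?d (Var w) = (\<Sum>K\<in>\<S>. Const (e K $ w) * \<beta> K * (Q * (\<alpha> I3 * p K - \<alpha> I2 * q K + \<alpha> I1 * r K)))"
      by (simp add: der_scale_def \<Theta>_def sum_distrib_left sum_subtractf[symmetric] sum.distrib[symmetric] algebra_simps)
    also have "\<dots> = 0"
      by (rule sum.neutral) (simp add: p_def q_def r_def algebra_simps)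
    finally show "?d (Var w) = 0 (Var w)" by simp
  qed
  moreover have "\<exists>a b. f = \<alpha> I2 * a - \<alpha> I1 * b" if "\<alpha> I3 * f - \<alpha> I2 * g + \<alpha> I1 * h = 0" for f g h
    using that unfolding \<alpha>_def
    by (rule linear_form_koszul[where ?e2.0 = "e I2" and ?e3.0 = "e I3", rotated -1])
      (use e I \<F> in auto)
  ultimately obtain A B where A: "A \<in> M" and B: "B \<in> M" and AB: "\<Theta> p = der_scale (\<alpha> I2) A - der_scale (\<alpha> I1) B"
    using free_submodule_koszul[OF _ \<Theta>_M[OF syz(1)] \<Theta>_M[OF syz(2)] \<Theta>_M[OF syz(3)], of "\<alpha> I3" "\<alpha> I2" "\<alpha> I1"]
      free unfolding multi_free_def M_def[symmetric] by blast
  have "\<forall>I. \<exists>k. I \<in> insert I0 \<S> \<longrightarrow> A (\<alpha> I) = \<beta> I * k"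
    using A \<F> unfolding M_iff dvd_def by (metis insert_iff subset_iff)
  then obtain A' where A': "\<And>I. I \<in> insert I0 \<S> \<Longrightarrow> A (\<alpha> I) = \<beta> I * A' I" by metis
  have "\<forall>I. \<exists>k. I \<in> insert I0 \<S> \<longrightarrow> B (\<alpha> I) = \<beta> I * k"
    using B \<F> unfolding M_iff dvd_def by (metis insert_iff subset_iff)
  then obtain B' where B': "\<And>I. I \<in> insert I0 \<S> \<Longrightarrow> B (\<alpha> I) = \<beta> I * B' I" by metis
  have \<alpha>_nz: "\<alpha> I \<noteq> 0" if "I \<in> \<F>" for I
    unfolding \<alpha>_def using \<F> that by (intro linear_form_neq_0) auto
  have \<beta>_nz: "\<beta> I \<noteq> 0" if "I \<in> \<F>" for I
  proof -
    have "\<alpha> I ^ k \<noteq> 0" for k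
      by (induction k) (use \<alpha>_nz that in \<open>auto simp: qpoly_mult_eq_0_iff\<close>)
    then show ?thesis by (simp add: \<beta>_def)
  qed
  \<comment> \<open>\<open>p\<close> is \<open>\<alpha> I2 * u - \<alpha> I1 * v\<close> by
    construction and, up to \<open>Q\<close>, \<open>\<alpha> I2 * A' - \<alpha> I1 * B'\<close> by
    freeness. Coprimality of the two forms shows that \<open>Q * u\<close> and \<open>A'\<close>
    agree modulo \<open>\<alpha> I1\<close>.\<close>
  have "\<exists>k. Q * u I - A' I = \<alpha> I1 * k" if "I \<in> insert I0 \<S>" for I
  proof -
    have "\<beta> I * (Q * p I) = \<alpha> I2 * (\<beta> I * A' I) - \<alpha> I1 * (\<beta> I * B' I)"
      using fun_cong[OF AB, of "\<alpha> I"] that \<Theta>_S[of I p] \<Theta>_I0[OF syz(1)] A'[OF that] B'[OF that]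
      by (auto simp: der_scale_def)
    then have "\<beta> I * (Q * p I) = \<beta> I * (\<alpha> I2 * A' I - \<alpha> I1 * B' I)"
      by (simp add: algebra_simps)
    then have "Q * p I = \<alpha> I2 * A' I - \<alpha> I1 * B' I"
      using \<beta>_nz[of I] that \<F> by (auto simp: qpoly_mult_left_cancel)
    then have "\<alpha> I2 * (Q * u I - A' I) = \<alpha> I1 * (Q * v I - B' I)"
      by (simp add: p_def algebra_simps)
    then have "linear_form (ind I1) dvd linear_form (ind I2) * (Q * u I - A' I)"
      by (simp add: \<alpha>_def)
    then have "linear_form (ind I1) dvd Q * u I - A' I"
      by (rule linear_form_coprime[where x = "e I2"]) (use e I \<F> in auto)
    then show ?thesis by (simp add: \<alpha>_def dvd_def)
  qed
  then obtain k where k: "\<And>I. I \<in> insert I0 \<S> \<Longrightarrow> Q * u I - A' I = \<alpha> I1 * k I" by metis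
  have \<phi>_cong: "\<phi> f = \<phi> g" if "\<And>I. I \<in> insert I0 \<S> \<Longrightarrow> f I = g I" for f g
    using that by (simp add: \<phi>_def cong: sum.cong)
  have "\<phi> A' = 0"
  proof -
    have "A (\<alpha> I0) = (\<Sum>I\<in>\<S>. Const (a I) * A (\<alpha> I))"
    proof -
      have lin: "linear_form (\<Sum>I\<in>T. f I) = (\<Sum>I\<in>T. linear_form (f I))" for T :: "'v set set" and f :: "_ \<Rightarrow> rat ^ 'v"
        by (induction T rule: infinite_finite_induct) (simp_all add: linear_form_add)
      have A_der: "A \<in> derivations" using A M_iff by simp
      show ?thesis
        unfolding \<alpha>_def I0 lin linear_form_scale derivation_sum[OF A_der] derivationsD(2)[OF A_der] ..
    qed
    then show ?thesis using A' by (simp add: \<phi>_def mult.assoc)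
  qed
  \<comment> \<open>Since \<open>A'\<close> is a syzygy, only the multiple of
    \<open>\<alpha> I1\<close> survives under \<open>\<phi>\<close>. Cancelling that form exhibits
    \<open>s\<close> in \<open>J\<close>, against its choice.\<close>
  have "\<alpha> I1 * (Q * s') = \<phi> (\<lambda>I. Q * u I)"
    by (simp add: \<phi>_mult uvt mult.left_commute)
  also have "\<dots> = \<phi> (\<lambda>I. A' I + \<alpha> I1 * k I)"
    using k by (intro \<phi>_cong) (simp add: diff_eq_eq add.commute)
  also have "\<dots> = \<alpha> I1 * \<phi> k"
    by (simp add: \<phi>_add \<phi>_mult \<open>\<phi> A' = 0\<close>)
  finally have "Q * s' = \<phi> k"
    using \<alpha>_nz[of I1] I(1) \<F>(2) by (auto simp: qpoly_mult_left_cancel)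
  then have "(Q * R) * s = \<phi> k" by (simp add: s'_def mult.assoc)
  moreover have "pt_eval p0 (Q * R) \<noteq> 0" using Q R by (simp add: pt_hom)
  ultimately have "J s" unfolding J_def by blast
  then show False using s(1) by simp
qed

section \<open>Connected vertex sets\<close>

text \<open>Connectedness by cuts instead of walks: the arguments about circuits use precisely that
  an edge leaves every proper part.\<close>

definition conn :: "('a \<times> 'a) set \<Rightarrow> 'a set \<Rightarrow> bool" where
  "conn E I \<longleftrightarrow> I \<noteq> {} \<and> (\<forall>U. U \<subseteq> I \<longrightarrow> U \<noteq> {} \<longrightarrow> U \<noteq> I \<longrightarrow> (\<exists>u\<in>U. \<exists>v\<in>I - U. (u, v) \<in> E))"

lemma conn_crossing:
  assumes "conn E I" "x \<in> I" "x \<in> U" "y \<in> I" "y \<notin> U"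
  obtains u v where "u \<in> I" "u \<in> U" "v \<in> I" "v \<notin> U" "(u, v) \<in> E"
  using assms unfolding conn_def
  by (elim conjE allE[of _ "U \<inter> I"]) blast

lemma conn_singleton [simp]: "conn E {x}"
  by (auto simp: conn_def)

lemma conn_Un:
  assumes "sym E" "conn E A" "conn E B" "a \<in> A" "b \<in> B" "(a, b) \<in> E"
  shows "conn E (A \<union> B)"
  unfolding conn_def
proof (intro conjI allI impI)
  fix U assume U: "U \<subseteq> A \<union> B" "U \<noteq> {}" "U \<noteq> A \<union> B"
  show "\<exists>u\<in>U. \<exists>v\<in>A \<union> B - U. (u, v) \<in> E"
  proof (cases "U \<inter> A \<noteq> {} \<and> U \<inter> A \<noteq> A \<or> U \<inter> B \<noteq> {} \<and> U \<inter> B \<noteq> B")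
    case True
    then show ?thesis
    proof
      assume "U \<inter> A \<noteq> {} \<and> U \<inter> A \<noteq> A"
      then have "\<exists>u\<in>U \<inter> A. \<exists>v\<in>A - U \<inter> A. (u, v) \<in> E"
        using assms(2) unfolding conn_def by blast
      then show ?thesis by blast
    next
      assume "U \<inter> B \<noteq> {} \<and> U \<inter> B \<noteq> B"
      then have "\<exists>u\<in>U \<inter> B. \<exists>v\<in>B - U \<inter> B. (u, v) \<in> E"
        using assms(3) unfolding conn_def by blast
      then show ?thesis by blast
    qed
  next
    case False
    then have "A \<subseteq> U \<and> U \<inter> B = {} \<or> B \<subseteq> U \<and> U \<inter> A = {}" using U by blast
    then show ?thesis
    proof
      assume "A \<subseteq> U \<and> U \<inter> B = {}"
      then show ?thesis using assms(4-6) by blast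
    next
      assume "B \<subseteq> U \<and> U \<inter> A = {}"
      then show ?thesis using assms(4-6) \<open>sym E\<close> by (blast dest: symD)
    qed
  qed
qed (use assms in auto)

lemma conn_insert:
  assumes "sym E" "conn E A" "a \<in> A" "(a, b) \<in> E"
  shows "conn E (insert b A)"
proof -
  have "conn E (A \<union> {b})"
    using assms by (intro conn_Un) auto
  then show ?thesis by simp
qed

section \<open>Graphs with a generic localization\<close>

abbreviation TNF :: "('v::finite \<times> 'v) set \<Rightarrow> bool" where
  "TNF E \<equiv> totally_non_free (subset_arrangement {I. conn E I})"

text \<open>Reading indicator vectors vertex by vertex turns independence, the circuit relation and
  closedness into scalar equations. Independence makes the indexing by numbers injective, so the
  family can be used as a set.\<close>

lemma TNF_if_closed_circuit:
  fixes A :: "nat \<Rightarrow> 'v::finite set"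
  assumes conn: "\<And>i. i < r \<Longrightarrow> conn E (A i)" "conn E D" and "3 \<le> r"
    and D: "\<And>v. of_bool (v \<in> D) = (\<Sum>i<r. a i * of_bool (v \<in> A i) :: rat)"
    and a: "a 0 \<noteq> 0" "a 1 \<noteq> 0" "a 2 \<noteq> 0"
    and indep: "\<And>x. \<forall>v. (\<Sum>i<r. x i * of_bool (v \<in> A i) :: rat) = 0 \<Longrightarrow> \<forall>i<r. x i = 0"
    and closed: "\<And>x I. conn E I \<Longrightarrow> \<forall>v. of_bool (v \<in> I) = (\<Sum>i<r. x i * of_bool (v \<in> A i) :: rat)
      \<Longrightarrow> I = D \<or> (\<exists>i<r. I = A i)"
  shows "TNF E"
  unfolding totally_non_free_def
proof (intro allI impI)
  fix \<mu> :: "(rat ^ 'v) set \<Rightarrow> nat"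
  assume \<mu>: "\<forall>H\<in>subset_arrangement {I. conn E I}. 1 \<le> \<mu> H"
  have inj: "inj_on A {..<r}"
  proof (rule inj_onI, rule ccontr)
    fix i j assume ij: "i \<in> {..<r}" "j \<in> {..<r}" "A i = A j" "i \<noteq> j"
    let ?x = "\<lambda>k. if k = i then 1 else if k = j then - 1 else 0 :: rat"
    have "(\<Sum>k<r. ?x k * of_bool (v \<in> A k)) = 0" for v
    proof -
      have "(\<Sum>k<r. ?x k * of_bool (v \<in> A k)) = (\<Sum>k\<in>{i, j}. ?x k * of_bool (v \<in> A k))"
        using ij by (intro sum.mono_neutral_right) auto
      then show ?thesis using ij by (simp del: sum_mult_of_bool_eq)
    qed
    then have "\<forall>k<r. ?x k = 0" by (intro indep allI)
    then have "?x i = 0" using ij(1) by blast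
    then show False by simp
  qed
  have nth: "(\<Sum>I\<in>A ` {..<r}. l I *s ind I) $ v = (\<Sum>i<r. l (A i) * of_bool (v \<in> A i))" for l v
    by (simp add: sum.reindex[OF inj] of_bool_def del: sum_mult_of_bool_eq)
  define b where "b = the_inv_into {..<r} A"
  have b: "b (A i) = i" if "i < r" for i
    using that inj by (simp add: b_def the_inv_into_f_f)
  show "\<not> multi_free (subset_arrangement {I. conn E I}) \<mu>"
  proof (rule not_multi_free_if_generic_localization[where \<S> = "A ` {..<r}" and ?I0.0 = D and a = "\<lambda>I. a (b I)"
        and ?I1.0 = "A 0" and ?I2.0 = "A 1" and ?I3.0 = "A 2"])
    show "{} \<notin> {I. conn E I}" by (simp add: conn_def)
    show "A ` {..<r} \<subseteq> {I. conn E I}" "D \<in> {I. conn E I}" using conn by auto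
    show "\<forall>I\<in>A ` {..<r}. l I = 0" if "(\<Sum>I\<in>A ` {..<r}. l I *s ind I) = 0" for l
      using indep[of "\<lambda>i. l (A i)"] that nth[of l] by auto
    show "ind D = (\<Sum>I\<in>A ` {..<r}. a (b I) *s ind I)"
      unfolding vec_eq_iff nth using D by (auto simp: b of_bool_def cong: if_cong)
    show "A 0 \<in> A ` {..<r}" "A 1 \<in> A ` {..<r}" "A 2 \<in> A ` {..<r}" using \<open>3 \<le> r\<close> by auto
    show "A 0 \<noteq> A 1" "A 0 \<noteq> A 2" "A 1 \<noteq> A 2"
      using inj_onD[OF inj, of 0 1] inj_onD[OF inj, of 0 2] inj_onD[OF inj, of 1 2] \<open>3 \<le> r\<close> by auto
    show "a (b (A 0)) \<noteq> 0" "a (b (A 1)) \<noteq> 0" "a (b (A 2)) \<noteq> 0"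
      using a b[of 0] b[of 1] b[of 2] \<open>3 \<le> r\<close> by auto
    show "I \<in> insert D (A ` {..<r})"
      if "I \<in> {I. conn E I}" "ind I = (\<Sum>J\<in>A ` {..<r}. l J *s ind J)" for I l
    proof -
      have "of_bool (v \<in> I) = (\<Sum>i<r. l (A i) * of_bool (v \<in> A i))" for v
        using arg_cong[OF that(2), of "\<lambda>x. x $ v"] unfolding nth by (simp add: of_bool_def)
      then have "I = D \<or> (\<exists>i<r. I = A i)"
        using closed[of I "\<lambda>i. l (A i)"] that(1) by blast
      then show ?thesis by blast
    qed
  qed (use \<mu> in auto)
qed

text \<open>The shortest circuit, \<open>A + B = C + D\<close>. The triple of zeros may appear among
  the admissible coefficients because it yields the empty set, which is not connected.\<close>

lemma TNF_if_closed_quadruple: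
  fixes A B C D :: "'v::finite set"
  assumes conn: "conn E A" "conn E B" "conn E C" "conn E D"
    and D: "\<And>v. of_bool (v \<in> D) = of_bool (v \<in> A) + of_bool (v \<in> B) - (of_bool (v \<in> C) :: rat)"
    and indep: "\<And>x y z. \<forall>v. x * of_bool (v \<in> A) + y * of_bool (v \<in> B) + z * of_bool (v \<in> C) = (0 :: rat)
      \<Longrightarrow> x = 0 \<and> y = 0 \<and> z = 0"
    and closed: "\<And>x y z I. conn E I \<Longrightarrow>
      \<forall>v. x * of_bool (v \<in> A) + y * of_bool (v \<in> B) + z * of_bool (v \<in> C) = (of_bool (v \<in> I) :: rat)
      \<Longrightarrow> (x, y, z) \<in> {(0, 0, 0), (1, 0, 0), (0, 1, 0), (0, 0, 1), (1, 1, - 1)}"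
  shows "TNF E"
proof (rule TNF_if_closed_circuit[where r = 3 and A = "\<lambda>i. [A, B, C] ! i" and a = "\<lambda>i. [1, 1, - 1] ! i" and D = D])
  have 3: "{..<3} = {0, 1, 2 :: nat}" by auto
  show "conn E ([A, B, C] ! i)" if "i < 3" for i
    using that conn by (auto simp: less_Suc_eq numeral_3_eq_3)
  show "\<forall>i<3. x i = 0" if "\<forall>v. (\<Sum>i<3. x i * of_bool (v \<in> [A, B, C] ! i) :: rat) = 0" for x
  proof -
    have "\<forall>v. x 0 * of_bool (v \<in> A) + x 1 * of_bool (v \<in> B) + x 2 * of_bool (v \<in> C) = 0"
      using that by (simp add: 3 add.assoc del: sum_mult_of_bool_eq)
    then have "x 0 = 0 \<and> x 1 = 0 \<and> x 2 = 0" by (rule indep)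
    then show ?thesis by (auto simp: less_Suc_eq numeral_3_eq_3 numeral_2_eq_2)
  qed
  show "I = D \<or> (\<exists>i<3. I = [A, B, C] ! i)"
    if I: "conn E I" and *: "\<forall>v. of_bool (v \<in> I) = (\<Sum>i<3. x i * of_bool (v \<in> [A, B, C] ! i) :: rat)" for x I
  proof -
    have eq: "x 0 * of_bool (v \<in> A) + x 1 * of_bool (v \<in> B) + x 2 * of_bool (v \<in> C) = of_bool (v \<in> I)" for v
      using * by (simp add: 3 add.assoc del: sum_mult_of_bool_eq)
    then have "(x 0, x 1, x 2) \<in> {(0, 0, 0), (1, 0, 0), (0, 1, 0), (0, 0, 1), (1, 1, - 1)}"
      using closed[OF I] by blast
    then have "x 0 = 0 \<and> x 1 = 0 \<and> x 2 = 0 \<or> x 0 = 1 \<and> x 1 = 0 \<and> x 2 = 0 \<or> x 0 = 0 \<and> x 1 = 1 \<and> x 2 = 0 \<or>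
        x 0 = 0 \<and> x 1 = 0 \<and> x 2 = 1 \<or> x 0 = 1 \<and> x 1 = 1 \<and> x 2 = - 1"
      by (simp only: insert_iff empty_iff prod.inject simp_thms)
    then have "I = {} \<or> I = A \<or> I = B \<or> I = C \<or> I = D"
    proof (elim disjE conjE)
      assume "x 0 = 1" "x 1 = 1" "x 2 = - 1"
      then have "of_bool (v \<in> I) = (of_bool (v \<in> D) :: rat)" for v using eq[of v] D[of v] by simp
      then have "I = D" by (auto simp: of_bool_eq_iff)
      then show ?thesis by simp
    qed (use eq in \<open>auto simp: of_bool_eq_iff\<close>)
    moreover have "I \<noteq> {}" using I by (simp add: conn_def)
    moreover have "\<exists>i<3. I = [A, B, C] ! i" if "I = A \<or> I = B \<or> I = C"
      using that
    proof (elim disjE)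
      assume "I = A"
      then show ?thesis by (intro exI[of _ 0]) simp
    next
      assume "I = B"
      then show ?thesis by (intro exI[of _ 1]) simp
    next
      assume "I = C"
      then show ?thesis by (intro exI[of _ 2]) simp
    qed
    ultimately show ?thesis by blast
  qed
qed (use conn D in \<open>auto simp: numeral_3_eq_3 lessThan_Suc\<close>)

text \<open>The sums of \<open>B0 + B1 + B2\<close> and \<open>B0 + B3 + B4\<close>, and of
  \<open>B0 + B1 + B3\<close> and \<open>B0 + B2 + B4\<close>, agree. At representatives of the five
  blocks a set in the span takes the values \<open>x + y + z\<close>, \<open>x + z\<close>,
  \<open>x\<close>, \<open>y + z\<close>, \<open>y\<close>; all of them being 0 or 1 leaves just the
  admissible triples.\<close>

lemma TNF_hub:
  assumes "conn E (B0 \<union> B1 \<union> B2)" "conn E (B0 \<union> B3 \<union> B4)" "conn E (B0 \<union> B1 \<union> B3)" "conn E (B0 \<union> B2 \<union> B4)"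
    and "b0 \<in> B0" "b1 \<in> B1" "b2 \<in> B2" "b3 \<in> B3" "b4 \<in> B4"
    and "B0 \<inter> B1 = {}" "B0 \<inter> B2 = {}" "B0 \<inter> B3 = {}" "B0 \<inter> B4 = {}" "B1 \<inter> B2 = {}"
      "B1 \<inter> B3 = {}" "B1 \<inter> B4 = {}" "B2 \<inter> B3 = {}" "B2 \<inter> B4 = {}" "B3 \<inter> B4 = {}"
  shows "TNF E"
proof (rule TNF_if_closed_quadruple)
  show "conn E (B0 \<union> B1 \<union> B2)" "conn E (B0 \<union> B3 \<union> B4)" "conn E (B0 \<union> B1 \<union> B3)" "conn E (B0 \<union> B2 \<union> B4)"
    by (fact assms)+
  let ?A = "B0 \<union> B1 \<union> B2" and ?B = "B0 \<union> B3 \<union> B4" and ?C = "B0 \<union> B1 \<union> B3" and ?D = "B0 \<union> B2 \<union> B4"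
  show "of_bool (v \<in> ?D) = of_bool (v \<in> ?A) + of_bool (v \<in> ?B) - (of_bool (v \<in> ?C) :: rat)" for v
    using assms(10-) by (auto simp: of_bool_def disjoint_iff)
  have b: "b0 \<in> ?A" "b0 \<in> ?B" "b0 \<in> ?C" "b1 \<in> ?A" "b1 \<notin> ?B" "b1 \<in> ?C" "b2 \<in> ?A" "b2 \<notin> ?B" "b2 \<notin> ?C"
      "b3 \<notin> ?A" "b3 \<in> ?B" "b3 \<in> ?C" "b4 \<notin> ?A" "b4 \<in> ?B" "b4 \<notin> ?C"
    using assms(5-) by (auto simp: disjoint_iff)
  show "x = 0 \<and> y = 0 \<and> z = 0"
    if "\<forall>v. x * of_bool (v \<in> ?A) + y * of_bool (v \<in> ?B) + z * of_bool (v \<in> ?C) = (0 :: rat)" for x y z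
    using that[rule_format, of b2] that[rule_format, of b4] that[rule_format, of b3]
    by (simp only: b of_bool_eq) simp
  show "(x, y, z) \<in> {(0, 0, 0), (1, 0, 0), (0, 1, 0), (0, 0, 1), (1, 1, - 1)}"
    if *: "\<forall>v. x * of_bool (v \<in> ?A) + y * of_bool (v \<in> ?B) + z * of_bool (v \<in> ?C) = (of_bool (v \<in> I) :: rat)" for x y z I
  proof -
    have "x = of_bool (b2 \<in> I)" "y = of_bool (b4 \<in> I)" "x + z = of_bool (b1 \<in> I)" "y + z = of_bool (b3 \<in> I)"
        "x + y + z = of_bool (b0 \<in> I)"
      using *[rule_format, of b2] *[rule_format, of b4] *[rule_format, of b1] *[rule_format, of b3] *[rule_format, of b0]
      by (simp_all only: b of_bool_eq mult_1_right mult_zero_right add_0_left add_0_right)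
    then show ?thesis by (auto simp: of_bool_def split: if_splits)
  qed
qed

lemma TNF_beta:
  assumes "conn E (C \<union> A)" "conn E (C \<union> B)" "conn E (C \<union> A \<union> D)" "conn E (C \<union> B \<union> D)" "\<not> conn E D"
    and "a \<in> A" "b \<in> B" "c \<in> C" "d \<in> D"
    and "A \<inter> B = {}" "A \<inter> C = {}" "A \<inter> D = {}" "B \<inter> C = {}" "B \<inter> D = {}" "C \<inter> D = {}"
  shows "TNF E"
proof (rule TNF_if_closed_quadruple)
  let ?A = "C \<union> A" and ?B = "C \<union> B \<union> D" and ?C = "C \<union> B" and ?D = "C \<union> A \<union> D"
  show "conn E ?A" "conn E ?B" "conn E ?C" "conn E ?D"
    by (fact assms)+
  show "of_bool (v \<in> ?D) = of_bool (v \<in> ?A) + of_bool (v \<in> ?B) - (of_bool (v \<in> ?C) :: rat)" for v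
    using assms by (auto simp: of_bool_def disjoint_iff)
  have b: "c \<in> ?A" "c \<in> ?B" "c \<in> ?C" "a \<in> ?A" "a \<notin> ?B" "a \<notin> ?C" "b \<notin> ?A" "b \<in> ?B" "b \<in> ?C"
      "d \<notin> ?A" "d \<in> ?B" "d \<notin> ?C"
    using assms(5-) by (auto simp: disjoint_iff)
  show "x = 0 \<and> y = 0 \<and> z = 0"
    if "\<forall>v. x * of_bool (v \<in> ?A) + y * of_bool (v \<in> ?B) + z * of_bool (v \<in> ?C) = (0 :: rat)" for x y z
    using that[rule_format, of a] that[rule_format, of d] that[rule_format, of b]
    by (simp only: b of_bool_eq) simp
  show "(x, y, z) \<in> {(0, 0, 0), (1, 0, 0), (0, 1, 0), (0, 0, 1), (1, 1, - 1)}"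
    if I: "conn E I" and *: "\<forall>v. x * of_bool (v \<in> ?A) + y * of_bool (v \<in> ?B) + z * of_bool (v \<in> ?C) = (of_bool (v \<in> I) :: rat)" for x y z I
  proof -
    have "x = of_bool (a \<in> I)" "y = of_bool (d \<in> I)" "y + z = of_bool (b \<in> I)" "x + y + z = of_bool (c \<in> I)"
      using *[rule_format, of a] *[rule_format, of d] *[rule_format, of b] *[rule_format, of c]
      by (simp_all only: b of_bool_eq mult_1_right mult_zero_right add_0_left add_0_right)
    moreover have "\<not> (x = 0 \<and> y = 1 \<and> z = - 1)"
    proof
      assume "x = 0 \<and> y = 1 \<and> z = - 1"
      then have "of_bool (v \<in> ?B) - of_bool (v \<in> ?C) = (of_bool (v \<in> I) :: rat)" for v
        using *[rule_format, of v] by simp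
      moreover have "of_bool (v \<in> ?B) - of_bool (v \<in> ?C) = (of_bool (v \<in> D) :: rat)" for v
        using assms by (auto simp: of_bool_def disjoint_iff)
      ultimately have "(of_bool (v \<in> I) :: rat) = of_bool (v \<in> D)" for v by metis
      then have "I = D" by (auto simp: of_bool_eq_iff)
      then show False using I assms(5) by simp
    qed
    ultimately show ?thesis by (auto simp: of_bool_def split: if_splits)
  qed
qed

section \<open>Two longer circuits: the net and the spider\<close>

lemma conn_cut:
  assumes "conn E I" "x \<in> I" "x \<in> U" "y \<in> I" "y \<notin> U"
    and "\<And>u v. u \<in> I \<Longrightarrow> u \<in> U \<Longrightarrow> v \<in> I \<Longrightarrow> v \<notin> U \<Longrightarrow> (u, v) \<in> E \<Longrightarrow> P"
  shows P
  using conn_crossing[OF assms(1-5)] assms(6) by metis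

text \<open>Linear relations between indicator values become propositional, so that closedness of
  the longer circuits is a Boolean problem.\<close>

lemma of_bool_sum_iff:
  "(of_bool p = (of_bool q + of_bool r :: rat)) \<longleftrightarrow> \<not> (q \<and> r) \<and> (p \<longleftrightarrow> q \<or> r)"
  "(of_bool p = (of_bool q + of_bool r - of_bool s :: rat)) \<longleftrightarrow>
    (if s then (if p then q \<and> r else (q \<noteq> r)) else \<not> (q \<and> r) \<and> (p \<longleftrightarrow> q \<or> r))"
  by (auto simp: of_bool_def)

lemma sum_lessThan_4: "(\<Sum>i<4. f i) = f 0 + f 1 + f 2 + f (3 :: nat)"
  by (simp add: eval_nat_numeral)

lemma sum_lessThan_5: "(\<Sum>i<5. f i) = f 0 + f 1 + f 2 + f 3 + f (4 :: nat)"
  by (simp add: eval_nat_numeral)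

text \<open>\<open>p0\<close> to \<open>p5\<close> record which vertices of the net are in the set.
  The first two assumptions are the linear equations of the span; the next three say that a pendant
  vertex brings its neighbour along as soon as the set has another vertex.\<close>

lemma net_bool:
  assumes "\<not> (p5 \<and> p3) \<and> (p1 \<longleftrightarrow> p5 \<or> p3)"
    and "if p4 then (if p2 then p0 \<and> p5 else (p0 \<noteq> p5)) else \<not> (p0 \<and> p5) \<and> (p2 \<longleftrightarrow> p0 \<or> p5)"
    and "p3 \<and> (p1 \<or> p2 \<or> p4 \<or> p5) \<longrightarrow> p0" "p4 \<and> (p0 \<or> p2 \<or> p3 \<or> p5) \<longrightarrow> p1"
    and "p5 \<and> (p0 \<or> p1 \<or> p3 \<or> p4) \<longrightarrow> p2" "p0 \<or> p1 \<or> p2 \<or> p3 \<or> p4 \<or> p5"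
  shows "p4 \<and> p1 \<and> p0 \<and> p2 \<and> p5 \<and> \<not> p3 \<or> p0 \<and> p2 \<and> \<not> p1 \<and> \<not> p3 \<and> \<not> p4 \<and> \<not> p5 \<or>
    p1 \<and> p2 \<and> p5 \<and> \<not> p0 \<and> \<not> p3 \<and> \<not> p4 \<or> p3 \<and> p0 \<and> p1 \<and> p2 \<and> \<not> p4 \<and> \<not> p5 \<or>
    p3 \<and> p0 \<and> p1 \<and> p4 \<and> \<not> p2 \<and> \<not> p5"
  using assms by argo

text \<open>\<open>p0\<close> is the centre and \<open>p1 p2\<close>, \<open>p3 p4\<close>,
  \<open>p5 p6\<close> are the legs from the inside out. After the two linear equations come the
  conditions that a connected set leaves a leg only through its inner vertex and the centre.\<close>

lemma spider_bool:
  assumes "if p2 then (if p3 then p6 \<and> p1 else (p6 \<noteq> p1)) else \<not> (p6 \<and> p1) \<and> (p3 \<longleftrightarrow> p6 \<or> p1)"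
    and "if p4 then (if p0 then p5 \<and> p1 else (p5 \<noteq> p1)) else \<not> (p5 \<and> p1) \<and> (p0 \<longleftrightarrow> p5 \<or> p1)"
    and "p2 \<and> (p0 \<or> p1 \<or> p3 \<or> p4 \<or> p5 \<or> p6) \<longrightarrow> p1" "p1 \<and> (p0 \<or> p3 \<or> p4 \<or> p5 \<or> p6) \<longrightarrow> p0"
    and "p4 \<and> (p0 \<or> p1 \<or> p2 \<or> p3 \<or> p5 \<or> p6) \<longrightarrow> p3" "p3 \<and> (p0 \<or> p1 \<or> p2 \<or> p5 \<or> p6) \<longrightarrow> p0"
    and "p6 \<and> (p0 \<or> p1 \<or> p2 \<or> p3 \<or> p4 \<or> p5) \<longrightarrow> p5" "p5 \<and> (p0 \<or> p1 \<or> p2 \<or> p3 \<or> p4) \<longrightarrow> p0"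
    and "p0 \<or> p1 \<or> p2 \<or> p3 \<or> p4 \<or> p5 \<or> p6"
  shows "p0 \<and> p1 \<and> p3 \<and> p4 \<and> p5 \<and> \<not> p2 \<and> \<not> p6 \<or> p0 \<and> p1 \<and> p2 \<and> p3 \<and> p4 \<and> p5 \<and> p6 \<or>
    p0 \<and> p5 \<and> \<not> p1 \<and> \<not> p2 \<and> \<not> p3 \<and> \<not> p4 \<and> \<not> p6 \<or> p0 \<and> p1 \<and> p2 \<and> \<not> p3 \<and> \<not> p4 \<and> \<not> p5 \<and> \<not> p6 \<or>
    p0 \<and> p1 \<and> p3 \<and> \<not> p2 \<and> \<not> p4 \<and> \<not> p5 \<and> \<not> p6 \<or> p0 \<and> p3 \<and> p5 \<and> p6 \<and> \<not> p1 \<and> \<not> p2 \<and> \<not> p4"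
  using assms by argo

text \<open>A triangle \<open>x0 x1 x2\<close> with pendants \<open>x3\<close>, \<open>x4\<close>,
  \<open>x5\<close>. Four independent indicators on six vertices leave two equations for a set in
  their span, on indicator values \<open>x1 = x3 + x5\<close> and \<open>x2 + x4 = x0 + x5\<close>.
  Connectivity at the pendants excludes the remaining 0/1 solutions.\<close>

lemma TNF_net:
  fixes x0 x1 x2 x3 x4 x5 :: "'v::finite"
  assumes E: "sym E" and d: "distinct [x0, x1, x2, x3, x4, x5]"
    and edges: "(x0, x1) \<in> E" "(x1, x2) \<in> E" "(x0, x2) \<in> E" "(x0, x3) \<in> E" "(x1, x4) \<in> E" "(x2, x5) \<in> E"
    and non3: "(x3, x1) \<notin> E" "(x3, x2) \<notin> E" "(x3, x4) \<notin> E" "(x3, x5) \<notin> E"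
    and non4: "(x4, x0) \<notin> E" "(x4, x2) \<notin> E" "(x4, x3) \<notin> E" "(x4, x5) \<notin> E"
    and non5: "(x5, x0) \<notin> E" "(x5, x1) \<notin> E" "(x5, x3) \<notin> E" "(x5, x4) \<notin> E"
  shows "TNF E"
proof (rule TNF_if_closed_circuit[where r = 4 and D = "{x4, x1, x0, x2, x5}" and a = "\<lambda>i. [1, 1, - 1, 1] ! i"
      and A = "\<lambda>i. [{x0, x2}, {x1, x2, x5}, {x3, x0, x1, x2}, {x3, x0, x1, x4}] ! i"])
  let ?A = "\<lambda>i. [{x0, x2}, {x1, x2, x5}, {x3, x0, x1, x2}, {x3, x0, x1, x4}] ! i"
  have A: "?A 0 = {x0, x2}" "?A 1 = {x1, x2, x5}" "?A 2 = {x3, x0, x1, x2}" "?A 3 = {x3, x0, x1, x4}"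
    by simp_all
  have d': "distinct [x5, x4, x3, x2, x1, x0]" using d by auto
  have edges': "(x1, x0) \<in> E" "(x2, x1) \<in> E" "(x2, x0) \<in> E" "(x3, x0) \<in> E" "(x4, x1) \<in> E" "(x5, x2) \<in> E"
    using edges E by (auto dest: symD)
  have step: "conn E (insert b (insert a A))" if "conn E (insert a A)" "(a, b) \<in> E" for a b A
    using conn_insert[OF E that(1) _ that(2)] by simp
  have "conn E {x0, x2}" "conn E {x1, x2, x5}" "conn E {x3, x0, x1, x2}" "conn E {x3, x0, x1, x4}"
    by (intro step conn_singleton edges edges')+
  then show "conn E (?A i)" if "i < 4" for i
    using that by (auto simp: less_Suc_eq eval_nat_numeral)
  show "conn E {x4, x1, x0, x2, x5}"
    by (intro step conn_singleton edges edges')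
  have sum: "(\<Sum>i<4. x i * of_bool (v \<in> ?A i) :: rat) = x 0 * of_bool (v \<in> {x0, x2}) + x 1 * of_bool (v \<in> {x1, x2, x5})
      + x 2 * of_bool (v \<in> {x3, x0, x1, x2}) + x 3 * of_bool (v \<in> {x3, x0, x1, x4})" for x v
    by (simp only: sum_lessThan_4 A)
  show "of_bool (v \<in> {x4, x1, x0, x2, x5}) = (\<Sum>i<4. [1, 1, - 1, 1] ! i * of_bool (v \<in> ?A i) :: rat)" for v
    unfolding sum using d by (auto simp: of_bool_def)
  have at: "x 0 * of_bool (x0 \<in> {x0, x2}) + x 1 * of_bool (x0 \<in> {x1, x2, x5}) + x 2 * of_bool (x0 \<in> {x3, x0, x1, x2}) + x 3 * of_bool (x0 \<in> {x3, x0, x1, x4}) = x 0 + x 2 + x 3"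
    "x 0 * of_bool (x1 \<in> {x0, x2}) + x 1 * of_bool (x1 \<in> {x1, x2, x5}) + x 2 * of_bool (x1 \<in> {x3, x0, x1, x2}) + x 3 * of_bool (x1 \<in> {x3, x0, x1, x4}) = x 1 + x 2 + x 3"
    "x 0 * of_bool (x2 \<in> {x0, x2}) + x 1 * of_bool (x2 \<in> {x1, x2, x5}) + x 2 * of_bool (x2 \<in> {x3, x0, x1, x2}) + x 3 * of_bool (x2 \<in> {x3, x0, x1, x4}) = x 0 + x 1 + x 2"
    "x 0 * of_bool (x3 \<in> {x0, x2}) + x 1 * of_bool (x3 \<in> {x1, x2, x5}) + x 2 * of_bool (x3 \<in> {x3, x0, x1, x2}) + x 3 * of_bool (x3 \<in> {x3, x0, x1, x4}) = x 2 + x 3"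
    "x 0 * of_bool (x4 \<in> {x0, x2}) + x 1 * of_bool (x4 \<in> {x1, x2, x5}) + x 2 * of_bool (x4 \<in> {x3, x0, x1, x2}) + x 3 * of_bool (x4 \<in> {x3, x0, x1, x4}) = x 3"
    "x 0 * of_bool (x5 \<in> {x0, x2}) + x 1 * of_bool (x5 \<in> {x1, x2, x5}) + x 2 * of_bool (x5 \<in> {x3, x0, x1, x2}) + x 3 * of_bool (x5 \<in> {x3, x0, x1, x4}) = x 1"
    for x :: "nat \<Rightarrow> rat"
    using d d' by simp_all
  show "\<forall>i<4. x i = 0" if *: "\<forall>v. (\<Sum>i<4. x i * of_bool (v \<in> ?A i) :: rat) = 0" for x
  proof -
    have "x 0 = 0 \<and> x 1 = 0 \<and> x 2 = 0 \<and> x 3 = 0"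
      using *[rule_format, of x0] *[rule_format, of x3] *[rule_format, of x4] *[rule_format, of x5]
      unfolding sum at by linarith
    then show ?thesis by (auto simp: less_Suc_eq eval_nat_numeral)
  qed
  show "I = {x4, x1, x0, x2, x5} \<or> (\<exists>i<4. I = ?A i)"
    if I: "conn E I" and *: "\<forall>v. of_bool (v \<in> I) = (\<Sum>i<4. x i * of_bool (v \<in> ?A i) :: rat)" for x I
  proof -
    note * = *[rule_format, unfolded sum]
    note eqs = *[of x0, unfolded at] *[of x1, unfolded at] *[of x2, unfolded at] *[of x3, unfolded at]
      *[of x4, unfolded at] *[of x5, unfolded at]
    have "of_bool (x1 \<in> I) = (of_bool (x5 \<in> I) + of_bool (x3 \<in> I) :: rat)"
      "of_bool (x2 \<in> I) = (of_bool (x0 \<in> I) + of_bool (x5 \<in> I) - of_bool (x4 \<in> I) :: rat)"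
      unfolding eqs by simp_all
    note bool = this[unfolded of_bool_sum_iff]
    have sub: "I \<subseteq> {x0, x1, x2, x3, x4, x5}"
    proof
      fix v assume "v \<in> I"
      then show "v \<in> {x0, x1, x2, x3, x4, x5}" using *[of v] by (auto simp: of_bool_def split: if_splits)
    qed
    have c3: "x0 \<in> I" if "x3 \<in> I" "y \<in> I" "y \<noteq> x3" for y
      by (rule conn_cut[OF I that(1) _ that(2), of "{x3}"]) (use sub non3 that(3) edges in auto)
    have c4: "x1 \<in> I" if "x4 \<in> I" "y \<in> I" "y \<noteq> x4" for y
      by (rule conn_cut[OF I that(1) _ that(2), of "{x4}"]) (use sub non4 that(3) edges in auto)
    have c5: "x2 \<in> I" if "x5 \<in> I" "y \<in> I" "y \<noteq> x5" for y
      by (rule conn_cut[OF I that(1) _ that(2), of "{x5}"]) (use sub non5 that(3) edges in auto)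
    have ne: "x0 \<in> I \<or> x1 \<in> I \<or> x2 \<in> I \<or> x3 \<in> I \<or> x4 \<in> I \<or> x5 \<in> I"
      using I sub by (auto simp: conn_def)
    have sets: "I = {x4, x1, x0, x2, x5} \<or> I = {x0, x2} \<or> I = {x1, x2, x5} \<or> I = {x3, x0, x1, x2} \<or> I = {x3, x0, x1, x4}"
    proof -
      have "x4 \<in> I \<and> x1 \<in> I \<and> x0 \<in> I \<and> x2 \<in> I \<and> x5 \<in> I \<and> x3 \<notin> I \<or>
          x0 \<in> I \<and> x2 \<in> I \<and> x1 \<notin> I \<and> x3 \<notin> I \<and> x4 \<notin> I \<and> x5 \<notin> I \<or>
          x1 \<in> I \<and> x2 \<in> I \<and> x5 \<in> I \<and> x0 \<notin> I \<and> x3 \<notin> I \<and> x4 \<notin> I \<or>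
          x3 \<in> I \<and> x0 \<in> I \<and> x1 \<in> I \<and> x2 \<in> I \<and> x4 \<notin> I \<and> x5 \<notin> I \<or>
          x3 \<in> I \<and> x0 \<in> I \<and> x1 \<in> I \<and> x4 \<in> I \<and> x2 \<notin> I \<and> x5 \<notin> I"
        by (rule net_bool[OF bool]) (use ne d d' c3 c4 c5 in auto)
      then show ?thesis
      proof (elim disjE conjE)
        assume "x4 \<in> I" "x1 \<in> I" "x0 \<in> I" "x2 \<in> I" "x5 \<in> I" "x3 \<notin> I"
        then have "I = {x4, x1, x0, x2, x5}" using sub by blast
        then show ?thesis by blast
      next
        assume "x0 \<in> I" "x2 \<in> I" "x1 \<notin> I" "x3 \<notin> I" "x4 \<notin> I" "x5 \<notin> I"
        then have "I = {x0, x2}" using sub by blast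
        then show ?thesis by blast
      next
        assume "x1 \<in> I" "x2 \<in> I" "x5 \<in> I" "x0 \<notin> I" "x3 \<notin> I" "x4 \<notin> I"
        then have "I = {x1, x2, x5}" using sub by blast
        then show ?thesis by blast
      next
        assume "x3 \<in> I" "x0 \<in> I" "x1 \<in> I" "x2 \<in> I" "x4 \<notin> I" "x5 \<notin> I"
        then have "I = {x3, x0, x1, x2}" using sub by blast
        then show ?thesis by blast
      next
        assume "x3 \<in> I" "x0 \<in> I" "x1 \<in> I" "x4 \<in> I" "x2 \<notin> I" "x5 \<notin> I"
        then have "I = {x3, x0, x1, x4}" using sub by blast
        then show ?thesis by blast
      qed
    qed
    then have "I = {x4, x1, x0, x2, x5} \<or> I = ?A 0 \<or> I = ?A 1 \<or> I = ?A 2 \<or> I = ?A 3"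
      by (simp only: A)
    moreover have "(0::nat) < 4" "(1::nat) < 4" "(2::nat) < 4" "(3::nat) < 4" by simp_all
    ultimately show ?thesis by blast
  qed
qed (simp_all)

text \<open>Five independent indicators on seven vertices leave the equations
  \<open>x2 + x3 = x1 + x6\<close> and \<open>x0 + x4 = x1 + x5\<close> on indicator values;
  connectivity along the three legs does the rest.\<close>

lemma TNF_spider:
  fixes x0 x1 x2 x3 x4 x5 x6 :: "'v::finite"
  assumes E: "sym E" and d: "distinct [x0, x1, x2, x3, x4, x5, x6]"
    and edges: "(x0, x1) \<in> E" "(x1, x2) \<in> E" "(x0, x3) \<in> E" "(x3, x4) \<in> E" "(x0, x5) \<in> E" "(x5, x6) \<in> E"
    and non2: "\<And>v. v \<in> {x0, x3, x4, x5, x6} \<Longrightarrow> (x2, v) \<notin> E"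
    and non4: "\<And>v. v \<in> {x0, x1, x2, x5, x6} \<Longrightarrow> (x4, v) \<notin> E"
    and non6: "\<And>v. v \<in> {x0, x1, x2, x3, x4} \<Longrightarrow> (x6, v) \<notin> E"
    and non1: "\<And>v. v \<in> {x3, x4, x5, x6} \<Longrightarrow> (x1, v) \<notin> E"
    and non3: "\<And>v. v \<in> {x1, x2, x5, x6} \<Longrightarrow> (x3, v) \<notin> E"
    and non5: "\<And>v. v \<in> {x1, x2, x3, x4} \<Longrightarrow> (x5, v) \<notin> E"
  shows "TNF E"
proof (rule TNF_if_closed_circuit[where r = 5 and D = "{x4, x3, x0, x1, x5}" and a = "\<lambda>i. [1, 1, - 1, 1, - 1] ! i"
      and A = "\<lambda>i. [{x0, x1, x2, x3, x4, x5, x6}, {x0, x5}, {x0, x1, x2}, {x3, x0, x1}, {x3, x0, x5, x6}] ! i"])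
  let ?A = "\<lambda>i. [{x0, x1, x2, x3, x4, x5, x6}, {x0, x5}, {x0, x1, x2}, {x3, x0, x1}, {x3, x0, x5, x6}] ! i"
  have A: "?A 0 = {x0, x1, x2, x3, x4, x5, x6}" "?A 1 = {x0, x5}" "?A 2 = {x0, x1, x2}" "?A 3 = {x3, x0, x1}"
      "?A 4 = {x3, x0, x5, x6}"
    by simp_all
  have d': "distinct [x6, x5, x4, x3, x2, x1, x0]" using d by auto
  have edges': "(x1, x0) \<in> E" "(x2, x1) \<in> E" "(x3, x0) \<in> E" "(x4, x3) \<in> E" "(x5, x0) \<in> E" "(x6, x5) \<in> E"
    using edges E by (auto dest: symD)
  have step: "conn E (insert b (insert a A))" if "conn E (insert a A)" "(a, b) \<in> E" for a b A
    using conn_insert[OF E that(1) _ that(2)] by simp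
  have c: "conn E {x0, x5}" "conn E {x0, x1, x2}" "conn E {x3, x0, x1}" "conn E {x3, x0, x5, x6}" "conn E {x4, x3, x0, x1, x2}"
    by (intro step conn_singleton edges edges')+
  have "conn E (insert x6 (insert x5 {x4, x3, x0, x1, x2}))"
    by (rule step[OF conn_insert[OF E c(5), of x0]]) (use edges in auto)
  moreover have "insert x6 (insert x5 {x4, x3, x0, x1, x2}) = {x0, x1, x2, x3, x4, x5, x6}" by auto
  ultimately have "conn E {x0, x1, x2, x3, x4, x5, x6}" by simp
  then show "conn E (?A i)" if "i < 5" for i
    using that c by (auto simp: less_Suc_eq eval_nat_numeral)
  have "conn E (insert x5 {x4, x3, x0, x1})"
    by (rule conn_insert[OF E, of _ x0]) (intro step conn_singleton edges edges', use edges in auto)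
  then show "conn E {x4, x3, x0, x1, x5}" by (simp add: insert_commute)
  have sum: "(\<Sum>i<5. x i * of_bool (v \<in> ?A i) :: rat) = x 0 * of_bool (v \<in> {x0, x1, x2, x3, x4, x5, x6})
      + x 1 * of_bool (v \<in> {x0, x5}) + x 2 * of_bool (v \<in> {x0, x1, x2}) + x 3 * of_bool (v \<in> {x3, x0, x1})
      + x 4 * of_bool (v \<in> {x3, x0, x5, x6})" for x v
    by (simp only: sum_lessThan_5 A)
  show "of_bool (v \<in> {x4, x3, x0, x1, x5}) = (\<Sum>i<5. [1, 1, - 1, 1, - 1] ! i * of_bool (v \<in> ?A i) :: rat)" for v
    unfolding sum using d by (auto simp: of_bool_def)
  define F where "F x v = x 0 * of_bool (v \<in> {x0, x1, x2, x3, x4, x5, x6})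
      + x 1 * of_bool (v \<in> {x0, x5}) + x 2 * of_bool (v \<in> {x0, x1, x2}) + x 3 * of_bool (v \<in> {x3, x0, x1})
      + x 4 * of_bool (v \<in> {x3, x0, x5, x6})" for x :: "nat \<Rightarrow> rat" and v
  have at: "F x x0 = x 0 + x 1 + x 2 + x 3 + x 4" "F x x1 = x 0 + x 2 + x 3" "F x x2 = x 0 + x 2"
      "F x x3 = x 0 + x 3 + x 4" "F x x4 = x 0" "F x x5 = x 0 + x 1 + x 4" "F x x6 = x 0 + x 4" for x
    unfolding F_def using d d' by simp_all
  note sum = sum[folded F_def]
  show "\<forall>i<5. x i = 0" if *: "\<forall>v. (\<Sum>i<5. x i * of_bool (v \<in> ?A i) :: rat) = 0" for x
  proof -
    have "x 0 = 0 \<and> x 1 = 0 \<and> x 2 = 0 \<and> x 3 = 0 \<and> x 4 = 0"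
      using *[rule_format, of x4] *[rule_format, of x2] *[rule_format, of x6] *[rule_format, of x1] *[rule_format, of x5]
      unfolding sum at by linarith
    then show ?thesis by (auto simp: less_Suc_eq eval_nat_numeral)
  qed
  show "I = {x4, x3, x0, x1, x5} \<or> (\<exists>i<5. I = ?A i)"
    if I: "conn E I" and *: "\<forall>v. of_bool (v \<in> I) = (\<Sum>i<5. x i * of_bool (v \<in> ?A i) :: rat)" for x I
  proof -
    note * = *[rule_format, unfolded sum]
    note eqs = *[of x0, unfolded at] *[of x1, unfolded at] *[of x2, unfolded at] *[of x3, unfolded at]
      *[of x4, unfolded at] *[of x5, unfolded at] *[of x6, unfolded at]
    have "of_bool (x3 \<in> I) = (of_bool (x6 \<in> I) + of_bool (x1 \<in> I) - of_bool (x2 \<in> I) :: rat)"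
      "of_bool (x0 \<in> I) = (of_bool (x5 \<in> I) + of_bool (x1 \<in> I) - of_bool (x4 \<in> I) :: rat)"
      unfolding eqs by simp_all
    note bool = this[unfolded of_bool_sum_iff]
    let ?X = "{x0, x1, x2, x3, x4, x5, x6}"
    have sub: "I \<subseteq> ?X"
    proof
      fix v assume "v \<in> I"
      then show "v \<in> ?X" using *[of v] unfolding F_def by (auto simp: of_bool_def split: if_splits)
    qed
    have c2: "x1 \<in> I" if "x2 \<in> I" "y \<in> I" "y \<noteq> x2" for y
      by (rule conn_cut[OF I that(1) _ that(2), of "{x2}"]) (use sub non2 that(3) in auto)
    have c4: "x3 \<in> I" if "x4 \<in> I" "y \<in> I" "y \<noteq> x4" for y
      by (rule conn_cut[OF I that(1) _ that(2), of "{x4}"]) (use sub non4 that(3) in auto)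
    have c6: "x5 \<in> I" if "x6 \<in> I" "y \<in> I" "y \<noteq> x6" for y
      by (rule conn_cut[OF I that(1) _ that(2), of "{x6}"]) (use sub non6 that(3) in auto)
    have c1: "x0 \<in> I" if "x1 \<in> I" "y \<in> I" "y \<notin> {x1, x2}" for y
      by (rule conn_cut[OF I that(1) _ that(2), of "{x1, x2}"]) (use sub non1 non2 that(3) in auto)
    have c3: "x0 \<in> I" if "x3 \<in> I" "y \<in> I" "y \<notin> {x3, x4}" for y
      by (rule conn_cut[OF I that(1) _ that(2), of "{x3, x4}"]) (use sub non3 non4 that(3) in auto)
    have c5: "x0 \<in> I" if "x5 \<in> I" "y \<in> I" "y \<notin> {x5, x6}" for y
      by (rule conn_cut[OF I that(1) _ that(2), of "{x5, x6}"]) (use sub non5 non6 that(3) in auto)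
    have ne: "x0 \<in> I \<or> x1 \<in> I \<or> x2 \<in> I \<or> x3 \<in> I \<or> x4 \<in> I \<or> x5 \<in> I \<or> x6 \<in> I"
      using I sub by (auto simp: conn_def)
    note dl = d[unfolded distinct.simps list.set insert_iff empty_iff de_Morgan_disj]
    have i2: "x2 \<in> I \<and> (x0 \<in> I \<or> x1 \<in> I \<or> x3 \<in> I \<or> x4 \<in> I \<or> x5 \<in> I \<or> x6 \<in> I) \<longrightarrow> x1 \<in> I"
      using c2 dl by blast
    have i1: "x1 \<in> I \<and> (x0 \<in> I \<or> x3 \<in> I \<or> x4 \<in> I \<or> x5 \<in> I \<or> x6 \<in> I) \<longrightarrow> x0 \<in> I"
      using c1 dl by blast
    have i4: "x4 \<in> I \<and> (x0 \<in> I \<or> x1 \<in> I \<or> x2 \<in> I \<or> x3 \<in> I \<or> x5 \<in> I \<or> x6 \<in> I) \<longrightarrow> x3 \<in> I"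
      using c4 dl by blast
    have i3: "x3 \<in> I \<and> (x0 \<in> I \<or> x1 \<in> I \<or> x2 \<in> I \<or> x5 \<in> I \<or> x6 \<in> I) \<longrightarrow> x0 \<in> I"
      using c3 dl by blast
    have i6: "x6 \<in> I \<and> (x0 \<in> I \<or> x1 \<in> I \<or> x2 \<in> I \<or> x3 \<in> I \<or> x4 \<in> I \<or> x5 \<in> I) \<longrightarrow> x5 \<in> I"
      using c6 dl by blast
    have i5: "x5 \<in> I \<and> (x0 \<in> I \<or> x1 \<in> I \<or> x2 \<in> I \<or> x3 \<in> I \<or> x4 \<in> I) \<longrightarrow> x0 \<in> I"
      using c5 dl by blast
    have "x0 \<in> I \<and> x1 \<in> I \<and> x3 \<in> I \<and> x4 \<in> I \<and> x5 \<in> I \<and> x2 \<notin> I \<and> x6 \<notin> I \<or>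
        x0 \<in> I \<and> x1 \<in> I \<and> x2 \<in> I \<and> x3 \<in> I \<and> x4 \<in> I \<and> x5 \<in> I \<and> x6 \<in> I \<or>
        x0 \<in> I \<and> x5 \<in> I \<and> x1 \<notin> I \<and> x2 \<notin> I \<and> x3 \<notin> I \<and> x4 \<notin> I \<and> x6 \<notin> I \<or>
        x0 \<in> I \<and> x1 \<in> I \<and> x2 \<in> I \<and> x3 \<notin> I \<and> x4 \<notin> I \<and> x5 \<notin> I \<and> x6 \<notin> I \<or>
        x0 \<in> I \<and> x1 \<in> I \<and> x3 \<in> I \<and> x2 \<notin> I \<and> x4 \<notin> I \<and> x5 \<notin> I \<and> x6 \<notin> I \<or>
        x0 \<in> I \<and> x3 \<in> I \<and> x5 \<in> I \<and> x6 \<in> I \<and> x1 \<notin> I \<and> x2 \<notin> I \<and> x4 \<notin> I"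
      by (rule spider_bool[OF bool i2 i1 i4 i3 i6 i5 ne])
    then have sets: "I = {x4, x3, x0, x1, x5} \<or> I = ?X \<or> I = {x0, x5} \<or> I = {x0, x1, x2} \<or> I = {x3, x0, x1} \<or> I = {x3, x0, x5, x6}"
    proof (elim disjE conjE)
      assume "x0 \<in> I" "x1 \<in> I" "x3 \<in> I" "x4 \<in> I" "x5 \<in> I" "x2 \<notin> I" "x6 \<notin> I"
      then have "I = {x4, x3, x0, x1, x5}" using sub by blast
      then show ?thesis by blast
    next
      assume "x0 \<in> I" "x1 \<in> I" "x2 \<in> I" "x3 \<in> I" "x4 \<in> I" "x5 \<in> I" "x6 \<in> I"
      then have "I = ?X" using sub by blast
      then show ?thesis by blast
    next
      assume "x0 \<in> I" "x5 \<in> I" "x1 \<notin> I" "x2 \<notin> I" "x3 \<notin> I" "x4 \<notin> I" "x6 \<notin> I"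
      then have "I = {x0, x5}" using sub by blast
      then show ?thesis by blast
    next
      assume "x0 \<in> I" "x1 \<in> I" "x2 \<in> I" "x3 \<notin> I" "x4 \<notin> I" "x5 \<notin> I" "x6 \<notin> I"
      then have "I = {x0, x1, x2}" using sub by blast
      then show ?thesis by blast
    next
      assume "x0 \<in> I" "x1 \<in> I" "x3 \<in> I" "x2 \<notin> I" "x4 \<notin> I" "x5 \<notin> I" "x6 \<notin> I"
      then have "I = {x3, x0, x1}" using sub by blast
      then show ?thesis by blast
    next
      assume "x0 \<in> I" "x3 \<in> I" "x5 \<in> I" "x6 \<in> I" "x1 \<notin> I" "x2 \<notin> I" "x4 \<notin> I"
      then have "I = {x3, x0, x5, x6}" using sub by blast
      then show ?thesis by blast
    qed
    then have "I = {x4, x3, x0, x1, x5} \<or> I = ?A 0 \<or> I = ?A 1 \<or> I = ?A 2 \<or> I = ?A 3 \<or> I = ?A 4"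
      by (simp only: A)
    moreover have "(0::nat) < 5" "(1::nat) < 5" "(2::nat) < 5" "(3::nat) < 5" "(4::nat) < 5" by simp_all
    ultimately show ?thesis by blast
  qed
qed (simp_all)

section \<open>Graphs without a generic localization\<close>

text \<open>Isomorphism with the undirected graph with vertices \<open>V\<close> and edges
  \<open>R\<close>, kept as a labelling of vertices; \<open>R\<close> may list each edge in one
  direction only.\<close>

definition is_model :: "('v \<times> 'v) set \<Rightarrow> nat set \<Rightarrow> (nat \<times> nat) set \<Rightarrow> bool" where
  "is_model E V R \<longleftrightarrow> (\<exists>f. bij_betw f V UNIV \<and> (\<forall>i\<in>V. \<forall>j\<in>V. (f i, f j) \<in> E \<longleftrightarrow> (i, j) \<in> R \<union> R\<inverse>))"

locale sgraph =
  fixes E :: "('v::finite \<times> 'v) set"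
  assumes sym: "sym E" and irrefl: "(v, v) \<notin> E" and connected: "conn E UNIV"
begin

lemma commute: "(u, v) \<in> E \<longleftrightarrow> (v, u) \<in> E"
  using sym by (meson symD)

lemma adjacent_outside:
  assumes "X \<noteq> {}" "X \<noteq> UNIV"
  obtains u x where "u \<notin> X" "x \<in> X" "(u, x) \<in> E"
proof -
  from assms obtain x y where "x \<in> X" "y \<notin> X" by auto
  then show thesis
    by (rule_tac conn_crossing[OF connected UNIV_I _ UNIV_I]) (use that commute in auto)
qed

lemma conn_pair: "(u, v) \<in> E \<Longrightarrow> conn E {u, v}"
  using conn_insert[OF sym conn_singleton, of v v u] commute by auto

lemma conn_insert2:
  assumes "conn E A" "a \<in> A" "(b, a) \<in> E" "a' \<in> A" "(b', a') \<in> E"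
  shows "conn E (insert b' (insert b A))"
proof (rule conn_insert[OF sym])
  show "conn E (insert b A)"
    using assms commute by (intro conn_insert[OF sym, of A a]) auto
  show "a' \<in> insert b A" "(a', b') \<in> E" using assms commute by auto
qed

lemma not_conn_pair: "(u, v) \<notin> E \<Longrightarrow> u \<noteq> v \<Longrightarrow> \<not> conn E {u, v}"
proof
  assume *: "(u, v) \<notin> E" "u \<noteq> v" "conn E {u, v}"
  then show False by (rule_tac conn_crossing[OF *(3), of u "{u}" v]) auto
qed

text \<open>A hub with four singleton blocks: adding any two neighbours to \<open>C\<close> keeps it
  connected.\<close>

lemma TNF_star:
  assumes C: "conn E C" and y: "distinct [y1, y2, y3, y4]" "y1 \<notin> C" "y2 \<notin> C" "y3 \<notin> C" "y4 \<notin> C"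
    and adj: "\<exists>c\<in>C. (y1, c) \<in> E" "\<exists>c\<in>C. (y2, c) \<in> E" "\<exists>c\<in>C. (y3, c) \<in> E" "\<exists>c\<in>C. (y4, c) \<in> E"
  shows "TNF E"
proof -
  have step: "conn E (C \<union> {y} \<union> {y'})" if "\<exists>c\<in>C. (y, c) \<in> E" "\<exists>c\<in>C. (y', c) \<in> E" for y y'
    using that conn_insert2[OF C] by (auto simp: insert_commute)
  obtain c where "c \<in> C" using adj by auto
  show ?thesis
  proof (rule TNF_hub[where ?B0.0 = C and ?B1.0 = "{y1}" and ?B2.0 = "{y2}" and ?B3.0 = "{y3}" and ?B4.0 = "{y4}"])
    show "conn E (C \<union> {y1} \<union> {y2})" "conn E (C \<union> {y3} \<union> {y4})" "conn E (C \<union> {y1} \<union> {y3})"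
        "conn E (C \<union> {y2} \<union> {y4})"
      by (intro step adj)+
  qed (use y \<open>c \<in> C\<close> in auto)
qed

text \<open>If \<open>u\<close> is adjacent to \<open>s\<close> or \<open>t\<close>, that vertex is
  the centre of a star. Otherwise \<open>u\<close> is paired with a nonadjacent vertex of the
  diamond to form the disconnected block \<open>D\<close> of \<open>TNF_beta\<close>: with the other
  one of \<open>p\<close>, \<open>q\<close> if it sees exactly one of them, with \<open>t\<close> if
  it sees both.\<close>

lemma TNF_diamond:
  assumes d: "distinct [p, q, s, t, u]"
    and E: "(p, s) \<in> E" "(p, t) \<in> E" "(q, s) \<in> E" "(q, t) \<in> E" "(s, t) \<in> E" "(p, q) \<notin> E"
    and u: "(u, p) \<in> E \<or> (u, q) \<in> E \<or> (u, s) \<in> E \<or> (u, t) \<in> E"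
  shows "TNF E"
proof -
  have star: "TNF E" if "(u, s) \<in> E" "(t, s) \<in> E" "(p, s) \<in> E" "(q, s) \<in> E" "distinct [p, q, s, t, u]" for s t
    by (rule TNF_star[of "{s}" p q t u]) (use that d in auto)
  have kite: "TNF E" if "(u, p) \<in> E" "(u, q) \<notin> E" "(p, q) \<notin> E" "(p, s) \<in> E" "(p, t) \<in> E" "(q, s) \<in> E" "(q, t) \<in> E"
    "distinct [p, q, s, t, u]" for p q
  proof (rule TNF_beta[where C = "{p}" and A = "{s}" and B = "{t}" and D = "{q, u}" and a = s and b = t and c = p and d = q])
    show "conn E ({p} \<union> {s})" "conn E ({p} \<union> {t})" using that commute by (auto intro: conn_pair)
    show "conn E ({p} \<union> {s} \<union> {q, u})"
    proof -
      have "conn E (insert u (insert q {p, s}))"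
        by (rule conn_insert2[of _ s _ p]) (use that commute in \<open>auto intro: conn_pair\<close>)
      then show ?thesis by (simp add: insert_commute)
    qed
    show "conn E ({p} \<union> {t} \<union> {q, u})"
    proof -
      have "conn E (insert u (insert q {p, t}))"
        by (rule conn_insert2[of _ t _ p]) (use that commute in \<open>auto intro: conn_pair\<close>)
      then show ?thesis by (simp add: insert_commute)
    qed
    show "\<not> conn E {q, u}" using that commute by (intro not_conn_pair) auto
  qed (use that in auto)
  consider "(u, s) \<in> E" | "(u, t) \<in> E" | "(u, p) \<in> E" "(u, q) \<notin> E" | "(u, q) \<in> E" "(u, p) \<notin> E"
    | "(u, p) \<in> E" "(u, q) \<in> E" "(u, s) \<notin> E" "(u, t) \<notin> E"
    using u by blast
  then show ?thesis
  proof cases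
    case 1
    then show ?thesis using star[of s t] d E commute by auto
  next
    case 2
    then show ?thesis using star[of t s] d E commute by auto
  next
    case 3
    then show ?thesis using kite[of p q] d E by auto
  next
    case 4
    then show ?thesis using kite[of q p] d E commute by auto
  next
    case 5
    show ?thesis
    proof (rule TNF_beta[where C = "{s}" and A = "{p}" and B = "{q}" and D = "{t, u}" and a = p and b = q and c = s and d = t])
      show "conn E ({s} \<union> {p})" "conn E ({s} \<union> {q})" using E commute by (auto intro: conn_pair)
      show "conn E ({s} \<union> {p} \<union> {t, u})"
      proof -
        have "conn E (insert u (insert t {s, p}))"
          by (rule conn_insert2[of _ s _ p]) (use E 5 commute in \<open>auto intro: conn_pair\<close>)
        then show ?thesis by (simp add: insert_commute)
      qed
      show "conn E ({s} \<union> {q} \<union> {t, u})"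
      proof -
        have "conn E (insert u (insert t {s, q}))"
          by (rule conn_insert2[of _ s _ q]) (use E 5 commute in \<open>auto intro: conn_pair\<close>)
        then show ?thesis by (simp add: insert_commute)
      qed
      show "\<not> conn E {t, u}" using 5 d commute by (intro not_conn_pair) auto
    qed (use d in auto)
  qed
qed

subsection \<open>Induced cycles\<close>

definition icyc :: "(nat \<Rightarrow> 'v) \<Rightarrow> nat \<Rightarrow> bool" where
  "icyc c k \<longleftrightarrow> inj_on c {..<k} \<and>
     (\<forall>x<k. \<forall>y<k. (c x, c y) \<in> E \<longleftrightarrow> y = Suc x mod k \<or> x = Suc y mod k)"

lemma mod_add_right_cancel_nat: "(x + d) mod k = (y + d) mod k \<longleftrightarrow> x mod k = y mod (k :: nat)"
proof (cases "x \<le> y")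
  case True
  then show ?thesis
    using mod_eq_dvd_iff_nat[of x y k] mod_eq_dvd_iff_nat[of "x + d" "y + d" k] by auto
next
  case False
  then show ?thesis
    using mod_eq_dvd_iff_nat[of y x k] mod_eq_dvd_iff_nat[of "y + d" "x + d" k] by auto
qed

lemma icyc_rotate:
  assumes c: "icyc c k" and "0 < k"
  shows "icyc (\<lambda>j. c ((j + d) mod k)) k"
  unfolding icyc_def
proof (intro conjI allI impI)
  have inj: "inj_on c {..<k}" and adj: "\<And>x y. x < k \<Longrightarrow> y < k \<Longrightarrow> (c x, c y) \<in> E \<longleftrightarrow> y = Suc x mod k \<or> x = Suc y mod k"
    using c by (auto simp: icyc_def)
  show "inj_on (\<lambda>j. c ((j + d) mod k)) {..<k}"
  proof (rule inj_onI)
    fix x y assume *: "x \<in> {..<k}" "y \<in> {..<k}" "c ((x + d) mod k) = c ((y + d) mod k)"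
    then have "(x + d) mod k = (y + d) mod k" using inj_onD[OF inj] \<open>0 < k\<close> by simp
    then show "x = y" using * by (simp add: mod_add_right_cancel_nat)
  qed
  fix x y assume *: "x < k" "y < k"
  have "(y + d) mod k = Suc ((x + d) mod k) mod k \<longleftrightarrow> y = Suc x mod k" if "y < k" for x y
    using mod_add_right_cancel_nat[of y d k "Suc x"] that by (simp add: mod_Suc_eq)
  then show "(c ((x + d) mod k), c ((y + d) mod k)) \<in> E \<longleftrightarrow> y = Suc x mod k \<or> x = Suc y mod k"
    using adj[of "(x + d) mod k" "(y + d) mod k"] * \<open>0 < k\<close> by simp
qed

lemma conn_segment:
  assumes "a \<le> b" "\<And>i. a \<le> i \<Longrightarrow> i < b \<Longrightarrow> (g i, g (Suc i)) \<in> E"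
  shows "conn E (g ` {a..b})"
  using assms
proof (induction b)
  case (Suc b)
  show ?case
  proof (cases "a \<le> b")
    case True
    then have "conn E (insert (g (Suc b)) (g ` {a..b}))"
      using Suc by (intro conn_insert[OF sym, of _ "g b"]) auto
    then show ?thesis using True by (simp add: atLeastAtMostSuc_conv)
  next
    case False
    then show ?thesis using Suc.prems by (simp add: le_Suc_eq)
  qed
qed simp

text \<open>Removing position 0 opens the cycle into a path, which \<open>c x\<close> splits into
  the blocks \<open>A\<close> and \<open>B\<close>. The block \<open>D\<close> consists of
  \<open>u\<close> and \<open>c 0\<close>, which are not adjacent: \<open>c 0\<close> is attached to
  the outer ends of both halves, \<open>u\<close> through \<open>c y\<close> to one and through
  \<open>c z\<close> to the other.\<close>

lemma icyc_attached_aux: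
  assumes c: "icyc c k" and u: "u \<notin> c ` {..<k}" "(u, c 0) \<notin> E"
    and x: "2 \<le> x" "x \<le> k - 2" and y: "1 \<le> y" "y \<le> x" "(u, c y) \<in> E" and z: "x \<le> z" "z < k" "(u, c z) \<in> E"
  shows "TNF E"
proof -
  have inj: "inj_on c {..<k}" and adj: "\<And>x y. x < k \<Longrightarrow> y < k \<Longrightarrow> (c x, c y) \<in> E \<longleftrightarrow> y = Suc x mod k \<or> x = Suc y mod k"
    using c by (auto simp: icyc_def)
  have k: "4 \<le> k" using x by simp
  have seg: "conn E (c ` {a..b})" if "a \<le> b" "b < k" for a b
    using that by (intro conn_segment) (auto simp: adj)
  have eq: "c i = c j \<longleftrightarrow> i = j" if "i < k" "j < k" for i j
    using inj that by (auto dest: inj_onD)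
  have c0: "(c 1, c 0) \<in> E" "(c (k - 1), c 0) \<in> E"
    using k adj[of 1 0] adj[of "k - 1" 0] by auto
  have u': "k \<le> i" if "u = c i" for i using u(1) that by (metis image_eqI lessThan_iff not_less)
  show ?thesis
  proof (rule TNF_beta[where C = "{c x}" and A = "c ` {1..x - 1}" and B = "c ` {x + 1..k - 1}" and D = "{c 0, u}"
        and c = "c x" and a = "c 1" and b = "c (x + 1)" and d = "c 0"])
    have CA: "{c x} \<union> c ` {1..x - 1} = c ` {1..x}"
    proof -
      have "{1..x} = insert x {1..x - 1}" using x by auto
      then show ?thesis by auto
    qed
    have CB: "{c x} \<union> c ` {x + 1..k - 1} = c ` {x..k - 1}"
    proof -
      have "{x..k - 1} = insert x {x + 1..k - 1}" using x by auto
      then show ?thesis by auto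
    qed
    show 1: "conn E ({c x} \<union> c ` {1..x - 1})" unfolding CA using x by (intro seg) auto
    show 2: "conn E ({c x} \<union> c ` {x + 1..k - 1})" unfolding CB using x by (intro seg) auto
    have "conn E (insert u (insert (c 0) (c ` {1..x})))"
    proof (rule conn_insert2[of _ "c 1" _ "c y"])
      show "conn E (c ` {1..x})" using 1 CA by simp
    qed (use x y c0 commute in auto)
    then show "conn E ({c x} \<union> c ` {1..x - 1} \<union> {c 0, u})" unfolding CA by (simp add: insert_commute)
    have "conn E (insert u (insert (c 0) (c ` {x..k - 1})))"
    proof (rule conn_insert2[of _ "c (k - 1)" _ "c z"])
      show "conn E (c ` {x..k - 1})" using 2 CB by simp
    qed (use x z c0 commute in auto)
    then show "conn E ({c x} \<union> c ` {x + 1..k - 1} \<union> {c 0, u})" unfolding CB by (simp add: insert_commute)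
    show "\<not> conn E {c 0, u}"
      using u k commute by (intro not_conn_pair) auto
  qed (use x k eq in \<open>auto simp: disjoint_iff dest!: u'\<close>)
qed

text \<open>If \<open>u\<close> sees the whole cycle it is the centre of a star. Otherwise a
  rotation moves a vertex that \<open>u\<close> does not see to position 0, and the neighbours of
  \<open>u\<close> serve both halves.\<close>

lemma TNF_icyc_attached:
  assumes c: "icyc c k" and k: "4 \<le> k" and u: "u \<notin> c ` {..<k}" and x: "x < k" "(u, c x) \<in> E"
  shows "TNF E"
proof -
  have inj: "inj_on c {..<k}" using c by (simp add: icyc_def)
  have eq: "c i = c j \<longleftrightarrow> i = j" if "i < k" "j < k" for i j
    using inj that by (auto dest: inj_onD)
  define rot where "rot d j = c ((j + d) mod k)" for d j
  have rot: "icyc (rot d) k" for d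
    unfolding rot_def using icyc_rotate[OF c] k by simp
  have rot_u: "u \<notin> rot d ` {..<k}" for d
    using u k by (auto simp: rot_def)
  have rot_ex: "\<exists>j<k. rot d j = c i" if "i < k" for d i
  proof (intro exI[of _ "(i + (k - d mod k)) mod k"] conjI)
    have dk: "d mod k < k" using k by simp
    have "((i + (k - d mod k)) mod k + d) mod k = (i + (k - d mod k) + d mod k) mod k"
      by (simp add: mod_simps)
    also have "i + (k - d mod k) + d mod k = i + k" using dk by simp
    also have "(i + k) mod k = i" using that by simp
    finally show "rot d ((i + (k - d mod k)) mod k) = c i" by (simp add: rot_def)
  qed (use k in simp)
  show ?thesis
  proof (cases "\<forall>i<k. (u, c i) \<in> E")
    case True
    then show ?thesis
      using k u eq commute by (intro TNF_star[of "{u}" "c 0" "c 1" "c 2" "c 3"]) auto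
  next
    case False
    then obtain d where d: "d < k" "(u, c d) \<notin> E" by blast
    show ?thesis
    proof (cases "\<exists>x'<k. x' \<noteq> x \<and> (u, c x') \<in> E")
      case True
      then obtain x' where x': "x' < k" "x' \<noteq> x" "(u, c x') \<in> E" by blast
      obtain j j' where j: "j < k" "rot d j = c x" and j': "j' < k" "rot d j' = c x'"
        using rot_ex[of x d] rot_ex[of x' d] x x' by blast
      have rot0: "rot d 0 = c d" using d by (simp add: rot_def)
      have main: "TNF E" if jj: "j < j'" "j' < k" "(u, rot d j) \<in> E" "(u, rot d j') \<in> E" for j j'
      proof -
        have "j \<noteq> 0" using jj rot0 d by metis
        \<comment> \<open>The splitting position must be at least 2 so that block \<open>A\<close>
          is nonempty, hence the correction for \<open>j = 1\<close>; it still does not exceed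
          \<open>j'\<close>.\<close>
        define m where "m = (if j = 1 then 2 else j)"
        show ?thesis
          by (rule icyc_attached_aux[OF rot rot_u, of d m j j'])
            (use jj \<open>j \<noteq> 0\<close> d rot0 k in \<open>auto simp: m_def\<close>)
      qed
      have "j \<noteq> j'" using j j' x x' eq by metis
      then show ?thesis
        using main[of j j'] main[of j' j] j j' x x' by (metis nat_neq_iff)
    next
      case False
      \<comment> \<open>This rotation moves the only neighbour of \<open>u\<close> to position
        \<open>k - 2\<close>, where it can itself be the splitting vertex, and leaves a vertex
        unseen by \<open>u\<close> at position 0.\<close>
      let ?d = "x + 2"
      have "(2 + x) mod k \<noteq> x"
      proof
        assume "(2 + x) mod k = x"
        then have "(2 + x) mod k = (0 + x) mod k" using x by simp
        then show False using k by (simp only: mod_add_right_cancel_nat) simp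
      qed
      then have 0: "(u, rot ?d 0) \<notin> E"
        using False k unfolding rot_def by (metis add.commute add_0 mod_less_divisor zero_less_numeral less_le_trans)
      have "rot ?d (k - 2) = c x"
      proof -
        have "k - 2 + (x + 2) = x + k" using k by simp
        then show ?thesis using x(1) unfolding rot_def by (simp only: mod_add_self2 mod_less)
      qed
      then show ?thesis
        using x k 0 by (intro icyc_attached_aux[OF rot rot_u, of ?d "k - 2" "k - 2" "k - 2"]) auto
    qed
  qed
qed

subsection \<open>Longest induced paths\<close>

definition ipath :: "(nat \<Rightarrow> 'v) \<Rightarrow> nat \<Rightarrow> bool" where
  "ipath f m \<longleftrightarrow> inj_on f {1..m} \<and> (\<forall>i\<in>{1..m}. \<forall>j\<in>{1..m}. (f i, f j) \<in> E \<longleftrightarrow> j = Suc i \<or> i = Suc j)"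

lemma ipath_prefix: "ipath f m \<Longrightarrow> m' \<le> m \<Longrightarrow> ipath f m'"
  unfolding ipath_def by (auto intro: inj_on_subset)

lemma ipath_reverse: "ipath f m \<Longrightarrow> ipath (\<lambda>i. f (m + 1 - i)) m"
  unfolding ipath_def
proof (elim conjE, intro conjI ballI)
  assume inj: "inj_on f {1..m}" and adj: "\<forall>i\<in>{1..m}. \<forall>j\<in>{1..m}. (f i, f j) \<in> E \<longleftrightarrow> j = Suc i \<or> i = Suc j"
  show "inj_on (\<lambda>i. f (m + 1 - i)) {1..m}"
    using inj by (auto intro!: inj_onI dest!: inj_onD)
  fix i j assume "i \<in> {1..m}" "j \<in> {1..m}"
  then have "m + 1 - i \<in> {1..m}" "m + 1 - j \<in> {1..m}"
    and "m + 1 - j = Suc (m + 1 - i) \<or> m + 1 - i = Suc (m + 1 - j) \<longleftrightarrow> j = Suc i \<or> i = Suc j"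
    by auto
  then show "(f (m + 1 - i), f (m + 1 - j)) \<in> E \<longleftrightarrow> j = Suc i \<or> i = Suc j"
    using adj by blast
qed

lemma ipath_append:
  assumes f: "ipath f m" and v: "v \<notin> f ` {1..m}" "\<And>i. i \<in> {1..m} \<Longrightarrow> (v, f i) \<in> E \<longleftrightarrow> i = m"
  shows "ipath (f(Suc m := v)) (Suc m)"
  unfolding ipath_def
proof (intro conjI ballI)
  show "inj_on (f(Suc m := v)) {1..Suc m}"
  proof -
    have set: "{1..Suc m} = insert (Suc m) {1..m}" by auto
    have im: "(f(Suc m := v)) ` ({1..m} - {Suc m}) = f ` {1..m}" by (rule image_cong) auto
    have "inj_on (f(Suc m := v)) {1..m}"
      using f v(1) by (intro inj_on_fun_updI) (simp_all add: ipath_def)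
    then show ?thesis unfolding set inj_on_insert im using v(1) by simp
  qed
  fix i j assume "i \<in> {1..Suc m}" "j \<in> {1..Suc m}"
  then consider "i \<in> {1..m}" "j \<in> {1..m}" | "i = Suc m" "j \<in> {1..m}" | "i \<in> {1..m}" "j = Suc m" | "i = Suc m" "j = Suc m"
    by fastforce
  then show "((f(Suc m := v)) i, (f(Suc m := v)) j) \<in> E \<longleftrightarrow> j = Suc i \<or> i = Suc j"
  proof cases
    case 1
    then show ?thesis using f unfolding ipath_def by auto
  qed (use v irrefl commute in auto)
qed

end

section \<open>Classification along a longest induced path\<close>

context sgraph
begin

definition in_family :: bool where
  "in_family \<longleftrightarrow> (\<exists>n\<ge>1. is_model E {1..n} (path_edges n)) \<or>
     (\<exists>n\<ge>3. is_model E {1..n} (path_edges n \<union> {(n, 1)})) \<or>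
     (\<exists>n k. 1 \<le> k \<and> k \<le> n \<and> is_model E {1..n + 1} (path_edges n \<union> {(k, n + 1)})) \<or>
     (\<exists>n k. 1 \<le> k \<and> k < n \<and> is_model E {1..n + 1} (path_edges n \<union> {(k, n + 1), (k + 1, n + 1)}))"

lemma in_familyI:
  "1 \<le> n \<Longrightarrow> is_model E {1..n} (path_edges n) \<Longrightarrow> in_family"
  "3 \<le> n \<Longrightarrow> is_model E {1..n} (path_edges n \<union> {(n, 1)}) \<Longrightarrow> in_family"
  "1 \<le> k \<Longrightarrow> k \<le> n \<Longrightarrow> is_model E {1..n + 1} (path_edges n \<union> {(k, n + 1)}) \<Longrightarrow> in_family"
  "1 \<le> k \<Longrightarrow> k < n \<Longrightarrow> is_model E {1..n + 1} (path_edges n \<union> {(k, n + 1), (k + 1, n + 1)}) \<Longrightarrow> in_family"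
  unfolding in_family_def by blast+

lemma path_edges_iff: "(i, j) \<in> path_edges n \<longleftrightarrow> 1 \<le> i \<and> i < n \<and> j = Suc i"
  by (auto simp: path_edges_def)

text \<open>The vertex \<open>v\<close> closes the stretch of the path between two successive
  neighbours to an induced cycle of length at least four. Either it is the whole graph, or a further
  vertex is attached to it and gives the obstruction.\<close>

lemma chord_path:
  assumes f: "ipath f m" and v: "v \<notin> f ` {1..m}"
    and ij: "1 \<le> i" "i + 2 \<le> j" "j \<le> m" "(v, f i) \<in> E" "(v, f j) \<in> E"
    and gap: "\<And>t. i < t \<Longrightarrow> t < j \<Longrightarrow> (v, f t) \<notin> E"
  shows "TNF E \<or> in_family"
proof -
  define k where "k = j - i + 2"
  define c where "c t = (if t = 0 then v else f (i + t - 1))" for t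
  have k: "4 \<le> k" using ij by (simp add: k_def)
  have inj_f: "inj_on f {1..m}"
    and adj_f: "\<And>x y. x \<in> {1..m} \<Longrightarrow> y \<in> {1..m} \<Longrightarrow> (f x, f y) \<in> E \<longleftrightarrow> y = Suc x \<or> x = Suc y"
    using f by (auto simp: ipath_def)
  have range: "i + t - 1 \<in> {1..m}" if "t < k" "t \<noteq> 0" for t
    using that ij by (auto simp: k_def)
  have inj: "inj_on c {..<k}"
  proof (rule inj_onI)
    fix x y assume *: "x \<in> {..<k}" "y \<in> {..<k}" "c x = c y"
    have nv: "f (i + t - 1) \<noteq> v" if "t < k" "t \<noteq> 0" for t
      using range[OF that] v by blast
    show "x = y"
    proof (cases "x = 0 \<or> y = 0")
      case True
      then show ?thesis using * nv[of x] nv[of y] by (auto simp: c_def split: if_splits)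
    next
      case False
      then have "f (i + x - 1) = f (i + y - 1)" using * by (simp add: c_def)
      then have "i + x - 1 = i + y - 1"
        using inj_onD[OF inj_f] range[of x] range[of y] * False by auto
      then show ?thesis using ij(1) by simp
    qed
  qed
  have v_adj: "(v, f (i + t - 1)) \<in> E \<longleftrightarrow> t = 1 \<or> t = k - 1" if "t < k" "t \<noteq> 0" for t
  proof (cases "t = 1 \<or> t = k - 1")
    case True
    then have "i + t - 1 = i \<or> i + t - 1 = j" using ij by (auto simp: k_def)
    then have "(v, f (i + t - 1)) \<in> E" using ij(4,5) by (elim disjE) simp_all
    then show ?thesis using True by blast
  next
    case False
    then have "i < i + t - 1" "i + t - 1 < j" using that by (auto simp: k_def)
    then show ?thesis using gap False by blast
  qed
  have adj: "(c x, c y) \<in> E \<longleftrightarrow> y = Suc x mod k \<or> x = Suc y mod k" if "x < k" "y < k" for x y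
  proof -
    have S: "Suc t mod k = (if t = k - 1 then 0 else Suc t)" if "t < k" for t
      using that by (auto simp: mod_Suc)
    consider "x = 0" "y = 0" | "x = 0" "y \<noteq> 0" | "x \<noteq> 0" "y = 0" | "x \<noteq> 0" "y \<noteq> 0" by blast
    then show ?thesis
    proof cases
      case 1
      then show ?thesis using k irrefl by (simp add: c_def)
    next
      case 2
      then show ?thesis using v_adj[of y] that k by (auto simp: c_def S)
    next
      case 3
      then show ?thesis using v_adj[of x] that k commute by (auto simp: c_def S)
    next
      case 4
      then have "(c x, c y) \<in> E \<longleftrightarrow> i + y - 1 = Suc (i + x - 1) \<or> i + x - 1 = Suc (i + y - 1)"
        using adj_f[OF range range] that by (simp add: c_def)
      also have "\<dots> \<longleftrightarrow> y = Suc x \<or> x = Suc y" using ij(1) 4 by auto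
      finally show ?thesis using that 4 by (auto simp: S)
    qed
  qed
  have c: "icyc c k" using inj adj by (auto simp: icyc_def)
  show ?thesis
  proof (cases "c ` {..<k} = UNIV")
    case False
    have "c 0 \<in> c ` {..<k}" using k by simp
    then obtain u x where "u \<notin> c ` {..<k}" "x \<in> c ` {..<k}" "(u, x) \<in> E"
      using adjacent_outside[OF _ False] by blast
    then show ?thesis using TNF_icyc_attached[OF c k] by auto
  next
    case True
    have "bij_betw (\<lambda>t. c (t - 1)) {1..k} UNIV"
    proof -
      have "bij_betw (\<lambda>t. t - 1) {1..k} {..<k}"
        by (rule bij_betw_byWitness[where f' = Suc]) auto
      moreover have "bij_betw c {..<k} UNIV" using inj True by (simp add: bij_betw_def)
      ultimately show ?thesis using bij_betw_trans by (force simp: comp_def)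
    qed
    moreover have "(c (x - 1), c (y - 1)) \<in> E \<longleftrightarrow> (x, y) \<in> (path_edges k \<union> {(k, 1)}) \<union> (path_edges k \<union> {(k, 1)})\<inverse>"
      if "x \<in> {1..k}" "y \<in> {1..k}" for x y
    proof -
      have xy: "x - 1 < k" "y - 1 < k" "Suc (x - 1) = x" "Suc (y - 1) = y" using that by auto
      have S: "t mod k = (if t = k then 0 else t)" if "t \<in> {1..k}" for t
        using that by auto
      have "(c (x - 1), c (y - 1)) \<in> E \<longleftrightarrow> y - 1 = (if x = k then 0 else x) \<or> x - 1 = (if y = k then 0 else y)"
        using adj[OF xy(1,2)] unfolding xy S[OF that(1)] S[OF that(2)] .
      also have "\<dots> \<longleftrightarrow> (x, y) \<in> (path_edges k \<union> {(k, 1)}) \<union> (path_edges k \<union> {(k, 1)})\<inverse>"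
        using that k by (auto simp: path_edges_iff)
      finally show ?thesis .
    qed
    ultimately have "is_model E {1..k} (path_edges k \<union> {(k, 1)})"
      unfolding is_model_def by blast
    then show ?thesis using in_familyI(2)[of k] k by simp
  qed
qed

lemma longest_ipath:
  "\<exists>f m. ipath f m \<and> 1 \<le> m \<and> (\<forall>f' m'. ipath f' m' \<longrightarrow> m' \<le> m)"
proof -
  let ?P = "\<lambda>m. \<exists>f. ipath f m"
  have "?P 1" by (rule exI[of _ "\<lambda>_. undefined"]) (simp add: ipath_def irrefl)
  moreover have bound: "m \<le> CARD('v)" if "?P m" for m
  proof -
    from that obtain f :: "nat \<Rightarrow> 'v" where "inj_on f {1..m}" by (auto simp: ipath_def)
    then have "card {1..m} \<le> card (UNIV :: 'v set)" by (intro card_inj_on_le) auto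
    then show ?thesis by simp
  qed
  ultimately have "?P (Greatest ?P)" "1 \<le> Greatest ?P" "\<And>m. ?P m \<Longrightarrow> m \<le> Greatest ?P"
    using GreatestI_nat[of ?P 1 "CARD('v)"] Greatest_le_nat[of ?P _ "CARD('v)"] by blast+
  then show ?thesis by blast
qed

text \<open>A gap between neighbours on the path closes an induced cycle. Four successive neighbours
  make \<open>v\<close> the centre of a star, three make a diamond, and a single neighbour at an end
  of the path would prolong it.\<close>

lemma attachment:
  assumes out: "\<not> TNF E" "\<not> in_family" and card: "5 \<le> CARD('v)"
    and f: "ipath f m" and max: "\<forall>f' m'. ipath f' m' \<longrightarrow> m' \<le> m"
    and v: "v \<notin> f ` {1..m}" "\<exists>i\<in>{1..m}. (v, f i) \<in> E"
  shows "\<exists>a b. (\<forall>i\<in>{1..m}. (v, f i) \<in> E \<longleftrightarrow> a \<le> i \<and> i \<le> b) \<and>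
    (1 < a \<and> b = a \<and> b < m \<or> 1 \<le> a \<and> b = Suc a \<and> b \<le> m)"
proof -
  have inj_f: "\<And>x y. x \<in> {1..m} \<Longrightarrow> y \<in> {1..m} \<Longrightarrow> f x = f y \<longleftrightarrow> x = y"
    and adj_f: "\<And>x y. x \<in> {1..m} \<Longrightarrow> y \<in> {1..m} \<Longrightarrow> (f x, f y) \<in> E \<longleftrightarrow> y = Suc x \<or> x = Suc y"
    using f by (auto simp: ipath_def inj_on_eq_iff)
  have nv: "v \<noteq> f i" if "i \<in> {1..m}" for i using v(1) that by auto
  define S where "S = {i \<in> {1..m}. (v, f i) \<in> E}"
  have S: "finite S" "S \<noteq> {}" "S \<subseteq> {1..m}" using v(2) by (auto simp: S_def)
  define a b where "a = Min S" and "b = Max S"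
  have ab: "a \<in> S" "b \<in> S" "\<And>i. i \<in> S \<Longrightarrow> a \<le> i \<and> i \<le> b"
    using S by (auto simp: a_def b_def)
  have full: "t \<in> S" if t: "a \<le> t" "t \<le> b" for t
  proof (rule ccontr)
    assume "t \<notin> S"
    \<comment> \<open>The neighbours of \<open>v\<close> nearest to the gap on both sides.\<close>
    define i j where "i = Max {s \<in> S. s < t}" and "j = Min {s \<in> S. t < s}"
    have ne: "{s \<in> S. s < t} \<noteq> {}" "{s \<in> S. t < s} \<noteq> {}"
      using ab(1,2) t \<open>t \<notin> S\<close> by (metis (mono_tags, lifting) empty_iff le_neq_implies_less mem_Collect_eq)+
    have "i \<in> {s \<in> S. s < t}"
      unfolding i_def by (rule Max_in[OF _ ne(1)]) (simp add: S(1))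
    moreover have "j \<in> {s \<in> S. t < s}"
      unfolding j_def by (rule Min_in[OF _ ne(2)]) (simp add: S(1))
    ultimately have ij: "i \<in> S" "j \<in> S" "i < t" "t < j" by auto
    have gap: "s \<notin> S" if "i < s" "s < j" for s
    proof
      assume "s \<in> S"
      then have "s < t \<or> t < s" using \<open>t \<notin> S\<close> by (metis nat_neq_iff)
      then show False
      proof
        assume "s < t"
        then have "s \<le> i" unfolding i_def using \<open>s \<in> S\<close> S by (intro Max_ge) auto
        then show False using that by simp
      next
        assume "t < s"
        then have "j \<le> s" unfolding j_def using \<open>s \<in> S\<close> S by (intro Min_le) auto
        then show False using that by simp
      qed
    qed
    have "TNF E \<or> in_family"
      by (rule chord_path[OF f v(1), of i j]) (use ij gap in \<open>auto simp: S_def\<close>)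
    then show False using out by simp
  qed
  have iff: "(v, f i) \<in> E \<longleftrightarrow> a \<le> i \<and> i \<le> b" if "i \<in> {1..m}" for i
  proof -
    have "i \<in> S \<longleftrightarrow> a \<le> i \<and> i \<le> b" using ab(3) full by blast
    then show ?thesis using that by (simp add: S_def)
  qed
  then have iff': "(f i, v) \<in> E \<longleftrightarrow> a \<le> i \<and> i \<le> b" if "i \<in> {1..m}" for i
    using that commute by blast
  have range: "1 \<le> a" "a \<le> b" "b \<le> m" using ab S by auto
  have "b < a + 3"
  proof (rule ccontr)
    assume *: "\<not> b < a + 3"
    have "TNF E"
      by (rule TNF_star[of "{v}" "f a" "f (a + 1)" "f (a + 2)" "f (a + 3)"])
        (use * range inj_f nv[of a] nv[of "a + 1"] nv[of "a + 2"] nv[of "a + 3"] iff' in auto)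
    then show False using out by simp
  qed
  moreover have "b \<noteq> a + 2"
  proof
    assume *: "b = a + 2"
    \<comment> \<open>A diamond whose nonadjacent vertices are \<open>f a\<close> and
      \<open>f (a + 2)\<close>. As there are at least five vertices, some vertex outside is adjacent
      to it.\<close>
    let ?X = "{f a, f (a + 2), f (a + 1), v}"
    have "card ?X \<le> 4" by (intro card_insert_le_m1) auto
    then have "?X \<noteq> UNIV" using card by auto
    then obtain u x where u: "u \<notin> ?X" "x \<in> ?X" "(u, x) \<in> E"
      by (rule adjacent_outside[rotated]) auto
    have "TNF E"
      by (rule TNF_diamond[of "f a" "f (a + 2)" "f (a + 1)" v u])
        (use * u range inj_f nv[of a] nv[of "a + 1"] nv[of "a + 2"] iff iff' adj_f in auto)
    then show False using out by simp
  qed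
  moreover have False if "a = b" "b = m"
  proof -
    have "ipath (f(Suc m := v)) (Suc m)"
      using that iff by (intro ipath_append[OF f v(1)]) auto
    then show False using max by fastforce
  qed
  moreover have False if "a = b" "a = 1"
  proof -
    have rev: "(\<lambda>i. f (m + 1 - i)) ` {1..m} = f ` {1..m}"
    proof -
      have "(\<lambda>i. m + 1 - i) ` {1..m} = {1..m}"
      proof (intro equalityI subsetI)
        fix x assume "x \<in> {1..m}"
        then show "x \<in> (\<lambda>i. m + 1 - i) ` {1..m}"
          by (intro image_eqI[of _ _ "m + 1 - x"]) auto
      qed auto
      then show ?thesis by (metis image_image)
    qed
    have "ipath ((\<lambda>i. f (m + 1 - i))(Suc m := v)) (Suc m)"
    proof (rule ipath_append[OF ipath_reverse[OF f]])
      show "v \<notin> (\<lambda>i. f (m + 1 - i)) ` {1..m}" unfolding rev by (rule v(1))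
      fix i assume i: "i \<in> {1..m}"
      then have "m + 1 - i \<in> {1..m}" by auto
      from iff[OF this] show "(v, f (m + 1 - i)) \<in> E \<longleftrightarrow> i = m" using that i by auto
    qed
    then show False using max by fastforce
  qed
  ultimately have "1 < a \<and> b = a \<and> b < m \<or> 1 \<le> a \<and> b = Suc a \<and> b \<le> m"
    using range by force
  then show ?thesis using iff by blast
qed

text \<open>If an inner segment of the path meets the neighbourhoods of both \<open>u\<close> and
  \<open>v\<close>, these two and the path vertices just before and after the segment are four
  neighbours of a connected set. The attachment intervals always allow such a segment, except when
  the path is a single edge seen by both.\<close>

lemma two_attachments:
  assumes f: "ipath f m" and max: "\<forall>f' m'. ipath f' m' \<longrightarrow> m' \<le> m" and card: "5 \<le> CARD('v)"
    and out: "\<not> TNF E" "\<not> in_family"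
    and u: "u \<notin> f ` {1..m}" and v: "v \<notin> f ` {1..m}" and "u \<noteq> v"
    and v_adj: "\<And>i. i \<in> {1..m} \<Longrightarrow> (v, f i) \<in> E \<longleftrightarrow> a \<le> i \<and> i \<le> b"
    and u_adj: "\<And>i. i \<in> {1..m} \<Longrightarrow> (u, f i) \<in> E \<longleftrightarrow> a' \<le> i \<and> i \<le> b'"
    and ab: "1 < a \<and> b = a \<and> b < m \<or> 1 \<le> a \<and> b = Suc a \<and> b \<le> m"
    and ab': "1 < a' \<and> b' = a' \<and> b' < m \<or> 1 \<le> a' \<and> b' = Suc a' \<and> b' \<le> m"
    and "a \<le> a'"
  shows False
proof -
  have inj_f: "\<And>x y. x \<in> {1..m} \<Longrightarrow> y \<in> {1..m} \<Longrightarrow> f x = f y \<longleftrightarrow> x = y"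
    and adj_f: "\<And>x y. x \<in> {1..m} \<Longrightarrow> y \<in> {1..m} \<Longrightarrow> (f x, f y) \<in> E \<longleftrightarrow> y = Suc x \<or> x = Suc y"
    using f by (auto simp: ipath_def inj_on_eq_iff)
  have nu: "u \<noteq> f i" and nv: "v \<noteq> f i" if "i \<in> {1..m}" for i using u v that by auto
  have seg: False if "1 < s" "s \<le> t" "t < m" "\<exists>i\<in>{s..t}. (v, f i) \<in> E" "\<exists>i\<in>{s..t}. (u, f i) \<in> E" for s t
  proof -
    have notin: "f x \<notin> f ` {s..t}" if "x \<in> {1..m}" "x \<notin> {s..t}" for x
    proof
      assume "f x \<in> f ` {s..t}"
      then obtain y where "y \<in> {s..t}" "f x = f y" by auto
      then show False using inj_f[of x y] that \<open>1 < s\<close> \<open>t < m\<close> by auto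
    qed
    have "TNF E"
    proof (rule TNF_star[of "f ` {s..t}" u v "f (s - 1)" "f (t + 1)"])
      show "conn E (f ` {s..t})"
        using that by (intro conn_segment) (auto simp: adj_f)
      show "u \<notin> f ` {s..t}" "v \<notin> f ` {s..t}"
        using u v that by auto
      show "f (s - 1) \<notin> f ` {s..t}" "f (t + 1) \<notin> f ` {s..t}"
        by (rule notin; use that(1-3) in auto)+
      show "\<exists>c\<in>f ` {s..t}. (f (s - 1), c) \<in> E"
      proof -
        have "s - 1 \<in> {1..m}" "s \<in> {1..m}" "s = Suc (s - 1)" using that(1-3) by auto
        then have "(f (s - 1), f s) \<in> E" using adj_f by blast
        then show ?thesis using that(2) by (intro bexI[of _ "f s"]) auto
      qed
      show "\<exists>c\<in>f ` {s..t}. (f (t + 1), c) \<in> E"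
      proof -
        have "t + 1 \<in> {1..m}" "t \<in> {1..m}" using that(1-3) by auto
        then have "(f (t + 1), f t) \<in> E" using adj_f by auto
        then show ?thesis using that(2) by (intro bexI[of _ "f t"]) auto
      qed
      have mem: "s - 1 \<in> {1..m}" "t + 1 \<in> {1..m}" using that(1-3) by auto
      have "f (s - 1) \<noteq> f (t + 1)" using inj_f[OF mem] that(2) by simp
      then show "distinct [u, v, f (s - 1), f (t + 1)]"
        using mem[THEN nu] mem[THEN nv] \<open>u \<noteq> v\<close> by simp
    qed (use that(4,5) in auto)
    then show False using out by simp
  qed
  show False
  proof (cases "b \<le> a'")
    case True
    then show False
      by (intro seg[of b a']) (use ab ab' v_adj u_adj in \<open>auto intro: bexI[of _ b] bexI[of _ a']\<close>)
  next
    case False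
    then have b: "b = Suc a" "a' = a" "1 \<le> a" "b \<le> m" using ab \<open>a \<le> a'\<close> by auto
    consider "1 < a" | "a = 1" "b' = Suc a" "b < m" | "a = 1" "b' = Suc a" "m = 2" using ab' b by fastforce
    then show False
    proof cases
      case 1
      then show False
        by (intro seg[of a a]) (use b ab' v_adj u_adj in auto)
    next
      case 2
      then show False
        by (intro seg[of b b]) (use b ab' v_adj u_adj in auto)
    next
      case 3
      have P: "f ` {1..m} = {f 1, f 2}" using 3 by (auto simp: numeral_2_eq_2 atLeastAtMostSuc_conv)
      have adj: "(v, f 1) \<in> E" "(v, f 2) \<in> E" "(u, f 1) \<in> E" "(u, f 2) \<in> E" "(f 1, f 2) \<in> E"
        using 3 b v_adj u_adj adj_f by auto
      \<comment> \<open>For \<open>m = 2\<close> no three vertices induce a path, so adjacency is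
        transitive on distinct vertices. The four vertices and a fifth one adjacent to them then
        form a star around \<open>f 1\<close>.\<close>
      have path3: False if "(x, y) \<in> E" "(y, z) \<in> E" "(x, z) \<notin> E" "x \<noteq> z" for x y z
      proof -
        have xyz: "x \<noteq> y" "y \<noteq> z" using that irrefl by auto
        let ?g = "\<lambda>i. if i = 1 then x else if i = 2 then y else z :: 'v"
        have "{1..3::nat} = {1, 2, 3}" by auto
        then have "ipath ?g 3"
          unfolding ipath_def using that xyz irrefl commute by (auto simp: inj_on_def)
        then show False using max[rule_format, of ?g 3] 3 by simp
      qed
      have uv: "(u, v) \<in> E"
        using path3[of u "f 1" v] adj commute \<open>u \<noteq> v\<close> by blast
      let ?X = "{f 1, f 2, u, v}"
      have "card ?X \<le> 4" by (intro card_insert_le_m1) auto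
      then have "?X \<noteq> UNIV" using card by auto
      then obtain w x where w: "w \<notin> ?X" "x \<in> ?X" "(w, x) \<in> E"
        by (rule adjacent_outside[rotated]) auto
      have "(w, f 1) \<in> E"
        using path3[of w x "f 1"] w adj uv commute by blast
      then have "TNF E"
        using w adj commute nu[of 1] nu[of 2] nv[of 1] nv[of 2] inj_f[of 1 2] 3 \<open>u \<noteq> v\<close>
        by (intro TNF_star[of "{f 1}" "f 2" u v w]) auto
      then show False using out by simp
    qed
  qed
qed

text \<open>At most one vertex \<open>v\<close> outside is adjacent to the path. If the path and
  \<open>v\<close> exhaust the graph, the two kinds of attachment are the two families with an extra
  vertex. If not, a vertex \<open>u\<close> sees \<open>v\<close> but not the path, and maximality
  keeps the attachment far enough from both ends for a spider or a net.\<close>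

theorem TNF_or_in_family:
  assumes card: "5 \<le> CARD('v)"
  shows "TNF E \<or> in_family"
proof (rule ccontr)
  assume "\<not> (TNF E \<or> in_family)"
  then have out: "\<not> TNF E" "\<not> in_family" by auto
  obtain f m where f: "ipath f m" "1 \<le> m" and max: "\<forall>f' m'. ipath f' m' \<longrightarrow> m' \<le> m"
    using longest_ipath by blast
  have inj_f: "\<And>x y. x \<in> {1..m} \<Longrightarrow> y \<in> {1..m} \<Longrightarrow> f x = f y \<longleftrightarrow> x = y" "inj_on f {1..m}"
    and adj_f: "\<And>x y. x \<in> {1..m} \<Longrightarrow> y \<in> {1..m} \<Longrightarrow> (f x, f y) \<in> E \<longleftrightarrow> y = Suc x \<or> x = Suc y"
    using f by (auto simp: ipath_def inj_on_eq_iff)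
  let ?P = "f ` {1..m}"
  have "?P \<noteq> UNIV"
  proof
    assume "?P = UNIV"
    then have "is_model E {1..m} (path_edges m)"
      unfolding is_model_def using inj_f(2) adj_f
      by (intro exI[of _ f]) (auto simp: bij_betw_def path_edges_iff)
    then show False using in_familyI(1) out(2) f(2) by blast
  qed
  then obtain v x where vx: "v \<notin> ?P" "x \<in> ?P" "(v, x) \<in> E"
    using adjacent_outside[of ?P] f(2) by (metis atLeastatMost_empty_iff2 image_is_empty not_less)
  have att: "\<exists>a b. (\<forall>i\<in>{1..m}. (u, f i) \<in> E \<longleftrightarrow> a \<le> i \<and> i \<le> b) \<and>
      (1 < a \<and> b = a \<and> b < m \<or> 1 \<le> a \<and> b = Suc a \<and> b \<le> m)" if "u \<notin> ?P" "x \<in> ?P" "(u, x) \<in> E" for u x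
    using attachment[OF out card f(1) max that(1)] that by blast
  obtain a b where v_adj: "\<And>i. i \<in> {1..m} \<Longrightarrow> (v, f i) \<in> E \<longleftrightarrow> a \<le> i \<and> i \<le> b"
    and ab: "1 < a \<and> b = a \<and> b < m \<or> 1 \<le> a \<and> b = Suc a \<and> b \<le> m"
    using att[OF vx] by blast
  have only: "(u, x) \<notin> E" if u: "u \<notin> ?P" "u \<noteq> v" "x \<in> ?P" for u x
  proof
    assume "(u, x) \<in> E"
    then obtain a' b' where u_adj: "\<And>i. i \<in> {1..m} \<Longrightarrow> (u, f i) \<in> E \<longleftrightarrow> a' \<le> i \<and> i \<le> b'"
      and ab': "1 < a' \<and> b' = a' \<and> b' < m \<or> 1 \<le> a' \<and> b' = Suc a' \<and> b' \<le> m"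
      using att[OF u(1,3)] by blast
    show False
      using two_attachments[OF f(1) max card out u(1) vx(1) u(2) v_adj u_adj ab ab']
        two_attachments[OF f(1) max card out vx(1) u(1) u(2)[symmetric] u_adj v_adj ab' ab] by linarith
  qed
  show False
  proof (cases "insert v ?P = UNIV")
    case True
    let ?f = "f(m + 1 := v)"
    have im: "?f ` {1..m} = ?P" by (rule image_cong) auto
    have set: "{1..m + 1} = insert (m + 1) {1..m}" by auto
    have "inj_on ?f {1..m}" using inj_f(2) vx(1) by (rule inj_on_fun_updI)
    then have bij: "bij_betw ?f {1..m + 1} UNIV"
      unfolding bij_betw_def set inj_on_insert image_insert im
      using vx(1) True im by (auto simp: image_iff)
    have adj: "(?f i, ?f j) \<in> E \<longleftrightarrow> (i, j) \<in> (path_edges m \<union> R) \<union> (path_edges m \<union> R)\<inverse>"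
      if ij: "i \<in> {1..m + 1}" "j \<in> {1..m + 1}" and R: "R = {a..b} \<times> {m + 1}" for i j R
    proof -
      consider "i \<in> {1..m}" "j \<in> {1..m}" | "i = m + 1" "j \<in> {1..m}" | "i \<in> {1..m}" "j = m + 1" | "i = m + 1" "j = m + 1"
        using ij by (cases "i = m + 1"; cases "j = m + 1") auto
      then show ?thesis
      proof cases
        case 1
        then show ?thesis using adj_f R by (auto simp: path_edges_iff)
      next
        case 2
        then show ?thesis using v_adj R by (auto simp: path_edges_iff)
      next
        case 3
        then show ?thesis using v_adj R commute by (auto simp: path_edges_iff)
      next
        case 4
        then show ?thesis using irrefl ab R by (auto simp: path_edges_iff)
      qed
    qed
    have model: "is_model E {1..m + 1} (path_edges m \<union> {a..b} \<times> {m + 1})"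
      unfolding is_model_def using bij adj by blast
    from ab show False
    proof (elim disjE conjE)
      assume *: "1 < a" "b = a" "b < m"
      then have set: "{a..b} \<times> {m + 1} = {(a, m + 1)}" by auto
      show False using in_familyI(3)[OF _ _ model[unfolded set]] * out(2) by simp
    next
      assume *: "1 \<le> a" "b = Suc a" "b \<le> m"
      then have set: "{a..b} \<times> {m + 1} = {(a, m + 1), (a + 1, m + 1)}" by (auto simp: le_Suc_eq)
      show False using in_familyI(4)[OF _ _ model[unfolded set]] * out(2) by simp
    qed
  next
    case False
    then obtain u x where u: "u \<notin> insert v ?P" "x \<in> insert v ?P" "(u, x) \<in> E"
      by (rule adjacent_outside[rotated]) auto
    then have uv: "(u, v) \<in> E" using only[of u x] by auto
    have u_no: "(u, f i) \<notin> E" if "i \<in> {1..m}" for i using only[of u "f i"] u that by auto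
    have v_adj': "(f i, v) \<in> E \<longleftrightarrow> a \<le> i \<and> i \<le> b" and u_no': "(f i, u) \<notin> E" if "i \<in> {1..m}" for i
      using v_adj u_no that commute by blast+
    have uv': "(v, u) \<in> E" using uv commute by blast
    have nu: "u \<noteq> f i" and nv: "v \<noteq> f i" if "i \<in> {1..m}" for i using u vx(1) that by auto
    \<comment> \<open>Replacing the end \<open>g m\<close> by \<open>v\<close> and \<open>u\<close>
      would give an induced path with \<open>m + 1\<close> vertices.\<close>
    have longer: False if g: "ipath g m" "g ` {1..m} = ?P" "1 < m" and "(v, g (m - 1)) \<in> E"
      and "\<And>i. i \<in> {1..m - 2} \<Longrightarrow> (v, g i) \<notin> E" for g
    proof -
      have "ipath g (m - 1)" using g(1) by (rule ipath_prefix) simp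
      then have 1: "ipath (g(Suc (m - 1) := v)) (Suc (m - 1))"
      proof (rule ipath_append)
        show "v \<notin> g ` {1..m - 1}" using vx(1) g(2) by (metis (no_types, lifting) atLeastatMost_subset_iff diff_le_self image_mono le_refl subsetD)
        show "(v, g i) \<in> E \<longleftrightarrow> i = m - 1" if "i \<in> {1..m - 1}" for i
          using that \<open>(v, g (m - 1)) \<in> E\<close> \<open>\<And>i. i \<in> {1..m - 2} \<Longrightarrow> (v, g i) \<notin> E\<close>[of i] by force
      qed
      have "Suc (m - 1) = m" using g(3) by simp
      with 1 have 2: "ipath (g(m := v)) m" by simp
      have "ipath ((g(m := v))(Suc m := u)) (Suc m)"
      proof (rule ipath_append[OF 2])
        have gP: "g i \<in> ?P" if "i \<in> {1..m}" for i using that g(2) by blast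
        show "u \<notin> (g(m := v)) ` {1..m}" using u(1) gP by auto
        show "(u, (g(m := v)) i) \<in> E \<longleftrightarrow> i = m" if "i \<in> {1..m}" for i
          using that uv only[of u "g i"] u(1) gP[of i] by auto
      qed
      then show False using max by fastforce
    qed
    have rev: "(\<lambda>i. f (m + 1 - i)) ` {1..m} = f ` {1..m}"
    proof -
      have "(\<lambda>i. m + 1 - i) ` {1..m} = {1..m}"
      proof (intro equalityI subsetI)
        fix x assume "x \<in> {1..m}"
        then show "x \<in> (\<lambda>i. m + 1 - i) ` {1..m}"
          by (intro image_eqI[of _ _ "m + 1 - x"]) auto
      qed auto
      then show ?thesis by (metis image_image)
    qed
    have right: False if "a = m - 1"
      by (rule longer[of f]) (use f(1) ab that v_adj in auto)
    have left: False if "b = 2"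
    proof (rule longer[OF ipath_reverse[OF f(1)] rev])
      show "1 < m" using ab that by auto
      then show "(v, f (m + 1 - (m - 1))) \<in> E" using v_adj[of 2] ab that by auto
      fix i assume i: "i \<in> {1..m - 2}"
      then have "m + 1 - i \<in> {1..m}" by auto
      from v_adj[OF this] show "(v, f (m + 1 - i)) \<notin> E" using that i by auto
    qed
    have "u \<noteq> v" using u(1) by blast
    define N where "N = {1..m}"
    have N_simps: "\<And>x y. x \<in> N \<Longrightarrow> y \<in> N \<Longrightarrow> f x = f y \<longleftrightarrow> x = y"
      "\<And>x y. x \<in> N \<Longrightarrow> y \<in> N \<Longrightarrow> (f x, f y) \<in> E \<longleftrightarrow> y = Suc x \<or> x = Suc y"
      "\<And>i. i \<in> N \<Longrightarrow> (v, f i) \<in> E \<longleftrightarrow> a \<le> i \<and> i \<le> b" "\<And>i. i \<in> N \<Longrightarrow> (f i, v) \<in> E \<longleftrightarrow> a \<le> i \<and> i \<le> b"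
      "\<And>i. i \<in> N \<Longrightarrow> (u, f i) \<notin> E" "\<And>i. i \<in> N \<Longrightarrow> (f i, u) \<notin> E"
      "\<And>i. i \<in> N \<Longrightarrow> u \<noteq> f i" "\<And>i. i \<in> N \<Longrightarrow> v \<noteq> f i" "\<And>i. i \<in> N \<Longrightarrow> f i \<noteq> u" "\<And>i. i \<in> N \<Longrightarrow> f i \<noteq> v"
      "(u, v) \<in> E" "(v, u) \<in> E" "u \<noteq> v" "v \<noteq> u"
      unfolding N_def using inj_f(1) adj_f v_adj v_adj' u_no u_no' nu nv uv uv' \<open>u \<noteq> v\<close> by metis+
    from ab show False
    proof (elim disjE conjE)
      assume *: "1 < a" "b = a" "b < m"
      \<comment> \<open>Two path vertices remain on either side of \<open>f a\<close>; with
        \<open>v\<close> and \<open>u\<close> they are the three legs of a spider.\<close>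
      then have **: "3 \<le> a" "a + 2 \<le> m" using left right by force+
      have mem: "a \<in> N" "a - Suc 0 \<in> N" "a - 2 \<in> N" "Suc a \<in> N" "Suc (Suc a) \<in> N"
        using ** by (auto simp: N_def)
      have "TNF E"
        by (rule TNF_spider[OF sym, of "f a" "f (a - 1)" "f (a - 2)" "f (a + 1)" "f (a + 2)" v u])
          (use ** \<open>b = a\<close> in \<open>auto simp: mem N_simps\<close>)
      then show False using out by simp
    next
      assume *: "1 \<le> a" "b = Suc a" "b \<le> m"
      \<comment> \<open>The triangle is \<open>v\<close>, \<open>f a\<close>,
        \<open>f (a + 1)\<close>; maximality leaves room for the pendants \<open>f (a - 1)\<close>
        and \<open>f (a + 2)\<close> beside \<open>u\<close>.\<close>
      then have **: "2 \<le> a" "a + 2 \<le> m" using left right by force+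
      have mem: "a \<in> N" "a - Suc 0 \<in> N" "Suc a \<in> N" "Suc (Suc a) \<in> N"
        using ** by (auto simp: N_def)
      have "TNF E"
        by (rule TNF_net[OF sym, of v "f a" "f (a + 1)" u "f (a - 1)" "f (a + 2)"])
          (use ** \<open>b = Suc a\<close> in \<open>auto simp: mem N_simps\<close>)
      then show False using out by simp
    qed
  qed
qed

end

section \<open>Finite differences and interpolation\<close>

text \<open>A bound through coefficients: the zero polynomial satisfies it for every
  \<open>n\<close>, including 0, so no case distinction is needed for sums.\<close>

definition deg_lt :: "nat \<Rightarrow> 'a::zero poly \<Rightarrow> bool" where
  "deg_lt n F \<longleftrightarrow> (\<forall>k\<ge>n. coeff F k = 0)"

lemma deg_lt_iff: "deg_lt n F \<longleftrightarrow> F = 0 \<or> degree F < n"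
  by (metis coeff_0 coeff_eq_0 deg_lt_def leading_coeff_0_iff not_less order_less_le_trans)

lemma deg_lt_0 [simp]: "deg_lt n 0" "deg_lt 0 F \<longleftrightarrow> F = 0"
  by (auto simp: deg_lt_iff)

lemma deg_lt_mono: "deg_lt n F \<Longrightarrow> n \<le> m \<Longrightarrow> deg_lt m F"
  by (auto simp: deg_lt_def)

lemma deg_lt_add: "deg_lt n F \<Longrightarrow> deg_lt n G \<Longrightarrow> deg_lt n (F + G)"
  and deg_lt_diff: "deg_lt n F' \<Longrightarrow> deg_lt n G' \<Longrightarrow> deg_lt n (F' - G')"
  and deg_lt_smult: "deg_lt n H \<Longrightarrow> deg_lt n (smult c H)"
  for F G :: "'a::comm_monoid_add poly" and F' G' :: "'b::ab_group_add poly" and H :: "'c::comm_semiring_0 poly"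
  by (auto simp: deg_lt_def)

lemma deg_lt_sum: "(\<And>s. s \<in> S \<Longrightarrow> deg_lt n (f s)) \<Longrightarrow> deg_lt n (\<Sum>s\<in>S. f s)"
  by (auto simp: deg_lt_def coeff_sum)

lemma deg_lt_mult:
  fixes F G :: "'a::idom poly"
  assumes "deg_lt (Suc m) F" "deg_lt n G"
  shows "deg_lt (m + n) (F * G)"
  using assms by (cases "F = 0"; cases "G = 0") (auto simp: deg_lt_iff degree_mult_eq)

lemma deg_lt_SucD: "deg_lt (Suc n) F \<Longrightarrow> coeff F n = 0 \<Longrightarrow> deg_lt n F"
  unfolding deg_lt_def by (metis Suc_leI le_neq_implies_less)

lemma deg_lt_monom: "k < n \<Longrightarrow> deg_lt n (monom c k)"
  by (auto simp: deg_lt_def)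

lemma poly_eq_sum_monom:
  assumes "deg_lt n F"
  shows "F = (\<Sum>s<n. monom (coeff F s) s)"
proof (rule poly_eqI)
  fix k
  have "coeff (\<Sum>s<n. monom (coeff F s) s) k = (\<Sum>s<n. if s = k then coeff F s else 0)"
    by (simp add: coeff_sum)
  then show "coeff F k = coeff (\<Sum>s<n. monom (coeff F s) s) k"
    using assms by (auto simp: deg_lt_def)
qed

lemma coeff_sum_lessThan_monom: "s < n \<Longrightarrow> coeff (\<Sum>s<n. monom (c s) s) s = c s"
  by (simp add: coeff_sum)

lemma sum_lessThan_add: "(\<Sum>s<m + n. f s) = (\<Sum>s<m. f s) + (\<Sum>s<n. f (m + s))" for f :: "nat \<Rightarrow> 'a::comm_monoid_add"
  by (induction n) (simp_all add: add.assoc)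

lemma diff_dvd_poly_diff: "x - z dvd poly F x - poly F z" for x z :: "'a::comm_ring_1"
proof (induction F)
  case (pCons a F)
  have "poly (pCons a F) x - poly (pCons a F) z = (x - z) * poly F x + z * (poly F x - poly F z)"
    by (simp add: algebra_simps)
  then show ?case using pCons by simp
qed simp

definition roots_poly :: "('i \<Rightarrow> 'a::idom) \<Rightarrow> 'i set \<Rightarrow> 'a poly" where
  "roots_poly q J = (\<Prod>j\<in>J. [:- q j, 1:])"

lemma poly_roots_poly: "poly (roots_poly q J) x = (\<Prod>j\<in>J. x - q j)"
  by (simp add: roots_poly_def poly_prod)

lemma roots_poly_monic: "degree (roots_poly q J) = card J" "lead_coeff (roots_poly q J) = 1" "roots_poly q J \<noteq> 0"
proof -
  show "lead_coeff (roots_poly q J) = 1"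
    by (simp add: roots_poly_def lead_coeff_prod)
  then show "roots_poly q J \<noteq> 0" by auto
  show "degree (roots_poly q J) = card J"
    by (simp add: roots_poly_def degree_prod_eq_sum_degree)
qed

lemma deg_lt_roots_poly: "deg_lt (Suc (card J)) (roots_poly q J)"
  by (simp add: deg_lt_iff roots_poly_monic)

lemma roots_poly_insert: "finite J \<Longrightarrow> j \<notin> J \<Longrightarrow> roots_poly q (insert j J) = [:- q j, 1:] * roots_poly q J"
  by (simp add: roots_poly_def)

lemma roots_poly_dvd:
  assumes "finite J" "inj_on q J" "\<And>j. j \<in> J \<Longrightarrow> poly F (q j) = 0"
  shows "\<exists>D. F = roots_poly q J * D"
  using assms
proof (induction J arbitrary: F)
  case empty
  then show ?case by (simp add: roots_poly_def)
next
  case (insert j J)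
  then obtain F' where F': "F = [:- q j, 1:] * F'"
    using poly_eq_0_iff_dvd[of F "q j"] by auto
  have "poly F' (q i) = 0" if "i \<in> J" for i
  proof -
    have "(q i - q j) * poly F' (q i) = 0"
      using insert.prems(2)[of i] that by (auto simp: F')
    moreover have "q i \<noteq> q j" using insert that by (auto simp: inj_on_def)
    ultimately show ?thesis by simp
  qed
  then obtain D where "F' = roots_poly q J * D" using insert by auto
  then have "F = roots_poly q (insert j J) * D"
    unfolding F' roots_poly_insert[OF insert.hyps] by (simp only: mult.assoc)
  then show ?case by (rule exI)
qed

lemma roots_poly_quotient_deg:
  assumes "deg_lt (card J + n) (roots_poly q J * D)"
  shows "deg_lt n D"
  using assms roots_poly_monic[of q J] by (cases "D = 0") (auto simp: deg_lt_iff degree_mult_eq)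

lemma deg_lt_roots_eq_0:
  fixes q :: "'i \<Rightarrow> 'a::idom"
  assumes "finite J" "inj_on q J" "\<And>j. j \<in> J \<Longrightarrow> poly F (q j) = 0" "deg_lt (card J) F"
  shows "F = 0"
proof -
  obtain D where D: "F = roots_poly q J * D" using roots_poly_dvd assms by blast
  then have "deg_lt 0 D" using roots_poly_quotient_deg[of J 0 q D] assms(4) by simp
  then show ?thesis using D by simp
qed

lemma dvd_of_dvd_prod_mult:
  fixes \<alpha> :: "'a::comm_ring_1"
  assumes "\<alpha> dvd (\<Prod>j\<in>J. \<beta> j) * h" "\<And>j f. j \<in> J \<Longrightarrow> \<alpha> dvd \<beta> j * f \<Longrightarrow> \<alpha> dvd f"
  shows "\<alpha> dvd h"
  using assms by (induction J rule: infinite_finite_induct) (auto simp: mult.assoc)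

text \<open>Pairwise cancellation of the given factors takes the place of unique
  factorization.\<close>

lemma prod_dvd_of_coprime:
  fixes \<beta> :: "'i \<Rightarrow> 'a::comm_ring_1"
  assumes "finite J" "\<And>j. j \<in> J \<Longrightarrow> \<beta> j dvd g"
    and "\<And>i j f. i \<in> J \<Longrightarrow> j \<in> J \<Longrightarrow> i \<noteq> j \<Longrightarrow> \<beta> i dvd \<beta> j * f \<Longrightarrow> \<beta> i dvd f"
  shows "(\<Prod>j\<in>J. \<beta> j) dvd g"
  using assms
proof (induction J)
  case (insert j J)
  then obtain h where h: "g = (\<Prod>j\<in>J. \<beta> j) * h" by (metis dvdE insertCI)
  have "\<beta> j dvd h"
  proof (rule dvd_of_dvd_prod_mult)
    show "\<beta> j dvd (\<Prod>j\<in>J. \<beta> j) * h" using insert.prems(1)[of j] h by simp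
    show "\<beta> j dvd f" if "i \<in> J" "\<beta> j dvd \<beta> i * f" for i f
      using insert.prems(2)[of j i f] insert.hyps that by auto
  qed
  then show ?case using insert.hyps h by (auto simp: mult_dvd_mono ac_simps)
qed simp

section \<open>Differences with step \<open>w\<close> and their quotients\<close>

definition shift_diff :: "'a::comm_ring_1 \<Rightarrow> 'a poly \<Rightarrow> 'a poly" where
  "shift_diff w F = pcompose F [:w, 1:] - F"

lemma shift_diff_simps:
  "shift_diff w (F + G) = shift_diff w F + shift_diff w G"
  "shift_diff w (F - G) = shift_diff w F - shift_diff w G"
  "shift_diff w (smult c F) = smult c (shift_diff w F)"
  by (simp_all add: shift_diff_def pcompose_add pcompose_diff pcompose_smult smult_diff_right)

lemma shift_diff_sum: "shift_diff w (\<Sum>s\<in>S. f s) = (\<Sum>s\<in>S. shift_diff w (f s))"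
  by (induction S rule: infinite_finite_induct) (simp_all add: shift_diff_simps(1), simp_all add: shift_diff_def)

lemma poly_shift_diff: "poly (shift_diff w F) x = poly F (x + w) - poly F x"
  by (simp add: shift_diff_def poly_pcompose add.commute)

text \<open>Induction on the coefficients: for \<open>a + t F(t)\<close> the quotient is
  \<open>F(t + w) + t Q(t)\<close>, and \<open>F(t + w) = F(t) + w Q(t)\<close>. The formula for the
  top coefficient is that of a derivative.\<close>

lemma shift_diff_quotient:
  fixes F :: "'a::comm_ring_1 poly"
  shows "\<exists>Q. shift_diff w F = smult w Q \<and> (\<forall>n. deg_lt (Suc n) F \<longrightarrow> deg_lt n Q) \<and>
    (\<forall>n. deg_lt (Suc (Suc n)) F \<longrightarrow> coeff Q n = of_nat (Suc n) * coeff F (Suc n))"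
proof (induction F)
  case 0
  then show ?case by (auto simp: shift_diff_def intro!: exI[of _ 0])
next
  case (pCons a F)
  then obtain Q where Q: "shift_diff w F = smult w Q" "\<And>n. deg_lt (Suc n) F \<Longrightarrow> deg_lt n Q"
    "\<And>n. deg_lt (Suc (Suc n)) F \<Longrightarrow> coeff Q n = of_nat (Suc n) * coeff F (Suc n)" by blast
  have F: "deg_lt n F" if "deg_lt (Suc n) (pCons a F)" for n
    unfolding deg_lt_def
  proof (intro allI impI)
    fix k assume "n \<le> k"
    then have "coeff (pCons a F) (Suc k) = 0" using that unfolding deg_lt_def by (metis Suc_le_mono)
    then show "coeff F k = 0" by simp
  qed
  show ?case
  proof (intro exI[of _ "F + smult w Q + pCons 0 Q"] conjI allI impI)
    have "pcompose F [:w, 1:] = F + smult w Q" using Q(1) by (simp add: shift_diff_def algebra_simps)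
    then show "shift_diff w (pCons a F) = smult w (F + smult w Q + pCons 0 Q)"
      by (simp add: shift_diff_def pcompose_pCons smult_add_right)
  next
    fix n assume "deg_lt (Suc n) (pCons a F)"
    then have n: "deg_lt n F" by (rule F)
    show "deg_lt n (F + smult w Q + pCons 0 Q)"
    proof (cases n)
      case 0
      then have "F = 0" using n by simp
      then have "Q = 0" using Q(2)[of 0] by simp
      then show ?thesis using \<open>F = 0\<close> by simp
    next
      case (Suc n')
      then have "deg_lt n' Q" using n Q(2) by blast
      then show ?thesis
        using n Suc unfolding deg_lt_def by (auto simp: coeff_pCons split: nat.split)
    qed
  next
    fix n assume "deg_lt (Suc (Suc n)) (pCons a F)"
    then have n: "deg_lt (Suc n) F" by (rule F)
    then have "coeff Q n = 0" using Q(2)[OF n] by (simp add: deg_lt_def)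
    moreover have "coeff (pCons 0 Q) n = of_nat n * coeff F n"
      using Q(3) n by (cases n) simp_all
    ultimately show "coeff (F + smult w Q + pCons 0 Q) n = of_nat (Suc n) * coeff (pCons a F) (Suc n)"
      by (simp add: algebra_simps)
  qed
qed

text \<open>\<open>scal n\<close> is the inverse of \<open>n\<close>. It undoes the integer factor
  that a difference quotient puts in front of the leading coefficient.\<close>

locale rational_domain =
  fixes scal :: "nat \<Rightarrow> 'a::idom"
  assumes scal: "0 < n \<Longrightarrow> of_nat n * scal n = 1"
begin

lemma of_nat_neq_0: "0 < n \<Longrightarrow> (of_nat n :: 'a) \<noteq> 0"
  using scal[of n] by auto

lemma shift_diff_eq_0:
  assumes "shift_diff w F = 0" "w \<noteq> (0 :: 'a)"
  shows "\<exists>c. F = [:c:]"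
proof -
  obtain Q where Q: "shift_diff w F = smult w Q"
    "\<And>n. deg_lt (Suc (Suc n)) F \<Longrightarrow> coeff Q n = of_nat (Suc n) * coeff F (Suc n)"
    using shift_diff_quotient[of w F] by blast
  have "degree F = 0"
  proof (rule ccontr)
    assume "degree F \<noteq> 0"
    then obtain n where n: "degree F = Suc n" by (cases "degree F") auto
    then have "coeff Q n = of_nat (Suc n) * coeff F (Suc n)" using Q(2)[of n] by (simp add: deg_lt_iff)
    moreover have "Q = 0" using Q(1) assms by simp
    moreover have "coeff F (Suc n) \<noteq> 0" using n by (metis leading_coeff_0_iff degree_0 nat.distinct(1))
    ultimately show False using of_nat_neq_0[of "Suc n"] by simp
  qed
  then have "F = [:coeff F 0:]" by (simp add: degree_0_id)
  then show ?thesis by (rule exI[of _ "coeff F 0"])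
qed

text \<open>Discrete integration: a monomial divided by its degree cancels the leading coefficient
  of \<open>Q\<close>, and induction treats the rest.\<close>

lemma shift_diff_surj:
  assumes "deg_lt n Q"
  shows "\<exists>F. shift_diff w F = smult (w :: 'a) Q \<and> deg_lt (Suc n) F"
  using assms
proof (induction n arbitrary: Q)
  case 0
    then show ?case by (auto simp: shift_diff_def intro!: exI[of _ 0])
  next
    case (Suc n)
    let ?F0 = "monom (coeff Q n * scal (Suc n)) (Suc n)"
    have F0: "deg_lt (Suc (Suc n)) ?F0" by (simp add: deg_lt_monom)
    obtain Q0 where Q0: "shift_diff w ?F0 = smult w Q0" "deg_lt (Suc n) Q0"
      "coeff Q0 n = of_nat (Suc n) * coeff ?F0 (Suc n)"
      using shift_diff_quotient[of w ?F0] F0 by blast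
    have "coeff Q0 n = coeff Q n" using Q0(3) scal[of "Suc n"] by (simp add: mult.left_commute)
    then have "deg_lt n (Q - Q0)"
      using deg_lt_SucD[OF deg_lt_diff[OF Suc.prems Q0(2)]] by simp
    then obtain F where F: "shift_diff w F = smult w (Q - Q0)" "deg_lt (Suc n) F" using Suc.IH by blast
    show ?case
      using F Q0(1) F0 by (intro exI[of _ "F + ?F0"])
        (auto simp: shift_diff_simps smult_diff_right intro!: deg_lt_add elim: deg_lt_mono)
  qed

end

section \<open>Free deformations of the braid arrangement\<close>

lemma smult_sum_right: "smult c (\<Sum>s\<in>S. f s) = (\<Sum>s\<in>S. smult c (f s))"
  by (induction S rule: infinite_finite_induct) (simp_all add: smult_add_right)

text \<open>All that is used of the polynomial ring beyond being a domain: the forms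
  \<open>y i - y k\<close> and \<open>y i - y k - w\<close> can be cancelled against each other like
  distinct primes. Unordered pairs appear in \<open>coprime\<close> because \<open>y k - y i\<close>
  is an associate of \<open>y i - y k\<close>.\<close>

locale coords = rational_domain scal for scal :: "nat \<Rightarrow> 'a::idom" +
  fixes y :: "nat \<Rightarrow> 'a" and w :: 'a and p :: nat
  assumes w: "w \<noteq> 0"
    and coprime: "\<lbrakk>i \<le> p; k \<le> p; j \<le> p; l \<le> p; i \<noteq> k; j \<noteq> l; {i, k} \<noteq> {j, l} \<or> e \<noteq> e'; e \<in> {0, w}; e' \<in> {0, w};
      y i - y k - e dvd (y j - y l - e') * f\<rbrakk> \<Longrightarrow> y i - y k - e dvd f"
    and coprime_w: "\<lbrakk>i \<le> p; k \<le> p; i \<noteq> k; y i - y k - w dvd w * f\<rbrakk> \<Longrightarrow> y i - y k - w dvd f"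
    and nonzero: "\<lbrakk>i \<le> p; k \<le> p; i \<noteq> k; e \<in> {0, w}\<rbrakk> \<Longrightarrow> y i - y k - e \<noteq> 0"
begin

text \<open>The conditions on the values \<open>g i\<close> at \<open>y i\<close> of a derivation
  that vanishes on \<open>w\<close>.\<close>

definition node_cond :: "(nat \<times> nat) set \<Rightarrow> (nat \<Rightarrow> 'a) \<Rightarrow> bool" where
  "node_cond R g \<longleftrightarrow> (\<forall>i\<le>p. \<forall>j\<le>p. y j - y i dvd g j - g i) \<and> (\<forall>(a, b)\<in>R. y a - y b - w dvd g a - g b)"

definition diff_cond :: "(nat \<times> nat) set \<Rightarrow> 'a poly \<Rightarrow> bool" where
  "diff_cond R E \<longleftrightarrow> (\<forall>(a, b)\<in>R. y a - y b - w dvd poly E (y b))"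

text \<open>Freeness of rank \<open>p\<close> modulo constants: the conditions concern differences
  of values only, so a common summand \<open>c0\<close> is split off.\<close>

definition free_nodes :: "(nat \<times> nat) set \<Rightarrow> bool" where
  "free_nodes R \<longleftrightarrow> (\<exists>G. (\<forall>s<p. node_cond R (G s)) \<and>
     (\<forall>g. node_cond R g \<longrightarrow> (\<exists>c0 c. \<forall>i\<le>p. g i = c0 + (\<Sum>s<p. c s * G s i))) \<and>
     (\<forall>c0 c. (\<forall>i\<le>p. c0 + (\<Sum>s<p. c s * G s i) = 0) \<longrightarrow> (\<forall>s<p. c s = 0)))"

lemma coprime_nodes: "\<lbrakk>i \<le> p; k \<le> p; j \<le> p; i \<noteq> k; i \<noteq> j; k \<noteq> j; y i - y k dvd (y i - y j) * f\<rbrakk> \<Longrightarrow> y i - y k dvd f"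
  using coprime[of i k i j 0 0 f] by (auto simp: doubleton_eq_iff)

lemma inj_y: "J \<subseteq> {..p} \<Longrightarrow> inj_on y J"
  by (rule inj_onI) (metis atMost_iff diff_self diff_zero insertI1 nonzero subset_iff)

text \<open>Newton interpolation without denominators. The error at a new node is divisible by its
  difference to each old node, hence by their product, and a multiple of the nodal polynomial
  corrects it.\<close>

lemma interpolation:
  assumes "J \<subseteq> {..p}" "\<And>i j. i \<in> J \<Longrightarrow> j \<in> J \<Longrightarrow> y j - y i dvd g j - g i"
  shows "\<exists>F. deg_lt (card J) F \<and> (\<forall>i\<in>J. poly F (y i) = g i)"
proof -
  have "finite J" using assms(1) by (rule finite_subset) simp
  then show ?thesis
    using assms
  proof (induction J)
    case (insert m J)
    then obtain F where F: "deg_lt (card J) F" "\<forall>i\<in>J. poly F (y i) = g i" by (metis insert_subset insertCI)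
    have "(\<Prod>i\<in>J. y m - y i) dvd g m - poly F (y m)"
    proof (rule prod_dvd_of_coprime[OF insert.hyps(1)])
      fix i assume i: "i \<in> J"
      have "y m - y i dvd (g m - g i) - (poly F (y m) - poly F (y i))"
        using dvd_diff[OF insert.prems(2)[of i m] diff_dvd_poly_diff] i by auto
      then show "y m - y i dvd g m - poly F (y m)" using F(2) i by simp
    next
      fix i j f assume "i \<in> J" "j \<in> J" "i \<noteq> j" "y m - y i dvd (y m - y j) * f"
      then show "y m - y i dvd f"
        using insert.prems(1) insert.hyps(2) by (intro coprime_nodes[of m i j f]) auto
    qed
    then obtain c where c: "g m - poly F (y m) = (\<Prod>i\<in>J. y m - y i) * c" ..
    have "poly (F + smult c (roots_poly y J)) (y i) = g i" if "i \<in> insert m J" for i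
      using that F(2) c insert.hyps by (cases "i = m") (auto simp: poly_roots_poly prod_zero_iff algebra_simps)
    moreover have "deg_lt (card (insert m J)) (F + smult c (roots_poly y J))"
      using insert.hyps F(1) deg_lt_roots_poly by (auto intro!: deg_lt_add deg_lt_smult elim: deg_lt_mono)
    ultimately show ?case by blast
  qed (auto intro!: exI[of _ 0])
qed

text \<open>The difference quotient of the nodal polynomial of \<open>A\<close>. For all nodes
  together it represents the zero system of values, so it has to be split off from the
  solutions.\<close>

definition qd :: "nat set \<Rightarrow> 'a poly" where
  "qd A = (SOME Q. shift_diff w (roots_poly y A) = smult w Q \<and> deg_lt (card A) Q \<and>
     (\<forall>n. card A = Suc n \<longrightarrow> coeff Q n = of_nat (card A)))"

lemma qd: "shift_diff w (roots_poly y A) = smult w (qd A)" "deg_lt (card A) (qd A)"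
    "card A = Suc n \<Longrightarrow> coeff (qd A) n = of_nat (card A)"
proof -
  obtain Q where Q: "shift_diff w (roots_poly y A) = smult w Q"
    "\<And>n. deg_lt (Suc n) (roots_poly y A) \<Longrightarrow> deg_lt n Q"
    "\<And>n. deg_lt (Suc (Suc n)) (roots_poly y A) \<Longrightarrow> coeff Q n = of_nat (Suc n) * coeff (roots_poly y A) (Suc n)"
    using shift_diff_quotient by blast
  have "coeff Q n = of_nat (card A)" if "card A = Suc n" for n
    using Q(3)[of n] deg_lt_roots_poly[of A y] roots_poly_monic(1,2)[of y A] that by simp
  then have "\<exists>Q. shift_diff w (roots_poly y A) = smult w Q \<and> deg_lt (card A) Q \<and>
     (\<forall>n. card A = Suc n \<longrightarrow> coeff Q n = of_nat (card A))"
    using Q(1) Q(2)[OF deg_lt_roots_poly] by blast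
  from someI_ex[OF this] show "shift_diff w (roots_poly y A) = smult w (qd A)" "deg_lt (card A) (qd A)"
    "card A = Suc n \<Longrightarrow> coeff (qd A) n = of_nat (card A)"
    unfolding qd_def by blast+
qed

text \<open>A system of values \<open>g\<close> at the nodes is the restriction of a polynomial \<open>F\<close>, unique up to
  multiples of the nodal polynomial, and the conditions on \<open>g\<close> become conditions on the difference
  quotient \<open>(F(t + w) - F(t)) / w\<close>.\<close>

lemma free_nodesI:
  fixes Es :: "nat \<Rightarrow> 'a poly"
  assumes R: "R \<subseteq> {..p} \<times> {..p}" "\<And>a. (a, a) \<notin> R"
    and Es: "\<And>s. s < p \<Longrightarrow> diff_cond R (Es s)" "\<And>s. s < p \<Longrightarrow> deg_lt (Suc p) (Es s)"
    and span: "\<And>E. deg_lt p E \<Longrightarrow> diff_cond R E \<Longrightarrow> \<exists>c0 c. E = smult c0 (qd {..p}) + (\<Sum>s<p. smult (c s) (Es s))"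
    and indep: "\<And>c0 c. (\<Sum>s<p. smult (c s) (Es s)) = smult c0 (qd {..p}) \<Longrightarrow> \<forall>s<p. c s = 0"
  shows "free_nodes R"
proof -
  let ?P = "roots_poly y {..p}"
  have P0: "poly ?P (y i) = 0" if "i \<le> p" for i
    using that by (auto simp: poly_roots_poly prod_zero_iff)
  have "\<exists>F. shift_diff w F = smult w (Es s) \<and> deg_lt (Suc (Suc p)) F" if "s < p" for s
    using shift_diff_surj Es(2) that by blast
  then obtain Fs where Fs: "\<And>s. s < p \<Longrightarrow> shift_diff w (Fs s) = smult w (Es s)"
    "\<And>s. s < p \<Longrightarrow> deg_lt (Suc (Suc p)) (Fs s)" by metis
  define G where "G s i = poly (Fs s) (y i)" for s i
  have step: "w * poly E (y b) - (poly F (y a) - poly F (y b)) = poly F (y b + w) - poly F (y a)"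
    if "shift_diff w F = smult w E" for E F a b
    using arg_cong[OF that, of "\<lambda>F. poly F (y b)"] by (simp add: poly_shift_diff algebra_simps)
  \<comment> \<open>Modulo \<open>y a - y b - w\<close> the points \<open>y a\<close> and
    \<open>y b + w\<close> coincide, so the difference of the two values of \<open>F\<close> becomes
    a difference with step \<open>w\<close>.\<close>
  have transfer: "y a - y b - w dvd poly F (y a) - poly F (y b) \<longleftrightarrow> y a - y b - w dvd w * poly E (y b)"
    if "shift_diff w F = smult w E" for E F a b
  proof -
    have "(y b + w) - y a dvd poly F (y b + w) - poly F (y a)" by (rule diff_dvd_poly_diff)
    moreover have "(y b + w) - y a = - (y a - y b - w)" by simp
    ultimately have "y a - y b - w dvd w * poly E (y b) - (poly F (y a) - poly F (y b))"
      unfolding step[OF that] by (metis minus_dvd_iff)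
    then show ?thesis
      using dvd_add[of "y a - y b - w" "w * poly E (y b) - (poly F (y a) - poly F (y b))" "poly F (y a) - poly F (y b)"]
        dvd_diff[of "y a - y b - w" "w * poly E (y b)" "w * poly E (y b) - (poly F (y a) - poly F (y b))"]
      by auto
  qed
  show ?thesis
    unfolding free_nodes_def
  proof (intro exI[of _ G] conjI allI impI)
    fix s assume s: "s < p"
    show "node_cond R (G s)"
      unfolding node_cond_def G_def
    proof (intro conjI allI impI ballI diff_dvd_poly_diff)
      fix ab assume ab: "ab \<in> R"
      obtain a b where ab_eq: "ab = (a, b)" by (cases ab)
      have "y a - y b - w dvd poly (Es s) (y b)" using Es(1)[OF s] ab ab_eq by (auto simp: diff_cond_def)
      then show "case ab of (a, b) \<Rightarrow> y a - y b - w dvd poly (Fs s) (y a) - poly (Fs s) (y b)"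
        by (simp add: ab_eq transfer[OF Fs(1)[OF s]])
    qed
  next
    fix g assume g: "node_cond R g"
    obtain F where F: "deg_lt (card {..p}) F" "\<forall>i\<in>{..p}. poly F (y i) = g i"
      using interpolation[of "{..p}" g] g by (auto simp: node_cond_def)
    obtain E where E: "shift_diff w F = smult w E" "deg_lt p E"
      using shift_diff_quotient[of w F] F(1) by auto
    have "diff_cond R E"
      unfolding diff_cond_def
    proof (intro ballI)
      fix ab assume ab: "ab \<in> R"
      obtain a b where ab_eq: "ab = (a, b)" by (cases ab)
      have le: "a \<le> p" "b \<le> p" "a \<noteq> b" using R ab ab_eq by auto
      have "y a - y b - w dvd g a - g b" using g ab ab_eq by (auto simp: node_cond_def)
      then have "y a - y b - w dvd poly F (y a) - poly F (y b)" using F(2) le by simp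
      then have "y a - y b - w dvd w * poly E (y b)" using transfer[OF E(1)] by blast
      then have "y a - y b - w dvd poly E (y b)" by (rule coprime_w[OF le])
      then show "case ab of (a, b) \<Rightarrow> y a - y b - w dvd poly E (y b)"
        by (simp add: ab_eq)
    qed
    then obtain c0 c where c: "E = smult c0 (qd {..p}) + (\<Sum>s<p. smult (c s) (Es s))"
      using span E(2) by blast
    \<comment> \<open>Its difference vanishes, so it is constant; the nodal polynomial contributes
      nothing to the values at the nodes.\<close>
    let ?F = "F - smult c0 ?P - (\<Sum>s<p. smult (c s) (Fs s))"
    have "shift_diff w ?F = smult w E - smult c0 (smult w (qd {..p})) - (\<Sum>s<p. smult (c s) (smult w (Es s)))"
      using E(1) qd(1) Fs(1) by (simp add: shift_diff_simps shift_diff_sum)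
    also have "\<dots> = 0" by (simp add: c smult_add_right smult_sum_right mult.commute)
    finally obtain d where d: "?F = [:d:]" using shift_diff_eq_0 w by blast
    have "g i = d + (\<Sum>s<p. c s * G s i)" if "i \<le> p" for i
      using arg_cong[OF d, of "\<lambda>F. poly F (y i)"] F(2) P0[OF that] that
      by (simp add: poly_sum G_def algebra_simps)
    then show "\<exists>c0 c. \<forall>i\<le>p. g i = c0 + (\<Sum>s<p. c s * G s i)" by blast
  next
    fix c0 c s assume *: "\<forall>i\<le>p. c0 + (\<Sum>s<p. c s * G s i) = 0" and s: "s < p"
    let ?F = "[:c0:] + (\<Sum>s<p. smult (c s) (Fs s))"
    have "poly ?F (y i) = 0" if "i \<in> {..p}" for i
      using * that by (simp add: poly_sum G_def)
    \<comment> \<open>A combination vanishing at all nodes is a multiple of the nodal polynomial,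
      and degrees make the factor constant. Passing to difference quotients gives a relation with
      \<open>qd {..p}\<close>.\<close>
    then obtain D where D: "?F = ?P * D"
      using roots_poly_dvd[of "{..p}" y ?F] inj_y by auto
    have "deg_lt (Suc (Suc p)) ?F"
      using Fs(2) by (intro deg_lt_add deg_lt_sum deg_lt_smult) (auto simp: deg_lt_iff)
    then have "deg_lt 1 D"
      unfolding D using roots_poly_quotient_deg[of "{..p}" 1 y D] by simp
    then obtain d where "D = [:d:]" by (metis deg_lt_iff degree_eq_zeroE less_one pCons_0_0)
    then have F: "?F = smult d ?P" using D by simp
    have c0: "shift_diff w [:c0:] = 0" by (simp add: shift_diff_def)
    have "smult w (\<Sum>s<p. smult (c s) (Es s)) = shift_diff w ?F"
      using Fs(1) by (simp add: shift_diff_simps shift_diff_sum c0 smult_sum_right mult.commute)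
    also have "\<dots> = smult w (smult d (qd {..p}))"
      by (simp only: F shift_diff_simps qd(1) smult_smult mult.commute)
    finally have "(\<Sum>s<p. smult (c s) (Es s)) = smult d (qd {..p})"
      using w by (simp only: smult_cancel)
    then show "c s = 0" using indep s by blast
  qed
qed

text \<open>The nodal polynomial after the shift by \<open>w\<close>. Its value at
  \<open>y b\<close> is, up to sign, the product of the forms \<open>y a - y b - w\<close>, so as a
  factor it enforces every condition with first index in \<open>A\<close>.\<close>

definition shifted_roots :: "nat set \<Rightarrow> 'a poly" where
  "shifted_roots A = roots_poly (\<lambda>a. y a - w) A"

lemma poly_shifted_roots: "poly (shifted_roots A) x = (\<Prod>a\<in>A. x + w - y a)"
  by (simp add: shifted_roots_def poly_roots_poly algebra_simps)

lemma pcompose_roots_poly: "pcompose (roots_poly y A) [:w, 1:] = shifted_roots A"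
  by (simp add: roots_poly_def shifted_roots_def pcompose_prod pcompose_pCons)

lemma shifted_roots_eq: "shifted_roots A = roots_poly y A + smult w (qd A)"
  using qd(1)[of A] by (simp add: shift_diff_def pcompose_roots_poly algebra_simps)

text \<open>The product rule for differences with step \<open>w\<close>, divided by
  \<open>w\<close>.\<close>

lemma qd_Un:
  assumes "finite A" "finite B" "A \<inter> B = {}"
  shows "qd (A \<union> B) = shifted_roots A * qd B + qd A * roots_poly y B"
proof -
  have Un: "roots_poly y (A \<union> B) = roots_poly y A * roots_poly y B" "shifted_roots (A \<union> B) = shifted_roots A * shifted_roots B"
    using assms by (simp_all add: roots_poly_def shifted_roots_def prod.union_disjoint)
  have "smult w (qd (A \<union> B)) = shifted_roots (A \<union> B) - roots_poly y (A \<union> B)"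
    by (simp add: shifted_roots_eq[of "A \<union> B"])
  also have "\<dots> = shifted_roots A * (roots_poly y B + smult w (qd B)) - roots_poly y A * roots_poly y B"
    unfolding Un by (simp add: shifted_roots_eq[of B])
  also have "\<dots> = smult w (shifted_roots A * qd B + qd A * roots_poly y B)"
    by (simp add: shifted_roots_eq[of A] smult_add_right algebra_simps)
  finally show ?thesis using w by (simp only: smult_cancel)
qed

lemma dvd_shift_iff: "y b + w - y a dvd f \<longleftrightarrow> y a - y b - w dvd f"
proof -
  have "y b + w - y a = - (y a - y b - w)" by simp
  then show ?thesis by (metis minus_dvd_iff)
qed

lemma dvd_shift_mult_iff: "\<alpha> dvd (y b + w - y a) * f \<longleftrightarrow> \<alpha> dvd (y a - y b - w) * f"
proof -
  have "(y b + w - y a) * f = - ((y a - y b - w) * f)" by (simp add: algebra_simps)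
  then show ?thesis by (metis dvd_minus_iff)
qed

lemma shifted_dvd:
  assumes "A \<subseteq> {..p}" "b \<le> p" "b \<notin> A" "\<And>a. a \<in> A \<Longrightarrow> y a - y b - w dvd f"
  shows "poly (shifted_roots A) (y b) dvd f"
  unfolding poly_shifted_roots
proof (rule prod_dvd_of_coprime)
  show "finite A" using assms(1) by (rule finite_subset) simp
  show "y b + w - y a dvd f" if "a \<in> A" for a using assms(4) that by (simp add: dvd_shift_iff)
  show "y b + w - y i dvd f" if "i \<in> A" "j \<in> A" "i \<noteq> j" "y b + w - y i dvd (y b + w - y j) * f" for i j f
    using that assms(1-3) coprime[of i b j b w w f]
    by (auto simp: dvd_shift_iff dvd_shift_mult_iff doubleton_eq_iff)
qed

text \<open>At nodes of \<open>B\<close> the values of \<open>E\<close> are divisible by those of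
  the shifted polynomial. The quotients again satisfy the divisibilities of interpolation, since
  \<open>y j - y i\<close> cancels against the shifted factors; the remainder vanishes on
  \<open>B\<close>.\<close>

lemma quotient_interpolation:
  assumes A: "A \<subseteq> {..p}" and B: "B \<subseteq> {..p}" and disj: "A \<inter> B = {}"
    and dvd: "\<And>a b. a \<in> A \<Longrightarrow> b \<in> B \<Longrightarrow> y a - y b - w dvd poly E (y b)"
  shows "\<exists>H D. deg_lt (card B) H \<and> E = shifted_roots A * H + roots_poly y B * D"
proof -
  have "\<exists>h. poly E (y b) = poly (shifted_roots A) (y b) * h" if "b \<in> B" for b
    using shifted_dvd[OF A, of b "poly E (y b)"] that B disj dvd by (auto simp: dvd_def)
  then obtain h where h: "\<And>b. b \<in> B \<Longrightarrow> poly E (y b) = poly (shifted_roots A) (y b) * h b" by metis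
  have "y j - y i dvd h j - h i" if ij: "i \<in> B" "j \<in> B" for i j
  proof (cases "i = j")
    case False
    have "poly (shifted_roots A) (y j) * (h j - h i) =
        (poly E (y j) - poly E (y i)) - (poly (shifted_roots A) (y j) - poly (shifted_roots A) (y i)) * h i"
      using h ij by (simp add: algebra_simps)
    also have "y j - y i dvd \<dots>"
      by (intro dvd_diff dvd_mult2 diff_dvd_poly_diff)
    finally have "y j - y i dvd (\<Prod>a\<in>A. y j + w - y a) * (h j - h i)"
      by (simp add: poly_shifted_roots)
    then show ?thesis
    proof (rule dvd_of_dvd_prod_mult)
      fix a f assume "a \<in> A" "y j - y i dvd (y j + w - y a) * f"
      then show "y j - y i dvd f"
        using coprime[of j i a j 0 w f] False w ij A B disj by (auto simp: dvd_shift_mult_iff)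
    qed
  qed simp
  then obtain H where H: "deg_lt (card B) H" "\<forall>b\<in>B. poly H (y b) = h b"
    using interpolation[OF B, of h] by blast
  have "poly (E - shifted_roots A * H) (y b) = 0" if "b \<in> B" for b
    using H(2) h that by simp
  then obtain D where "E - shifted_roots A * H = roots_poly y B * D"
    using roots_poly_dvd[of B y] inj_y[OF B] finite_subset[OF B] by blast
  then show ?thesis using H(1) by (metis add.commute diff_add_cancel)
qed

text \<open>The roots \<open>y a - w\<close> on the left are not roots of the nodal polynomial of
  \<open>B\<close>, so \<open>Y\<close> has more roots than its degree permits.\<close>

lemma shifted_indep:
  assumes A: "A \<subseteq> {..p}" and B: "B \<subseteq> {..p}" and disj: "A \<inter> B = {}"
    and eq: "shifted_roots A * X = roots_poly y B * Y" and Y: "deg_lt (card A) Y"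
  shows "X = 0 \<and> Y = 0"
proof -
  have fin: "finite A" using A by (rule finite_subset) simp
  have "poly Y (y a - w) = 0" if a: "a \<in> A" for a
  proof -
    have "poly (shifted_roots A) (y a - w) = 0"
      using a fin by (auto simp: poly_shifted_roots prod_zero_iff)
    then have "poly (roots_poly y B) (y a - w) * poly Y (y a - w) = 0"
      using arg_cong[OF eq, of "\<lambda>F. poly F (y a - w)"] by simp
    moreover have "poly (roots_poly y B) (y a - w) \<noteq> 0"
    proof
      assume "poly (roots_poly y B) (y a - w) = 0"
      then obtain b where b: "b \<in> B" "y a - w - y b = 0"
        using finite_subset[OF B] by (auto simp: poly_roots_poly prod_zero_iff)
      then have "y a - y b - w = 0" by (simp add: algebra_simps)
      then show False using nonzero[of a b w] a b A B disj by auto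
    qed
    ultimately show ?thesis by simp
  qed
  then have "Y = 0"
    using deg_lt_roots_eq_0[of A "\<lambda>a. y a - w" Y] fin inj_y[OF A] Y by (auto simp: inj_on_def)
  moreover have "shifted_roots A \<noteq> 0"
    using roots_poly_monic(3) by (simp add: shifted_roots_def)
  ultimately show ?thesis using eq by simp
qed

lemma sum_smult_monom: "(\<Sum>s<n. smult (c s) (X * monom 1 s)) = X * (\<Sum>s<n. monom (c s) s)" for X :: "'a poly"
  by (simp add: sum_distrib_left smult_monom flip: mult_smult_right)

lemma sum_monom_eq_0D: "(\<Sum>s<n. monom (c s) s) = 0 \<Longrightarrow> s < n \<Longrightarrow> c s = (0 :: 'a)"
  by (metis coeff_0 coeff_sum_lessThan_monom)

lemma deg_lt_sum_monom: "deg_lt n (\<Sum>s<n. monom (c s) s)" for c :: "nat \<Rightarrow> 'a"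
  by (intro deg_lt_sum deg_lt_monom) auto

end

section \<open>Conditions from a cut of the nodes and from two overlapping cuts\<close>

context coords
begin

lemma dvd_shifted_roots: "finite A \<Longrightarrow> a \<in> A \<Longrightarrow> y a - y b - w dvd poly (shifted_roots A) (y b)"
  unfolding poly_shifted_roots
  by (rule dvd_trans[OF _ dvd_prodI[of A a "\<lambda>a. y b + w - y a"]]) (simp_all add: dvd_shift_iff[symmetric])

lemma roots_poly_at_node: "finite B \<Longrightarrow> b \<in> B \<Longrightarrow> poly (roots_poly y B) (y b) = 0"
  by (auto simp: poly_roots_poly prod_zero_iff)

lemma deg_lt_shifted_roots: "deg_lt (Suc (card A)) (shifted_roots A)"
  by (simp add: shifted_roots_def deg_lt_roots_poly)

lemma diff_condI: "(\<And>a b. (a, b) \<in> R \<Longrightarrow> y a - y b - w dvd poly E (y b)) \<Longrightarrow> diff_cond R E"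
  by (auto simp: diff_cond_def)

lemma diff_condD: "diff_cond R E \<Longrightarrow> (a, b) \<in> R \<Longrightarrow> y a - y b - w dvd poly E (y b)"
  by (auto simp: diff_cond_def)

text \<open>Solutions are the combinations \<open>U * H + V * D\<close>, where \<open>U\<close>
  carries the conditions and \<open>V\<close> vanishes on the second block. In
  \<open>qd {..p} = U * qd ?B + qd ?A * V\<close> the second part has leading coefficient
  \<open>k\<close>, so this polynomial replaces the top monomial of \<open>D\<close>; the other
  monomials give \<open>l + (k - 1) = p\<close> basis elements.\<close>

lemma free_nodes_cut:
  assumes k: "1 \<le> k" "k \<le> p"
  shows "free_nodes ({..<k} \<times> {k..p})"
proof -
  let ?A = "{..<k}" and ?B = "{k..p}"
  define l where "l = Suc p - k"
  have p: "p = l + (k - 1)" and card: "card ?A = k" "card ?B = l" using k by (auto simp: l_def)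
  have sub: "?A \<subseteq> {..p}" "?B \<subseteq> {..p}" "?A \<inter> ?B = {}" and un: "{..p} = ?A \<union> ?B" using k by auto
  define U where "U = shifted_roots ?A"
  define V where "V = roots_poly y ?B"
  define Es where "Es s = (if s < l then U * monom 1 s else V * monom 1 (s - l))" for s
  have U_deg: "deg_lt (Suc k) U" and V_deg: "deg_lt (Suc l) V"
    using deg_lt_shifted_roots[of ?A] deg_lt_roots_poly[of ?B y] card by (simp_all add: U_def V_def)
  have qd_eq: "qd {..p} = U * qd ?B + qd ?A * V"
    unfolding un U_def V_def by (rule qd_Un) (use sub in auto)
  have qd_deg: "deg_lt k (qd ?A)" "deg_lt l (qd ?B)" and qd_lead: "coeff (qd ?A) (k - 1) = of_nat k"
    using qd(2)[of ?A] qd(2)[of ?B] qd(3)[of ?A "k - 1"] k card by simp_all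
  have sum: "(\<Sum>s<p. smult (c s) (Es s)) = U * (\<Sum>s<l. monom (c s) s) + V * (\<Sum>s<k - 1. monom (c (l + s)) s)" for c
    unfolding p sum_lessThan_add by (simp add: Es_def flip: sum_smult_monom)
  show ?thesis
  proof (rule free_nodesI[where Es = Es])
    fix s assume s: "s < p"
    show "diff_cond (?A \<times> ?B) (Es s)"
      by (rule diff_condI) (auto simp: Es_def U_def V_def roots_poly_at_node intro!: dvd_mult2 dvd_shifted_roots)
    have "deg_lt (k + l) (U * monom 1 s)" if "s < l"
      using U_deg that by (intro deg_lt_mult deg_lt_monom)
    moreover have "deg_lt (l + k) (V * monom 1 (s - l))" if "\<not> s < l"
      using V_deg s p that by (intro deg_lt_mult deg_lt_monom) auto
    ultimately show "deg_lt (Suc p) (Es s)"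
      using k by (auto simp: Es_def p add.commute)
  next
    fix E assume E: "deg_lt p E" "diff_cond (?A \<times> ?B) E"
    obtain H D where H: "deg_lt l H" and E_eq: "E = U * H + V * D"
      using quotient_interpolation[OF sub, of E] diff_condD[OF E(2)] card unfolding U_def V_def by auto
    have "V * D = E - U * H" by (simp add: E_eq)
    moreover have "deg_lt (l + k) (E - U * H)"
      using E(1) deg_lt_mult[OF U_deg H] p by (intro deg_lt_diff) (auto simp: add.commute elim: deg_lt_mono)
    ultimately have D: "deg_lt k D"
      using roots_poly_quotient_deg[of ?B k y D] card by (simp add: V_def)
    \<comment> \<open>Chosen so that subtracting \<open>c0\<close> times \<open>qd {..p}\<close>
      removes the top coefficient of \<open>D\<close>.\<close>
    define c0 where "c0 = scal k * coeff D (k - 1)"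
    define H' D' where "H' = H - smult c0 (qd ?B)" and "D' = D - smult c0 (qd ?A)"
    have H': "deg_lt l H'" using H qd_deg by (simp add: H'_def deg_lt_diff deg_lt_smult)
    have "coeff D' (k - 1) = coeff D (k - 1) - of_nat k * scal k * coeff D (k - 1)"
      unfolding D'_def c0_def coeff_diff coeff_smult qd_lead by (simp only: ac_simps)
    also have "\<dots> = 0" using scal[of k] k by simp
    finally have lead: "coeff D' (k - 1) = 0" .
    have "deg_lt (Suc (k - 1)) D'"
      using D qd_deg k by (simp add: D'_def deg_lt_diff deg_lt_smult)
    then have D': "deg_lt (k - 1) D'" using lead by (rule deg_lt_SucD)
    let ?c = "\<lambda>s. if s < l then coeff H' s else coeff D' (s - l)"
    have "E = smult c0 (qd {..p}) + (U * H' + V * D')"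
      by (simp add: qd_eq E_eq H'_def D'_def smult_add_right algebra_simps)
    also have "U * H' + V * D' = (\<Sum>s<p. smult (?c s) (Es s))"
      unfolding sum using poly_eq_sum_monom[OF H'] poly_eq_sum_monom[OF D'] by simp
    finally show "\<exists>c0 c. E = smult c0 (qd {..p}) + (\<Sum>s<p. smult (c s) (Es s))"
      by (intro exI[of _ c0] exI[of _ ?c])
  next
    fix c0 c assume *: "(\<Sum>s<p. smult (c s) (Es s)) = smult c0 (qd {..p})"
    define H where "H = (\<Sum>s<l. monom (c s) s)"
    define D where "D = (\<Sum>s<k - 1. monom (c (l + s)) s)"
    have D: "deg_lt (k - 1) D" unfolding D_def by (rule deg_lt_sum_monom)
    have "U * (H - smult c0 (qd ?B)) = V * (smult c0 (qd ?A) - D)"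
      using *[unfolded sum qd_eq, folded H_def D_def] by (simp add: smult_add_right algebra_simps)
    moreover have "deg_lt k (smult c0 (qd ?A) - D)"
      using D qd_deg by (intro deg_lt_diff deg_lt_smult) (auto elim: deg_lt_mono)
    ultimately have "H - smult c0 (qd ?B) = 0 \<and> smult c0 (qd ?A) - D = 0"
      unfolding U_def V_def by (rule shifted_indep[OF sub, unfolded card])
    then have 0: "H = smult c0 (qd ?B)" "D = smult c0 (qd ?A)" by auto
    have "coeff D (k - 1) = 0" using D by (simp add: deg_lt_def)
    then have "c0 = 0" using 0(2) qd_lead of_nat_neq_0[of k] k by simp
    then have "H = 0" "D = 0" using 0 by simp_all
    then show "\<forall>s<p. c s = 0"
    proof (intro allI impI)
      fix s assume s: "s < p"
      show "c s = 0"
      proof (cases "s < l")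
        case True
        then show ?thesis using sum_monom_eq_0D \<open>H = 0\<close> by (simp add: H_def)
      next
        case False
        then have "s - l < k - 1" using s p by simp
        from sum_monom_eq_0D[OF _ this, of "\<lambda>s. c (l + s)"] show ?thesis
          using \<open>D = 0\<close> False by (simp add: D_def)
      qed
    qed
  qed (use k in auto)
qed

text \<open>Node \<open>k\<close> belongs to both sides, through the factors \<open>S\<close>
  (shifted) and \<open>T\<close> (unshifted). Besides the multiples of \<open>U * S\<close> and
  \<open>T * V\<close> there is the solution \<open>U * V\<close>: at \<open>y k\<close> its factor
  \<open>U\<close> does the work, at the nodes beyond \<open>k\<close> it vanishes.\<close>

lemma free_nodes_overlap:
  assumes k: "1 \<le> k" "k < p"
  shows "free_nodes {(i, j). i \<le> k \<and> k \<le> j \<and> i < j \<and> j \<le> p}"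
proof -
  let ?A = "{..<k}" and ?B = "{k + 1..p}" and ?R = "{(i, j). i \<le> k \<and> k \<le> j \<and> i < j \<and> j \<le> p}"
  define l where "l = p - k"
  have p: "p = l + (1 + (k - 1))" and card: "card ?A = k" "card ?B = l" using k by (auto simp: l_def)
  have sub: "?A \<subseteq> {..p}" "?B \<subseteq> {..p}" "?A \<inter> ?B = {}" using k by auto
  have un: "{..p} = ?A \<union> insert k ?B" and ins: "insert k ?A = {..k}" using k by auto
  define U where "U = shifted_roots ?A"
  define V where "V = roots_poly y ?B"
  define S where "S = [:w - y k, 1:]"
  define T where "T = [:- y k, 1:]"
  have US: "shifted_roots (insert k ?A) = U * S"
    by (simp add: U_def S_def shifted_roots_def roots_poly_insert mult.commute)
  have TV: "roots_poly y (insert k ?B) = T * V"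
    by (simp add: V_def T_def roots_poly_insert)
  have U_deg: "deg_lt (Suc k) U" and V_deg: "deg_lt (Suc l) V"
    using deg_lt_shifted_roots[of ?A] deg_lt_roots_poly[of ?B y] card by (simp_all add: U_def V_def)
  have S_deg: "deg_lt 2 S" and T_deg: "deg_lt 2 T"
    by (simp_all add: S_def T_def deg_lt_iff)
  have qd_single: "qd {k} = 1"
  proof -
    have "smult w (qd {k}) = shifted_roots {k} - roots_poly y {k}"
      by (simp add: shifted_roots_eq[of "{k}"])
    also have "\<dots> = smult w 1"
      by (simp add: shifted_roots_def roots_poly_def one_pCons)
    finally have "smult w (qd {k}) = smult w 1" .
    then show ?thesis using w by (simp only: smult_cancel)
  qed
  have "qd (insert k ?B) = S * qd ?B + V"
    using qd_Un[of "{k}" ?B] qd_single by (simp add: S_def V_def shifted_roots_def roots_poly_def)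
  moreover have "qd (?A \<union> insert k ?B) = U * qd (insert k ?B) + qd ?A * (T * V)"
    unfolding U_def TV[symmetric] by (rule qd_Un) auto
  ultimately have qd_eq: "qd {..p} = U * S * qd ?B + U * V + T * V * qd ?A"
    unfolding un by (simp only: distrib_left ac_simps)
  have qd_deg: "deg_lt k (qd ?A)" "deg_lt l (qd ?B)" and qd_lead: "coeff (qd ?A) (k - 1) = of_nat k"
    using qd(2)[of ?A] qd(2)[of ?B] qd(3)[of ?A "k - 1"] k card by simp_all
  define Es where "Es s = (if s < l then U * S * monom 1 s else if s = l then U * V else T * V * monom 1 (s - l - 1))" for s
  have sum: "(\<Sum>s<p. smult (c s) (Es s)) = U * S * (\<Sum>s<l. monom (c s) s) + smult (c l) (U * V)
      + T * V * (\<Sum>s<k - 1. monom (c (l + (1 + s))) s)" for c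
    unfolding p sum_lessThan_add by (simp add: Es_def flip: sum_smult_monom)
  have US_deg: "deg_lt (Suc (Suc k)) (U * S)"
    using deg_lt_mult[OF U_deg S_deg] by simp
  have VT_deg: "deg_lt (Suc (Suc l)) (T * V)"
    using deg_lt_mult[OF V_deg T_deg] by (simp add: mult.commute)
  have UV_deg: "deg_lt (Suc (k + l)) (U * V)"
    using deg_lt_mult[OF U_deg V_deg] by simp
  have T_at: "poly T (y k) = 0" and S_at: "poly S (y k - w) = 0" by (simp_all add: T_def S_def)
  have S_dvd: "y k - y b - w dvd poly S (y b)" for b
  proof -
    have "poly S (y b) = y b + w - y k" by (simp add: S_def)
    then show ?thesis by (simp only: dvd_shift_iff[symmetric] dvd_refl)
  qed
  show ?thesis
  proof (rule free_nodesI[where Es = Es])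
    fix s assume s: "s < p"
    have "y a - y b - w dvd poly (Es s) (y b)" if "(a, b) \<in> ?R" for a b
    proof -
      have 1: "y a - y b - w dvd poly (U * S) (y b)"
        unfolding US[symmetric] by (rule dvd_shifted_roots) (use that in auto)
      have 2: "y a - y b - w dvd poly (U * V) (y b)"
      proof (cases "b = k")
        case True
        then have "y a - y b - w dvd poly U (y b)" using that dvd_shifted_roots[of ?A a b] by (auto simp: U_def)
        then show ?thesis by simp
      next
        case False
        then have "poly V (y b) = 0" using that unfolding V_def by (intro roots_poly_at_node) auto
        then show ?thesis by simp
      qed
      have 3: "poly (T * V) (y b) = 0"
        unfolding TV[symmetric] using that by (intro roots_poly_at_node) auto
      show ?thesis using 1 2 3 by (auto simp: Es_def simp del: mult.commute)
    qed
    then show "diff_cond ?R (Es s)" by (rule diff_condI)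
    have "deg_lt (Suc k + l) (U * S * monom 1 s)" if "s < l"
      using US_deg that by (intro deg_lt_mult deg_lt_monom)
    moreover have "deg_lt (Suc p) (T * V * monom 1 (s - l - 1))" if "\<not> s < l" "s \<noteq> l"
    proof -
      have "deg_lt (Suc l + (k - 1)) (T * V * monom 1 (s - l - 1))"
        using VT_deg s p that by (intro deg_lt_mult deg_lt_monom) auto
      then show ?thesis by (rule deg_lt_mono) (use p in simp)
    qed
    ultimately show "deg_lt (Suc p) (Es s)"
      using k UV_deg p by (auto simp: Es_def add.commute)
  next
    fix E assume E: "deg_lt p E" "diff_cond ?R E"
    \<comment> \<open>At this stage only the conditions with second index beyond \<open>k\<close>
      are used.\<close>
    have "\<exists>H D. deg_lt (card ?B) H \<and> E = shifted_roots (insert k ?A) * H + roots_poly y ?B * D"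
      by (rule quotient_interpolation) (use k diff_condD[OF E(2)] in auto)
    then obtain H D where H: "deg_lt l H" and E_eq: "E = U * S * H + V * D"
      unfolding US card V_def[symmetric] by blast
    have "V * D = E - U * S * H" by (simp add: E_eq)
    moreover have "deg_lt (l + Suc k) (E - U * S * H)"
      using E(1) deg_lt_mult[OF US_deg H] p k by (intro deg_lt_diff) (auto simp: add.commute elim: deg_lt_mono)
    ultimately have D: "deg_lt (Suc k) D"
      using roots_poly_quotient_deg[of ?B "Suc k" y D] card by (simp add: V_def)
    \<comment> \<open>The conditions with second index \<open>k\<close>. Since the factors of
      \<open>U\<close> at \<open>y k\<close> cancel against those of \<open>V\<close>, the value of
      \<open>D\<close> there is a multiple of the value of \<open>U\<close>; subtracting that
      multiple of \<open>U\<close> makes \<open>D\<close> divisible by \<open>T\<close>.\<close>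
    have "poly U (y k) dvd poly E (y k)"
      unfolding U_def by (rule shifted_dvd) (use k diff_condD[OF E(2)] in auto)
    then have "poly U (y k) dvd poly V (y k) * poly D (y k)"
      unfolding E_eq by (simp add: dvd_add_right_iff mult.assoc)
    moreover have "poly U (y k) dvd f" if "poly U (y k) dvd poly V (y k) * f" for f
      unfolding U_def
    proof (rule shifted_dvd)
      fix a assume a: "a \<in> ?A"
      have "y a - y k - w dvd poly U (y k)" unfolding U_def using a by (intro dvd_shifted_roots) auto
      then have "y a - y k - w dvd (\<Prod>b\<in>?B. y k - y b) * f"
        using that dvd_trans by (simp add: V_def poly_roots_poly)
      then show "y a - y k - w dvd f"
      proof (rule dvd_of_dvd_prod_mult)
        fix b f assume "b \<in> ?B" "y a - y k - w dvd (y k - y b) * f"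
        then show "y a - y k - w dvd f"
          using coprime[of a k k b w 0 f] a k w by auto
      qed
    qed (use k in auto)
    ultimately obtain e where e: "poly D (y k) = poly U (y k) * e" by (auto simp: dvd_def)
    have "poly (D - smult e U) (y k) = 0" using e by (simp add: mult.commute)
    then obtain D1 where D1: "D - smult e U = T * D1"
      unfolding T_def using poly_eq_0_iff_dvd by (metis dvdE)
    have "deg_lt (Suc k) (D - smult e U)" using D U_deg by (intro deg_lt_diff deg_lt_smult)
    then have D1_deg: "deg_lt k D1"
      using roots_poly_quotient_deg[of "{k}" k y D1] D1 by (simp add: roots_poly_def T_def)
    have "D = smult e U + T * D1" using D1 by (simp add: algebra_simps)
    then have E_eq: "E = U * S * H + smult e (U * V) + T * V * D1"
      by (simp add: E_eq algebra_simps)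
    define c0 where "c0 = scal k * coeff D1 (k - 1)"
    define H' D' where "H' = H - smult c0 (qd ?B)" and "D' = D1 - smult c0 (qd ?A)"
    have H': "deg_lt l H'" using H qd_deg by (simp add: H'_def deg_lt_diff deg_lt_smult)
    have "coeff D' (k - 1) = coeff D1 (k - 1) - of_nat k * scal k * coeff D1 (k - 1)"
      unfolding D'_def c0_def coeff_diff coeff_smult qd_lead by (simp only: ac_simps)
    also have "\<dots> = 0" using scal[of k] k by simp
    finally have lead: "coeff D' (k - 1) = 0" .
    have "deg_lt (Suc (k - 1)) D'"
      using D1_deg qd_deg k by (simp add: D'_def deg_lt_diff deg_lt_smult)
    then have D': "deg_lt (k - 1) D'" using lead by (rule deg_lt_SucD)
    \<comment> \<open>\<open>qd {..p}\<close> contains \<open>U * V\<close> with coefficient one,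
      hence the correction \<open>e - c0\<close> in the middle.\<close>
    let ?c = "\<lambda>s. if s < l then coeff H' s else if s = l then e - c0 else coeff D' (s - l - 1)"
    have "E = smult c0 (qd {..p}) + (U * S * H' + smult (e - c0) (U * V) + T * V * D')"
      by (simp add: qd_eq E_eq H'_def D'_def smult_add_right smult_diff_left algebra_simps)
    also have "U * S * H' + smult (e - c0) (U * V) + T * V * D' = (\<Sum>s<p. smult (?c s) (Es s))"
      unfolding sum using poly_eq_sum_monom[OF H'] poly_eq_sum_monom[OF D'] by simp
    finally show "\<exists>c0 c. E = smult c0 (qd {..p}) + (\<Sum>s<p. smult (c s) (Es s))"
      by (intro exI[of _ c0] exI[of _ ?c])
  next
    fix c0 c assume *: "(\<Sum>s<p. smult (c s) (Es s)) = smult c0 (qd {..p})"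
    define H where "H = (\<Sum>s<l. monom (c s) s)"
    define D where "D = (\<Sum>s<k - 1. monom (c (l + (1 + s))) s)"
    have D: "deg_lt (k - 1) D" unfolding D_def by (rule deg_lt_sum_monom)
    have "U * (S * (H - smult c0 (qd ?B)) + smult (c l - c0) V) = T * V * (smult c0 (qd ?A) - D)"
      using *[unfolded sum qd_eq, folded H_def D_def] by (simp add: smult_add_right smult_diff_left algebra_simps)
    moreover have "deg_lt k (smult c0 (qd ?A) - D)"
      using D qd_deg by (intro deg_lt_diff deg_lt_smult) (auto elim: deg_lt_mono)
    ultimately have "S * (H - smult c0 (qd ?B)) + smult (c l - c0) V = 0 \<and> smult c0 (qd ?A) - D = 0"
      unfolding U_def TV[symmetric] using card k by (intro shifted_indep[of ?A "insert k ?B"]) auto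
    then have 0: "S * (H - smult c0 (qd ?B)) + smult (c l - c0) V = 0" "D = smult c0 (qd ?A)" by auto
    have "coeff D (k - 1) = 0" using D by (simp add: deg_lt_def)
    then have "c0 = 0" using 0(2) qd_lead of_nat_neq_0[of k] k by simp
    \<comment> \<open>What is left is a relation between the single shifted node \<open>k\<close>
      and the nodes beyond it, so the independence argument applies once more.\<close>
    then have "D = 0" and SH: "shifted_roots {k} * H = roots_poly y ?B * [:- c l:]"
      using 0 by (simp_all add: S_def V_def shifted_roots_def roots_poly_def add_eq_0_iff)
    have "H = 0 \<and> [:- c l:] = 0"
      by (rule shifted_indep[OF _ _ _ SH]) (use k in \<open>auto simp: deg_lt_iff\<close>)
    then have "H = 0" "c l = 0" by auto
    then show "\<forall>s<p. c s = 0"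
    proof (intro allI impI)
      fix s assume s: "s < p"
      consider "s < l" | "s = l" | "l < s" by linarith
      then show "c s = 0"
      proof cases
        case 1
        then show ?thesis using sum_monom_eq_0D \<open>H = 0\<close> by (simp add: H_def)
      next
        case 2
        then show ?thesis using \<open>c l = 0\<close> by simp
      next
        case 3
        then have "s - l - 1 < k - 1" using s p by simp
        from sum_monom_eq_0D[OF _ this, of "\<lambda>s. c (l + (1 + s))"] show ?thesis
          using \<open>D = 0\<close> 3 by (simp add: D_def)
      qed
    qed
  qed (use k in auto)
qed

end

section \<open>Conditions for all ordered pairs of nodes\<close>

context coords
begin

text \<open>Basis of the cone over the Shi arrangement, after Suyama and Terao.\<close>

definition shi :: "nat \<Rightarrow> nat \<Rightarrow> 'a poly" where
  "shi n s = smult (y s - y (Suc s) - w) (shifted_roots {..<s} * roots_poly y {Suc (Suc s)..n})"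

text \<open>The unshifted roots settle all pairs with \<open>b\<close> at least \<open>s + 2\<close>
  and the shifted roots those with \<open>a < s\<close>. The only pair left is
  \<open>(s, s + 1)\<close>, which explains the scalar factor.\<close>

lemma shi_cond:
  assumes "s < n" "n \<le> p" "a < b" "b \<le> n"
  shows "y a - y b - w dvd poly (shi n s) (y b)"
proof -
  consider "Suc (Suc s) \<le> b" | "a < s" | "a = s" "b = Suc s" using assms(3) by linarith
  then show ?thesis
  proof cases
    case 1
    then have "poly (roots_poly y {Suc (Suc s)..n}) (y b) = 0"
      using assms by (intro roots_poly_at_node) auto
    then show ?thesis by (simp add: shi_def)
  next
    case 2
    then have "y a - y b - w dvd poly (shifted_roots {..<s}) (y b)"
      by (intro dvd_shifted_roots) auto
    then show ?thesis by (simp add: shi_def)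
  next
    case 3
    then show ?thesis by (simp add: shi_def)
  qed
qed

lemma shi_Suc:
  assumes "s < n"
  shows "shi (Suc n) s = [:- y (Suc n), 1:] * shi n s"
proof -
  have "{Suc (Suc s)..Suc n} = insert (Suc n) {Suc (Suc s)..n}" using assms by auto
  then have "roots_poly y {Suc (Suc s)..Suc n} = [:- y (Suc n), 1:] * roots_poly y {Suc (Suc s)..n}"
    by (simp only: roots_poly_insert[of "{Suc (Suc s)..n}" "Suc n"] finite_atLeastAtMost) (simp add: roots_poly_insert)
  then show ?thesis unfolding shi_def by (simp only: mult_smult_right mult.left_commute)
qed

lemma shi_last: "shi (Suc n) n = smult (y n - y (Suc n) - w) (shifted_roots {..<n})"
  by (simp add: shi_def roots_poly_def)

lemma deg_lt_shi:
  assumes "s < n"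
  shows "deg_lt n (shi n s)"
proof -
  have "deg_lt (Suc s) (shifted_roots {..<s})" "deg_lt (Suc (n - Suc s)) (roots_poly y {Suc (Suc s)..n})"
    using deg_lt_shifted_roots[of "{..<s}"] deg_lt_roots_poly[of "{Suc (Suc s)..n}" y] by simp_all
  then have "deg_lt (s + Suc (n - Suc s)) (shifted_roots {..<s} * roots_poly y {Suc (Suc s)..n})"
    by (rule deg_lt_mult)
  then show ?thesis unfolding shi_def using assms by (intro deg_lt_smult) simp
qed

text \<open>At the last node all conditions together make the value of \<open>E\<close> a multiple
  of that of the last basis element, up to sign. Subtracting it leaves a multiple of
  \<open>t - y (Suc n)\<close>, and the cofactor meets the conditions for one node fewer.\<close>

lemma shi_span:
  assumes "n \<le> p" "deg_lt n E" "\<And>a b. a < b \<Longrightarrow> b \<le> n \<Longrightarrow> y a - y b - w dvd poly E (y b)"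
  shows "\<exists>c. E = (\<Sum>s<n. smult (c s) (shi n s))"
  using assms
proof (induction n arbitrary: E)
  case (Suc n)
  let ?x = "y (Suc n)"
  have "poly (shifted_roots {..n}) ?x dvd poly E ?x"
    using Suc.prems by (intro shifted_dvd) auto
  then obtain h where h: "poly E ?x = poly (shifted_roots {..n}) ?x * h" ..
  have set: "{..n} = insert n {..<n}" by auto
  have "poly (shifted_roots {..n}) ?x = - poly (shi (Suc n) n) ?x"
    unfolding shi_last set by (simp add: poly_shifted_roots algebra_simps)
  then have "poly (E + smult h (shi (Suc n) n)) ?x = 0" using h by (simp add: mult.commute)
  then obtain E' where E': "E + smult h (shi (Suc n) n) = [:- ?x, 1:] * E'"
    using poly_eq_0_iff_dvd by (metis dvdE)
  have "deg_lt (Suc n) (E + smult h (shi (Suc n) n))"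
    using Suc.prems(2) deg_lt_shi by (intro deg_lt_add deg_lt_smult) auto
  then have deg: "deg_lt n E'"
    using roots_poly_quotient_deg[of "{Suc n}" n y E'] E' by (simp add: roots_poly_def)
  have "y a - y b - w dvd poly E' (y b)" if ab: "a < b" "b \<le> n" for a b
  proof -
    have "y a - y b - w dvd poly (E + smult h (shi (Suc n) n)) (y b)"
      using Suc.prems(1,3) shi_cond[of n "Suc n" a b] ab by simp
    then have "y a - y b - w dvd (y b - ?x - 0) * poly E' (y b)"
      unfolding E' by (simp add: algebra_simps)
    then show ?thesis
      by (rule coprime[rotated -1]) (use ab Suc.prems(1) w in auto)
  qed
  then obtain c where "E' = (\<Sum>s<n. smult (c s) (shi n s))" using Suc.IH[OF _ deg] Suc.prems(1) by auto
  then have "[:- ?x, 1:] * E' = (\<Sum>s<n. smult (c s) (shi (Suc n) s))"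
    by (simp add: sum_distrib_left shi_Suc del: mult_pCons_left)
  moreover have "E = [:- ?x, 1:] * E' - smult h (shi (Suc n) n)" unfolding E'[symmetric] by simp
  ultimately have "E = (\<Sum>s<Suc n. smult ((c(n := - h)) s) (shi (Suc n) s))" by simp
  then show ?case by blast
qed simp

text \<open>At the last node all basis elements but the last vanish, so the coefficients drop out
  one after the other.\<close>

lemma shi_indep:
  assumes "n \<le> p" "(\<Sum>s<n. smult (c s) (shi n s)) = 0" "s < n"
  shows "c s = 0"
  using assms
proof (induction n arbitrary: s)
  case (Suc n)
  let ?x = "y (Suc n)"
  have sum: "[:- ?x, 1:] * (\<Sum>s<n. smult (c s) (shi n s)) + smult (c n) (shi (Suc n) n) = 0"
    using Suc.prems(2) by (simp add: sum_distrib_left shi_Suc del: mult_pCons_left)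
  have "c n * poly (shi (Suc n) n) ?x = 0"
    using arg_cong[OF sum, of "\<lambda>F. poly F ?x"] by simp
  moreover have "poly (shi (Suc n) n) ?x \<noteq> 0"
  proof -
    have ne: "?x + w - y a \<noteq> 0" if "a < n" for a
    proof -
      have "y a - ?x - w \<noteq> 0" using nonzero[of a "Suc n" w] that Suc.prems(1) by simp
      then show ?thesis by (simp add: algebra_simps)
    qed
    have "y n - ?x - w \<noteq> 0" using nonzero[of n "Suc n" w] Suc.prems(1) by simp
    then show ?thesis using ne by (simp add: shi_last poly_shifted_roots prod_zero_iff)
  qed
  ultimately have n: "c n = 0" by simp
  then have "[:- ?x, 1:] * (\<Sum>s<n. smult (c s) (shi n s)) = 0" using sum by simp
  then have "(\<Sum>s<n. smult (c s) (shi n s)) = 0" by (simp only: mult_eq_0_iff) auto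
  then show ?case using Suc n by (cases "s = n") auto
qed simp

text \<open>All members have degree below \<open>p\<close>, whereas \<open>qd {..p}\<close> has
  degree \<open>p\<close> with leading coefficient \<open>p + 1\<close>; hence no multiple of it
  interferes.\<close>

lemma free_nodes_shi: "free_nodes {(i, j). i < j \<and> j \<le> p}"
proof (rule free_nodesI[where Es = "shi p"])
  fix s assume s: "s < p"
  show "diff_cond {(i, j). i < j \<and> j \<le> p} (shi p s)"
    by (rule diff_condI) (use s shi_cond in auto)
  show "deg_lt (Suc p) (shi p s)" using deg_lt_shi[OF s] by (rule deg_lt_mono) simp
next
  fix E assume "deg_lt p E" "diff_cond {(i, j). i < j \<and> j \<le> p} E"
  then obtain c where "E = (\<Sum>s<p. smult (c s) (shi p s))"
    using shi_span[of p E] diff_condD by auto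
  then have "E = smult 0 (qd {..p}) + (\<Sum>s<p. smult (c s) (shi p s))" by simp
  then show "\<exists>c0 c. E = smult c0 (qd {..p}) + (\<Sum>s<p. smult (c s) (shi p s))" by blast
next
  fix c0 c assume *: "(\<Sum>s<p. smult (c s) (shi p s)) = smult c0 (qd {..p})"
  have "deg_lt p (\<Sum>s<p. smult (c s) (shi p s))"
    by (intro deg_lt_sum deg_lt_smult deg_lt_shi) auto
  then have "c0 * of_nat (Suc p) = 0"
    unfolding * using qd(3)[of "{..p}" p] by (simp add: deg_lt_def del: of_nat_Suc) (metis coeff_smult le_refl)
  then have "c0 = 0" using of_nat_neq_0[of "Suc p"] by (metis mult_eq_0_iff zero_less_Suc)
  then show "\<forall>s<p. c s = 0" using shi_indep[of p c] * by simp
qed auto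

end

section \<open>Arrangements in node coordinates\<close>

lemma to_ordered_simps:
  "to_ordered (p + q) = to_ordered p + to_ordered q" "to_ordered (p - q) = to_ordered p - to_ordered q"
  "to_ordered (p * q) = to_ordered p * to_ordered q" "to_ordered 0 = 0" "to_ordered 1 = 1"
  "to_ordered (\<Sum>i\<in>I. f i) = (\<Sum>i\<in>I. to_ordered (f i))" "to_ordered (Const a) = Const a"
  by (simp_all add: to_ordered_def peval_hom[OF rat_hom_Const])

text \<open>The last vertex is reserved for \<open>w\<close>: a nonzero coefficient there makes the
  partial sums \<open>y 1\<close>, ..., \<open>y p\<close> and \<open>w\<close> a coordinate system.
  The form \<open>w\<close> is left open because the families with an extra vertex and the cycles
  need different ones.\<close>

locale node_coordinates =
  fixes \<sigma> :: "nat \<Rightarrow> 'v::finite" and p :: nat and wv :: "rat ^ 'v"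
  assumes bij: "bij_betw \<sigma> {1..Suc p} UNIV" and wv: "wv $ \<sigma> (Suc p) \<noteq> 0"
begin

definition yv :: "nat \<Rightarrow> rat ^ 'v" where
  "yv j = ind (\<sigma> ` {1..j})"

lemma \<sigma>_inj: "i \<in> {1..Suc p} \<Longrightarrow> j \<in> {1..Suc p} \<Longrightarrow> \<sigma> i = \<sigma> j \<longleftrightarrow> i = j"
  using bij by (auto simp: bij_betw_def inj_on_eq_iff)

lemma sum_UNIV: "(\<Sum>v\<in>UNIV. f v) = (\<Sum>i=1..Suc p. f (\<sigma> i))"
  by (rule sum.reindex_bij_betw[OF bij, symmetric])

lemma yv_nth: "j \<le> p \<Longrightarrow> i \<in> {1..Suc p} \<Longrightarrow> yv j $ \<sigma> i = (if i \<le> j then 1 else 0)"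
  using \<sigma>_inj by (auto simp: yv_def)

lemma yv_0 [simp]: "yv 0 = 0"
  by (simp add: yv_def)

lemma yv_Suc: "j < p \<Longrightarrow> yv (Suc j) = yv j + ind {\<sigma> (Suc j)}"
proof -
  assume j: "j < p"
  have "\<sigma> (Suc j) \<notin> \<sigma> ` {1..j}"
  proof
    assume "\<sigma> (Suc j) \<in> \<sigma> ` {1..j}"
    then obtain i where "i \<in> {1..j}" "\<sigma> (Suc j) = \<sigma> i" by auto
    then show False using \<sigma>_inj[of "Suc j" i] j by auto
  qed
  then show "yv (Suc j) = yv j + ind {\<sigma> (Suc j)}"
    by (auto simp: yv_def vec_eq_iff atLeastAtMostSuc_conv)
qed

lemma dot_ind_singleton: "dot (ind {v}) x = x $ v"
  by (simp add: dot_def if_distrib[of "\<lambda>z. z * _"] cong: if_cong)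

text \<open>Increments of \<open>t\<close> are used as coordinates, and the last coordinate then
  adjusts the value of \<open>w\<close>. Such points certify that two forms are not
  proportional.\<close>

lemma point_exists: "\<exists>x. (\<forall>i\<le>p. \<forall>j\<le>p. dot (yv i - yv j) x = t i - t j) \<and> dot wv x = \<omega>"
proof -
  let ?e = "\<sigma> (Suc p)"
  define x0 where "x0 = (\<chi> v. let i = the_inv_into {1..Suc p} \<sigma> v in if i \<le> p then t i - t (i - 1) else (0 :: rat))"
  have inv: "the_inv_into {1..Suc p} \<sigma> (\<sigma> i) = i" if "i \<in> {1..Suc p}" for i
    using bij that by (auto simp: bij_betw_def intro: the_inv_into_f_f)
  define x where "x = x0 + ((\<omega> - dot wv x0) / wv $ ?e) *s axis ?e 1"
  have yx: "dot (yv j) x = dot (yv j) x0" if "j \<le> p" for j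
    using yv_nth[of j "Suc p"] that by (simp add: x_def dot_axis)
  have "dot (yv j) x0 = t j - t 0" if "j \<le> p" for j
    using that
  proof (induction j)
    case (Suc j)
    then have "x0 $ \<sigma> (Suc j) = t (Suc j) - t j" using inv[of "Suc j"] by (simp add: x0_def)
    then show ?case using Suc by (simp add: yv_Suc dot_ind_singleton)
  qed simp
  then have "dot (yv i - yv j) x = t i - t j" if "i \<le> p" "j \<le> p" for i j
    using that yx by simp
  moreover have "dot wv x = \<omega>" using wv by (simp add: x_def dot_axis)
  ultimately show ?thesis by blast
qed

definition y :: "nat \<Rightarrow> 'v qpoly" where "y i = linear_form (yv i)"
definition w :: "'v qpoly" where "w = linear_form wv"

lemma y_0 [simp]: "y 0 = 0"
  by (simp add: y_def)

lemma form_coprime: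
  assumes idx: "i \<le> p" "k \<le> p" "j \<le> p" "l \<le> p" "i \<noteq> k" "j \<noteq> l"
    and ne: "{i, k} \<noteq> {j, l} \<or> \<delta> \<noteq> \<delta>'" and \<delta>: "\<delta> \<in> {0, 1}" "\<delta>' \<in> {0, 1}"
    and dvd: "linear_form (yv i - yv k - \<delta> *s wv) dvd linear_form (yv j - yv l - \<delta>' *s wv) * f"
  shows "linear_form (yv i - yv k - \<delta> *s wv) dvd f"
proof -
  have "\<exists>t \<omega>. t i - t k - \<delta> * \<omega> = 0 \<and> t j - t l - \<delta>' * \<omega> \<noteq> (0 :: rat)"
  proof (cases "{i, k} = {j, l}")
    case False
    \<comment> \<open>Raising a node that occurs only in the second form separates the two.\<close>
    then obtain m where m: "m = j \<or> m = l" "m \<noteq> i" "m \<noteq> k" using idx by auto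
    then show ?thesis
      using idx by (intro exI[of _ "\<lambda>n. if n = m then 1 else 0"] exI[of _ 0]) auto
  next
    case True
    \<comment> \<open>On the same pair of nodes the forms differ in \<open>\<delta>\<close>. With
      \<open>\<omega> = 1\<close> and node \<open>i\<close> raised by \<open>\<delta>\<close> the
      first vanishes; the second takes the value \<open>\<delta> - \<delta>'\<close> or, for the
      reversed pair, \<open>- \<delta> - \<delta>'\<close>.\<close>
    then show ?thesis using ne \<delta> idx
      by (intro exI[of _ "\<lambda>n. if n = i then \<delta> else 0"] exI[of _ 1]) (auto simp: doubleton_eq_iff)
  qed
  then obtain t \<omega> where t: "t i - t k - \<delta> * \<omega> = 0" "t j - t l - \<delta>' * \<omega> \<noteq> (0 :: rat)" by blast
  obtain x where x: "\<forall>i\<le>p. \<forall>j\<le>p. dot (yv i - yv j) x = t i - t j" "dot wv x = \<omega>"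
    using point_exists by blast
  obtain x' where x': "\<forall>a\<le>p. \<forall>b\<le>p. dot (yv a - yv b) x' = (if a = i then 1 else 0) - (if b = i then 1 else 0)" "dot wv x' = 0"
    using point_exists[of "\<lambda>a. if a = i then 1 else 0" 0] by blast
  have dots: "dot (yv a - yv b - d *s wv) x = t a - t b - d * \<omega>" if "a \<le> p" "b \<le> p" for a b d
    using x that by simp
  have "yv i - yv k - \<delta> *s wv \<noteq> 0"
  proof
    assume "yv i - yv k - \<delta> *s wv = 0"
    then have "dot (yv i - yv k - \<delta> *s wv) x' = 0" by (metis dot_simps(5))
    then show False using x'(1)[rule_format, of i k] x'(2) idx by simp
  qed
  from dvd this show ?thesis
    by (rule linear_form_coprime[where x = x]) (use t idx in \<open>simp_all only: dots not_False_eq_True\<close>)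
qed

lemma form_coprime_w:
  assumes idx: "i \<le> p" "k \<le> p" "i \<noteq> k" and dvd: "linear_form (yv i - yv k - wv) dvd linear_form wv * f"
  shows "linear_form (yv i - yv k - wv) dvd f"
proof -
  obtain x where x: "\<forall>a\<le>p. \<forall>b\<le>p. dot (yv a - yv b) x = (if a = i then 1 else 0) - (if b = i then 1 else 0)" "dot wv x = 1"
    using point_exists[of "\<lambda>a. if a = i then 1 else 0" 1] by blast
  obtain x' where x': "\<forall>a\<le>p. \<forall>b\<le>p. dot (yv a - yv b) x' = (if a = i then 1 else 0) - (if b = i then 1 else 0)" "dot wv x' = 0"
    using point_exists[of "\<lambda>a. if a = i then 1 else 0" 0] by blast
  have "yv i - yv k - wv \<noteq> 0"
  proof
    assume "yv i - yv k - wv = 0"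
    then have "dot (yv i - yv k - wv) x' = 0" by (metis dot_simps(5))
    then show False using x'(1)[rule_format, of i k] x'(2) idx by simp
  qed
  moreover have "dot (yv i - yv k - wv) x = 0" using x(1)[rule_format, of i k] x(2) idx by simp
  moreover have "dot wv x \<noteq> 0" using x(2) by simp
  ultimately show ?thesis
    using linear_form_coprime[OF dvd] by blast
qed

lemma form_nonzero:
  assumes "i \<le> p" "k \<le> p" "i \<noteq> k"
  shows "linear_form (yv i - yv k - \<delta> *s wv) \<noteq> 0"
proof -
  obtain x where x: "\<forall>a\<le>p. \<forall>b\<le>p. dot (yv a - yv b) x = (if a = i then 1 else 0) - (if b = i then 1 else 0)" "dot wv x = 0"
    using point_exists[of "\<lambda>a. if a = i then 1 else 0" 0] by blast
  have "dot (yv i - yv k - \<delta> *s wv) x \<noteq> 0" using x(1)[rule_format, of i k] x(2) assms by simp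
  then show ?thesis by (rule linear_form_nonzero)
qed

lemma w_nonzero: "w \<noteq> 0"
  unfolding w_def using wv by (intro linear_form_neq_0) auto

text \<open>The abstract setting asks for a type that is an integral domain, so the forms are
  carried to the ordered copy of the ring.\<close>

sublocale nodes: coords "\<lambda>n. to_ordered (Const (1 / of_nat n))" "\<lambda>i. to_ordered (y i)" "to_ordered w" p
proof
  have Const_of_nat: "of_nat n = (Const (of_nat n) :: 'v qpoly)" for n
    by (induction n) (simp_all add: Const_add)
  show "of_nat n * to_ordered (Const (1 / of_nat n)) = (1 :: 'v ordered qpoly)" if "0 < n" for n
  proof -
    have "of_nat n = to_ordered (of_nat n :: 'v qpoly)" by (induction n) (simp_all add: to_ordered_simps)
    then have "of_nat n * to_ordered (Const (1 / of_nat n)) = to_ordered (Const (of_nat n) * Const (1 / of_nat n) :: 'v qpoly)"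
      by (simp only: to_ordered_simps Const_of_nat)
    also have "Const (of_nat n) * Const (1 / of_nat n) = (1 :: 'v qpoly)"
      using that by (simp flip: Const_mult)
    finally show ?thesis by (simp add: to_ordered_simps)
  qed
  show "to_ordered w \<noteq> 0" using w_nonzero to_ordered_eq_iff[of w 0] by (simp add: to_ordered_simps)
  have form: "to_ordered (y i) - to_ordered (y k) - to_ordered (Const \<delta> * w) = to_ordered (linear_form (yv i - yv k - \<delta> *s wv))" for i k \<delta>
    by (simp add: y_def w_def linear_form_diff linear_form_scale to_ordered_simps)
  have e_cases: "\<exists>\<delta>\<in>{0, 1}. e = to_ordered (Const \<delta> * w)" if "e \<in> {0, to_ordered w}" for e
    using that by (auto simp: to_ordered_simps)
  {
    fix i k j l e e' f
    assume *: "i \<le> p" "k \<le> p" "j \<le> p" "l \<le> p" "i \<noteq> k" "j \<noteq> l" "{i, k} \<noteq> {j, l} \<or> e \<noteq> e'"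
      "e \<in> {0, to_ordered w}" "e' \<in> {0, to_ordered w}"
      "to_ordered (y i) - to_ordered (y k) - e dvd (to_ordered (y j) - to_ordered (y l) - e') * f"
    obtain \<delta> \<delta>' where d: "\<delta> \<in> {0, 1}" "e = to_ordered (Const \<delta> * w)" "\<delta>' \<in> {0, 1}" "e' = to_ordered (Const \<delta>' * w)"
      using e_cases *(8,9) by blast
    have "to_ordered (linear_form (yv i - yv k - \<delta> *s wv)) dvd
        to_ordered (linear_form (yv j - yv l - \<delta>' *s wv) * from_ordered f)"
      using *(10) unfolding d form by (simp add: to_ordered_simps)
    then have dvd: "linear_form (yv i - yv k - \<delta> *s wv) dvd linear_form (yv j - yv l - \<delta>' *s wv) * from_ordered f"
      by (simp only: to_ordered_dvd_iff)
    have "{i, k} \<noteq> {j, l} \<or> \<delta> \<noteq> \<delta>'" using *(7) d(2,4) by blast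
    then have "linear_form (yv i - yv k - \<delta> *s wv) dvd from_ordered f"
      by (rule form_coprime[OF *(1-6) _ d(1,3) dvd])
    then show "to_ordered (y i) - to_ordered (y k) - e dvd f"
      unfolding d form by (metis to_ordered_dvd_iff to_from_ordered)
  }
  {
    fix i k f assume *: "i \<le> p" "k \<le> p" "i \<noteq> k" "to_ordered (y i) - to_ordered (y k) - to_ordered w dvd to_ordered w * f"
    have eq: "to_ordered (y i) - to_ordered (y k) - to_ordered w = to_ordered (linear_form (yv i - yv k - wv))"
      using form[of i k 1] by (simp add: to_ordered_simps)
    have "to_ordered (linear_form (yv i - yv k - wv)) dvd to_ordered (linear_form wv * from_ordered f)"
      using *(4) unfolding eq unfolding w_def to_ordered_simps(3) to_from_ordered .
    then have "linear_form (yv i - yv k - wv) dvd linear_form wv * from_ordered f"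
      by (simp only: to_ordered_dvd_iff)
    then have "linear_form (yv i - yv k - wv) dvd from_ordered f" by (rule form_coprime_w[OF *(1-3)])
    then show "to_ordered (y i) - to_ordered (y k) - to_ordered w dvd f"
      unfolding eq by (metis to_ordered_dvd_iff to_from_ordered)
  }
  fix i k e assume *: "i \<le> p" "k \<le> p" "i \<noteq> k" "e \<in> {0, to_ordered w}"
  then obtain \<delta> where "e = to_ordered (Const \<delta> * w)" using e_cases by blast
  then show "to_ordered (y i) - to_ordered (y k) - e \<noteq> 0"
    using form form_nonzero[OF *(1-3)] to_ordered_eq_iff[of _ 0] by (metis to_ordered_simps(4))
qed

end

section \<open>From values at the nodes to derivations\<close>

lemma derivation_0: "\<theta> \<in> derivations \<Longrightarrow> \<theta> 0 = 0"
  using derivation_Const[of \<theta> 0] by simp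

lemma derivation_minus: "\<theta> \<in> derivations \<Longrightarrow> \<theta> (- a) = - \<theta> a"
  using derivationsD(1)[of \<theta> a "- a"] by (simp add: derivation_0 add_eq_0_iff)

lemma derivation_diff: "\<theta> \<in> derivations \<Longrightarrow> \<theta> (a - b) = \<theta> a - \<theta> b"
  using derivationsD(1)[of \<theta> a "- b"] by (simp add: derivation_minus)

lemma linear_form_singleton: "linear_form (ind {v}) = Var v"
  by (simp add: linear_form_ind)

lemma sum_fun_apply: "(\<Sum>s\<in>S. f s) q = (\<Sum>s\<in>S. f s q)" for f :: "'i \<Rightarrow> 'a \<Rightarrow> 'b::comm_monoid_add"
  by (induction S rule: infinite_finite_induct) simp_all

context node_coordinates
begin

definition node_values :: "(nat \<times> nat) set \<Rightarrow> (nat \<Rightarrow> 'v qpoly) \<Rightarrow> bool" where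
  "node_values R g \<longleftrightarrow> (\<forall>i\<le>p. \<forall>j\<le>p. y j - y i dvd g j - g i) \<and> (\<forall>(a, b)\<in>R. y a - y b - w dvd g a - g b)"

lemma node_cond_iff: "nodes.node_cond R (\<lambda>i. to_ordered (g i)) \<longleftrightarrow> node_values R g"
  unfolding nodes.node_cond_def node_values_def by (simp flip: to_ordered_simps(2))

lemma node_values_basis:
  assumes "nodes.free_nodes R"
  obtains G where "\<forall>s<p. node_values R (G s)"
    and "\<forall>g. node_values R g \<longrightarrow> (\<exists>c0 c. \<forall>i\<le>p. g i = c0 + (\<Sum>s<p. c s * G s i))"
    and "\<forall>c0 c. (\<forall>i\<le>p. c0 + (\<Sum>s<p. c s * G s i) = 0) \<longrightarrow> (\<forall>s<p. c s = 0)"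
proof -
  obtain G' where G': "\<forall>s<p. nodes.node_cond R (G' s)"
    "\<forall>g. nodes.node_cond R g \<longrightarrow> (\<exists>c0 c. \<forall>i\<le>p. g i = c0 + (\<Sum>s<p. c s * G' s i))"
    "\<forall>c0 c. (\<forall>i\<le>p. c0 + (\<Sum>s<p. c s * G' s i) = 0) \<longrightarrow> (\<forall>s<p. c s = 0)"
    using assms unfolding nodes.free_nodes_def by blast
  define G where "G s i = from_ordered (G' s i)" for s i
  have G: "G' s i = to_ordered (G s i)" for s i by (simp add: G_def)
  have comb: "to_ordered (c0 + (\<Sum>s<p. c s * G s i)) = to_ordered c0 + (\<Sum>s<p. to_ordered (c s) * G' s i)" for c0 c i
    by (simp add: to_ordered_simps G)
  show thesis
  proof (rule that[of G])
    show "\<forall>s<p. node_values R (G s)"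
      using G'(1) unfolding node_cond_iff[symmetric] G[symmetric] by simp
    show "\<forall>g. node_values R g \<longrightarrow> (\<exists>c0 c. \<forall>i\<le>p. g i = c0 + (\<Sum>s<p. c s * G s i))"
    proof (intro allI impI)
      fix g assume "node_values R g"
      then obtain c0 c where c: "\<forall>i\<le>p. to_ordered (g i) = c0 + (\<Sum>s<p. c s * G' s i)"
        using G'(2)[rule_format, of "\<lambda>i. to_ordered (g i)"] unfolding node_cond_iff by blast
      have "g i = from_ordered c0 + (\<Sum>s<p. from_ordered (c s) * G s i)" if "i \<le> p" for i
      proof -
        have "to_ordered (g i) = to_ordered (from_ordered c0 + (\<Sum>s<p. from_ordered (c s) * G s i))"
          unfolding comb using c that by simp
        then show ?thesis by (simp only: to_ordered_eq_iff)
      qed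
      then show "\<exists>c0 c. \<forall>i\<le>p. g i = c0 + (\<Sum>s<p. c s * G s i)"
        by (intro exI[of _ "from_ordered c0"] exI[of _ "\<lambda>s. from_ordered (c s)"]) simp
    qed
    show "\<forall>c0 c. (\<forall>i\<le>p. c0 + (\<Sum>s<p. c s * G s i) = 0) \<longrightarrow> (\<forall>s<p. c s = 0)"
    proof (intro allI impI)
      fix c0 c s assume *: "\<forall>i\<le>p. c0 + (\<Sum>s<p. c s * G s i) = 0" and s: "s < p"
      have "to_ordered c0 + (\<Sum>s<p. to_ordered (c s) * G' s i) = 0" if "i \<le> p" for i
        unfolding comb[symmetric] using * that by (simp add: to_ordered_simps(4))
      then have "to_ordered (c s) = 0"
        using G'(3)[rule_format, of "to_ordered c0" "\<lambda>s. to_ordered (c s)" s] s by blast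
      then show "c s = 0" by (metis to_ordered_eq_iff to_ordered_simps(4))
    qed
  qed
qed

lemma Var_eq: "1 \<le> i \<Longrightarrow> i \<le> p \<Longrightarrow> Var (\<sigma> i) = y i - y (i - 1)"
  using yv_Suc[of "i - 1"] by (simp add: y_def flip: linear_form_diff linear_form_singleton)

lemma derivation_w:
  assumes "\<theta> \<in> derivations"
  shows "\<theta> w = (\<Sum>i=1..p. Const (wv $ \<sigma> i) * \<theta> (Var (\<sigma> i))) + Const (wv $ \<sigma> (Suc p)) * \<theta> (Var (\<sigma> (Suc p)))"
  unfolding w_def derivation_linear_form[OF assms] sum_UNIV by simp

lemma derivation_node_eqI:
  assumes d: "\<theta> \<in> derivations" "\<theta>' \<in> derivations" and eq: "\<And>i. i \<le> p \<Longrightarrow> \<theta> (y i) = \<theta>' (y i)" "\<theta> w = \<theta>' w"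
  shows "\<theta> = \<theta>'"
proof (rule derivation_eqI[OF d])
  fix v
  have "v \<in> \<sigma> ` {1..Suc p}" using bij by (simp add: bij_betw_def)
  then obtain i where i: "i \<in> {1..Suc p}" "v = \<sigma> i" by blast
  have 1: "\<theta> (Var (\<sigma> i)) = \<theta>' (Var (\<sigma> i))" if "1 \<le> i" "i \<le> p" for i
    using that eq(1) by (simp add: Var_eq derivation_diff[OF d(1)] derivation_diff[OF d(2)])
  show "\<theta> (Var v) = \<theta>' (Var v)"
  proof (cases "i \<le> p")
    case True
    then show ?thesis using 1 i by simp
  next
    case False
    then have "i = Suc p" using i by simp
    have "(\<Sum>i=1..p. Const (wv $ \<sigma> i) * \<theta> (Var (\<sigma> i))) = (\<Sum>i=1..p. Const (wv $ \<sigma> i) * \<theta>' (Var (\<sigma> i)))"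
      using 1 by (intro sum.cong) auto
    then have "Const (wv $ \<sigma> (Suc p)) * \<theta> (Var (\<sigma> (Suc p))) = Const (wv $ \<sigma> (Suc p)) * \<theta>' (Var (\<sigma> (Suc p)))"
      using eq(2) unfolding derivation_w[OF d(1)] derivation_w[OF d(2)] by simp
    moreover have "Const (wv $ \<sigma> (Suc p)) \<noteq> (0 :: 'v qpoly)"
      using wv by (metis Const_def lookup_single_eq lookup_zero)
    ultimately show ?thesis by (simp add: qpoly_mult_left_cancel \<open>i = Suc p\<close> i(2))
  qed
qed

lemma derivation_exists: "\<exists>\<theta>\<in>derivations. (\<forall>i\<le>p. \<theta> (y i) = g i - g 0) \<and> \<theta> w = 0"
proof -
  define f0 where "f0 v = (let i = the_inv_into {1..Suc p} \<sigma> v in g i - g (i - 1))" for v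
  \<comment> \<open>The value on the last variable is solved from the requirement that the
    derivation vanish on \<open>w\<close>.\<close>
  define f where "f v = (if v = \<sigma> (Suc p) then Const (- 1 / wv $ \<sigma> (Suc p)) * (\<Sum>i=1..p. Const (wv $ \<sigma> i) * f0 (\<sigma> i)) else f0 v)" for v
  have f: "f (\<sigma> i) = f0 (\<sigma> i)" "f0 (\<sigma> i) = g i - g (i - 1)" if "i \<in> {1..p}" for i
    using that \<sigma>_inj[of i "Suc p"] bij
    by (auto simp: f_def f0_def bij_betw_def the_inv_into_f_f)
  let ?\<theta> = "der_with f"
  have y: "?\<theta> (y j) = g j - g 0" if "j \<le> p" for j
    using that
  proof (induction j)
    case 0
    then show ?case by (simp add: derivation_0[OF der_with_derivation])
  next
    case (Suc j)
    then have "y (Suc j) = y j + Var (\<sigma> (Suc j))" using Var_eq[of "Suc j"] by simp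
    then show ?case using Suc f[of "Suc j"] by (simp add: derivationsD(1)[OF der_with_derivation])
  qed
  have "Const (wv $ \<sigma> (Suc p)) * f (\<sigma> (Suc p)) = (Const (wv $ \<sigma> (Suc p)) * Const (- 1 / wv $ \<sigma> (Suc p))) * (\<Sum>i=1..p. Const (wv $ \<sigma> i) * f0 (\<sigma> i))"
    by (simp add: f_def mult.assoc)
  also have "Const (wv $ \<sigma> (Suc p)) * Const (- 1 / wv $ \<sigma> (Suc p)) = (- 1 :: 'v qpoly)"
    using wv by (simp add: Const_minus flip: Const_mult)
  finally have e: "Const (wv $ \<sigma> (Suc p)) * f (\<sigma> (Suc p)) = - (\<Sum>i=1..p. Const (wv $ \<sigma> i) * f0 (\<sigma> i))" by simp
  have "?\<theta> w = (\<Sum>i=1..p. Const (wv $ \<sigma> i) * f (\<sigma> i)) + Const (wv $ \<sigma> (Suc p)) * f (\<sigma> (Suc p))"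
    using derivation_w[OF der_with_derivation, of f] by simp
  also have "(\<Sum>i=1..p. Const (wv $ \<sigma> i) * f (\<sigma> i)) = (\<Sum>i=1..p. Const (wv $ \<sigma> i) * f0 (\<sigma> i))"
    using f by (intro sum.cong) auto
  finally have "?\<theta> w = 0" using e by simp
  then show ?thesis using y der_with_derivation by blast
qed

definition node_forms :: "(nat \<times> nat) set \<Rightarrow> (rat ^ 'v) set" where
  "node_forms R = {yv j - yv i | i j. i < j \<and> j \<le> p} \<union> {wv} \<union> {yv a - yv b - wv | a b. (a, b) \<in> R}"

text \<open>A derivation sends \<open>w\<close> to a multiple of \<open>w\<close>; subtracting that
  multiple of the Euler derivation leaves one that vanishes on \<open>w\<close> and is determined by
  its values at the nodes. A basis thus consists of the lifted node systems and the Euler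
  derivation.\<close>

theorem multi_free_node_forms:
  assumes F: "{} \<notin> \<F>" and R: "R \<subseteq> {..p} \<times> {..p}" and free: "nodes.free_nodes R"
    and forms: "\<And>I. I \<in> \<F> \<Longrightarrow> ind I \<in> node_forms R \<or> - ind I \<in> node_forms R"
      "\<And>c. c \<in> node_forms R \<Longrightarrow> \<exists>I\<in>\<F>. c = ind I \<or> c = - ind I"
  shows "multi_free (subset_arrangement \<F>) (\<lambda>_. 1)"
proof -
  define M where "M = multi_derivations (subset_arrangement \<F>) (\<lambda>_. 1)"
  have neg: "linear_form (- c) dvd \<theta> (linear_form (- c)) \<longleftrightarrow> linear_form c dvd \<theta> (linear_form c)"
    if "\<theta> \<in> derivations" for \<theta> c
    by (simp add: linear_form_minus derivation_minus[OF that])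
  have M_forms: "\<theta> \<in> M \<longleftrightarrow> \<theta> \<in> derivations \<and> (\<forall>c\<in>node_forms R. linear_form c dvd \<theta> (linear_form c))" for \<theta>
  proof -
    have "(\<forall>I\<in>\<F>. linear_form (ind I) dvd \<theta> (linear_form (ind I))) \<longleftrightarrow> (\<forall>c\<in>node_forms R. linear_form c dvd \<theta> (linear_form c))"
      if \<theta>: "\<theta> \<in> derivations"
      using forms neg[OF \<theta>] by metis
    then show ?thesis
      unfolding M_def multi_derivations_subset_arrangement[OF F] by auto
  qed
  have M_iff: "\<theta> \<in> M \<longleftrightarrow> \<theta> \<in> derivations \<and> w dvd \<theta> w \<and> (\<forall>i\<le>p. \<forall>j\<le>p. y j - y i dvd \<theta> (y j) - \<theta> (y i)) \<and>
      (\<forall>(a, b)\<in>R. y a - y b - w dvd \<theta> (y a) - \<theta> (y b) - \<theta> w)" for \<theta>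
  proof (cases "\<theta> \<in> derivations")
    case True
    note diff = derivation_diff[OF True]
    have sym: "y j - y i dvd \<theta> (y j) - \<theta> (y i) \<longleftrightarrow> y i - y j dvd \<theta> (y i) - \<theta> (y j)" for i j
      by (metis minus_diff_eq minus_dvd_iff dvd_minus_iff)
    have 1: "(\<forall>c\<in>{yv j - yv i | i j. i < j \<and> j \<le> p}. linear_form c dvd \<theta> (linear_form c)) \<longleftrightarrow>
        (\<forall>i j. i < j \<longrightarrow> j \<le> p \<longrightarrow> y j - y i dvd \<theta> (y j) - \<theta> (y i))"
    proof -
      have "(\<forall>c\<in>{yv j - yv i | i j. i < j \<and> j \<le> p}. linear_form c dvd \<theta> (linear_form c)) \<longleftrightarrow>
          (\<forall>i j. i < j \<longrightarrow> j \<le> p \<longrightarrow> linear_form (yv j - yv i) dvd \<theta> (linear_form (yv j - yv i)))"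
        by blast
      then show ?thesis by (simp only: y_def linear_form_diff diff)
    qed
    have 2: "(\<forall>i j. i < j \<longrightarrow> j \<le> p \<longrightarrow> y j - y i dvd \<theta> (y j) - \<theta> (y i)) \<longleftrightarrow>
        (\<forall>i\<le>p. \<forall>j\<le>p. y j - y i dvd \<theta> (y j) - \<theta> (y i))"
    proof (intro iffI allI impI)
      fix i j assume *: "\<forall>i j. i < j \<longrightarrow> j \<le> p \<longrightarrow> y j - y i dvd \<theta> (y j) - \<theta> (y i)" "i \<le> p" "j \<le> p"
      show "y j - y i dvd \<theta> (y j) - \<theta> (y i)"
        using * sym[of i j] by (cases i j rule: linorder_cases) auto
    qed auto
    have 3: "(\<forall>c\<in>{yv a - yv b - wv | a b. (a, b) \<in> R}. linear_form c dvd \<theta> (linear_form c)) \<longleftrightarrow>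
        (\<forall>(a, b)\<in>R. y a - y b - w dvd \<theta> (y a) - \<theta> (y b) - \<theta> w)"
    proof -
      have "(\<forall>c\<in>{yv a - yv b - wv | a b. (a, b) \<in> R}. linear_form c dvd \<theta> (linear_form c)) \<longleftrightarrow>
          (\<forall>(a, b)\<in>R. linear_form (yv a - yv b - wv) dvd \<theta> (linear_form (yv a - yv b - wv)))"
        by blast
      then show ?thesis by (simp only: y_def w_def linear_form_diff diff)
    qed
    show ?thesis
      unfolding M_forms node_forms_def ball_Un 1 2 3 using True by (auto simp: w_def)
  qed (simp add: M_forms)
  have "der.subspace M" unfolding M_def by (rule multi_derivations_subspace)
  obtain G where G: "\<forall>s<p. node_values R (G s)"
    "\<forall>g. node_values R g \<longrightarrow> (\<exists>c0 c. \<forall>i\<le>p. g i = c0 + (\<Sum>s<p. c s * G s i))"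
    "\<forall>c0 c. (\<forall>i\<le>p. c0 + (\<Sum>s<p. c s * G s i) = 0) \<longrightarrow> (\<forall>s<p. c s = 0)"
    by (rule node_values_basis[OF free]) (rule that)
  have "\<exists>b. \<forall>s. b s \<in> derivations \<and> (\<forall>i\<le>p. b s (y i) = G s i - G s 0) \<and> b s w = 0"
    by (rule choice) (use derivation_exists in blast)
  then obtain b where b: "\<And>s. b s \<in> derivations" "\<And>s i. i \<le> p \<Longrightarrow> b s (y i) = G s i - G s 0" "\<And>s. b s w = 0"
    by blast
  define euler where "euler = der_with (Var :: 'v \<Rightarrow> 'v qpoly)"
  have euler: "euler \<in> derivations" "euler (linear_form c) = linear_form c" for c
  proof -
    show d: "euler \<in> derivations" by (simp add: euler_def der_with_derivation)
    show "euler (linear_form c) = linear_form c"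
      unfolding derivation_linear_form[OF d] by (simp add: euler_def linear_form_def)
  qed
  have euler_yw: "euler (y i) = y i" "euler w = w" for i
    by (simp_all add: y_def w_def euler)
  define bs where "bs s = (if s < p then b s else euler)" for s
  have sum_at: "(\<Sum>s\<in>{..<Suc p}. der_scale (c s) (bs s)) q = (\<Sum>s<p. c s * b s q) + c p * euler q" for c q
    by (simp add: sum_fun_apply der_scale_def bs_def)
  show ?thesis
    unfolding multi_free_def M_def[symmetric]
  proof (rule free_submoduleI[of "{..<Suc p}" M bs])
    show "bs s \<in> M" if "s \<in> {..<Suc p}" for s
    proof (cases "s < p")
      case True
      then have Gs: "node_values R (G s)" and bs: "bs s = b s" using G(1) by (simp_all add: bs_def)
      have diff: "b s (y j) - b s (y i) = G s j - G s i" if "i \<le> p" "j \<le> p" for i j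
        using b(2) that by simp
      show ?thesis
        unfolding M_iff bs
      proof (intro conjI allI impI ballI)
        show "y j - y i dvd b s (y j) - b s (y i)" if "i \<le> p" "j \<le> p" for i j
          unfolding diff[OF that] using Gs that by (simp add: node_values_def)
        fix ab assume ab: "ab \<in> R"
        obtain a c where ab_eq: "ab = (a, c)" by (cases ab)
        have "a \<le> p" "c \<le> p" using R ab ab_eq by auto
        moreover have "y a - y c - w dvd G s a - G s c" using Gs ab ab_eq by (auto simp: node_values_def)
        ultimately show "case ab of (a, c) \<Rightarrow> y a - y c - w dvd b s (y a) - b s (y c) - b s w"
          by (simp add: ab_eq diff b(3))
      qed (simp_all add: b)
    next
      case False
      then show ?thesis by (simp add: bs_def M_forms euler)
    qed
    show "\<exists>c. \<theta> = (\<Sum>s\<in>{..<Suc p}. der_scale (c s) (bs s))" if \<theta>: "\<theta> \<in> M" for \<theta>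
    proof -
      have d: "\<theta> \<in> derivations" using \<theta> M_iff by simp
      obtain h where h: "\<theta> w = w * h" using \<theta> M_iff by (auto simp: dvd_def)
      define g where "g i = \<theta> (y i) - h * y i" for i
      have "node_values R g"
        unfolding node_values_def
      proof (intro conjI allI impI ballI)
        fix i j assume ij: "i \<le> p" "j \<le> p"
        have "y j - y i dvd (\<theta> (y j) - \<theta> (y i)) - h * (y j - y i)"
          by (rule dvd_diff) (use \<theta> ij in \<open>auto simp: M_iff\<close>)
        then show "y j - y i dvd g j - g i" by (simp add: g_def algebra_simps)
      next
        fix ab assume ab: "ab \<in> R"
        obtain a b where ab_eq: "ab = (a, b)" by (cases ab)
        have "y a - y b - w dvd (\<theta> (y a) - \<theta> (y b) - \<theta> w) - h * (y a - y b - w)"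
          by (rule dvd_diff) (use \<theta> ab ab_eq in \<open>auto simp: M_iff\<close>)
        then show "case ab of (a, b) \<Rightarrow> y a - y b - w dvd g a - g b"
          by (simp add: ab_eq g_def h algebra_simps)
      qed
      then obtain c0 c where c: "\<forall>i\<le>p. g i = c0 + (\<Sum>s<p. c s * G s i)" using G(2) by blast
      \<comment> \<open>\<open>y 0\<close> is zero, which fixes the common summand: the derivations
        \<open>b s\<close> take the values \<open>G s i - G s 0\<close>.\<close>
      have g0: "g 0 = 0" by (simp add: g_def derivation_0[OF d])
      let ?c = "c(p := h)"
      have "\<theta> = (\<Sum>s\<in>{..<Suc p}. der_scale (?c s) (bs s))"
      proof (rule derivation_node_eqI[OF d])
        show "(\<Sum>s\<in>{..<Suc p}. der_scale (?c s) (bs s)) \<in> derivations"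
          by (intro der.subspace_sum[OF derivations_subspace] der.subspace_scale[OF derivations_subspace])
            (simp add: bs_def b euler)
        fix i assume i: "i \<le> p"
        have "\<theta> (y i) = g i - g 0 + h * y i" by (simp add: g0) (simp add: g_def)
        also have "g i - g 0 = (\<Sum>s<p. c s * (G s i - G s 0))"
          using c i by (simp add: right_diff_distrib sum_subtractf)
        finally show "\<theta> (y i) = (\<Sum>s\<in>{..<Suc p}. der_scale (?c s) (bs s)) (y i)"
          unfolding sum_at using b(2)[OF i] by (simp add: euler_yw)
      next
        show "\<theta> w = (\<Sum>s\<in>{..<Suc p}. der_scale (?c s) (bs s)) w"
          unfolding sum_at by (simp add: b(3) euler_yw h mult.commute)
      qed
      then show ?thesis by blast
    qed
    show "\<forall>s\<in>{..<Suc p}. c s = 0" if 0: "(\<Sum>s\<in>{..<Suc p}. der_scale (c s) (bs s)) = 0" for c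
    proof -
      have at: "(\<Sum>s<p. c s * b s q) + c p * euler q = 0" for q
        unfolding sum_at[symmetric] 0 by simp
      have "c p * w = 0" using at[of w] by (simp add: b(3) euler_yw)
      then have cp: "c p = 0" using w_nonzero by (simp add: qpoly_mult_eq_0_iff)
      have "- (\<Sum>s<p. c s * G s 0) + (\<Sum>s<p. c s * G s i) = 0" if "i \<le> p" for i
        using at[of "y i"] cp b(2)[OF that] by (simp add: right_diff_distrib sum_subtractf)
      then have "\<forall>s<p. c s = 0" using G(3) by blast
      then show ?thesis using cp by (auto simp: less_Suc_eq)
    qed
  qed (use \<open>der.subspace M\<close> in simp_all)
qed

end

section \<open>The graph families\<close>

text \<open>Intervals are written \<open>i + 1..j\<close> throughout, so that the indicator of their
  image is \<open>yv j - yv i\<close>.\<close>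

lemma convex_interval:
  fixes J :: "nat set"
  assumes "J \<subseteq> {1..n}" "J \<noteq> {}" "\<forall>a\<in>J. \<forall>b\<in>J. \<forall>c. a < c \<longrightarrow> c < b \<longrightarrow> c \<in> J"
  shows "\<exists>i j. i < j \<and> j \<le> n \<and> J = {i + 1..j}"
proof (intro exI conjI)
  have fin: "finite J" using assms(1) by (rule finite_subset) simp
  have m: "Min J \<in> J" "Max J \<in> J" using fin assms(2) by simp_all
  have le: "Min J \<le> x" "x \<le> Max J" if "x \<in> J" for x using fin that by simp_all
  have 1: "1 \<le> Min J" "Max J \<le> n" using m assms(1) by auto
  show "Min J - 1 < Max J" using 1 le(1)[OF m(2)] by simp
  show "Max J \<le> n" by (rule 1)
  show "J = {Min J - 1 + 1..Max J}"
  proof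
    show "J \<subseteq> {Min J - 1 + 1..Max J}" using le 1 by auto
    show "{Min J - 1 + 1..Max J} \<subseteq> J"
    proof
      fix x assume "x \<in> {Min J - 1 + 1..Max J}"
      then have "Min J \<le> x" "x \<le> Max J" using 1 by auto
      then show "x \<in> J" using assms(3)[rule_format, OF m, of x] m by (cases "x = Min J"; cases "x = Max J") auto
    qed
  qed
qed

context node_coordinates
begin

lemma ind_segment:
  assumes "i \<le> j" "j \<le> p"
  shows "ind (\<sigma> ` {i + 1..j}) = yv j - yv i"
proof -
  have "{1..j} = {1..i} \<union> {i + 1..j}" using assms by auto
  then have un: "\<sigma> ` {1..j} = \<sigma> ` {1..i} \<union> \<sigma> ` {i + 1..j}" by (metis image_Un)
  have "\<sigma> ` {1..i} \<inter> \<sigma> ` {i + 1..j} = {}"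
  proof (rule ccontr)
    assume "\<sigma> ` {1..i} \<inter> \<sigma> ` {i + 1..j} \<noteq> {}"
    then obtain x z where "x \<in> {1..i}" "z \<in> {i + 1..j}" "\<sigma> x = \<sigma> z" by blast
    then show False using \<sigma>_inj[of x z] assms by auto
  qed
  then show ?thesis
    unfolding yv_def un by (auto simp: vec_eq_iff)
qed

end

lemma bij_betw_subset_image:
  assumes "bij_betw f V UNIV"
  shows "\<exists>J\<subseteq>V. I = f ` J"
proof (intro exI[of _ "{x \<in> V. f x \<in> I}"] conjI)
  show "I = f ` {x \<in> V. f x \<in> I}"
  proof
    show "I \<subseteq> f ` {x \<in> V. f x \<in> I}"
    proof
      fix v assume "v \<in> I"
      moreover have "v \<in> f ` V" using assms by (simp add: bij_betw_def)
      ultimately show "v \<in> f ` {x \<in> V. f x \<in> I}" by auto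
    qed
  qed auto
qed auto

section \<open>Connected vertex sets of the families as intervals of labels\<close>

context sgraph
begin

lemma conn_index_cut:
  assumes f: "bij_betw f V UNIV" and adj: "\<forall>i\<in>V. \<forall>j\<in>V. (f i, f j) \<in> E \<longleftrightarrow> (i, j) \<in> R"
    and J: "J \<subseteq> V" "conn E (f ` J)" and ab: "a \<in> J" "a \<in> U" "b \<in> J" "b \<notin> U"
  shows "\<exists>x\<in>J \<inter> U. \<exists>y\<in>J - U. (x, y) \<in> R"
proof -
  have inj: "f i = f j \<longleftrightarrow> i = j" if "i \<in> V" "j \<in> V" for i j
    using f that by (auto simp: bij_betw_def inj_on_eq_iff)
  have "f b \<notin> f ` (J \<inter> U)"
  proof
    assume "f b \<in> f ` (J \<inter> U)"
    then obtain c where "c \<in> J \<inter> U" "f b = f c" by auto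
    then show False using inj[of b c] J(1) ab by auto
  qed
  then obtain u v where uv: "u \<in> f ` J" "u \<in> f ` (J \<inter> U)" "v \<in> f ` J" "v \<notin> f ` (J \<inter> U)" "(u, v) \<in> E"
    using conn_crossing[OF J(2), of "f a" "f ` (J \<inter> U)" "f b"] ab by blast
  then obtain x y where "x \<in> J \<inter> U" "u = f x" "y \<in> J" "v = f y" by auto
  then show ?thesis using uv(4,5) adj J(1) by blast
qed

text \<open>The extra vertex cannot bridge a missing label \<open>c\<close> because its neighbours
  are consecutive: for \<open>c \<le> k\<close> it sees nothing below \<open>c\<close>, for
  \<open>c > k\<close> nothing above. So a connected set meets the path in an interval, and contains
  the extra vertex only alone or next to a neighbour.\<close>

lemma conn_pendant_iff:
  assumes f: "bij_betw f {1..n + 1} UNIV"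
    and adj: "\<forall>i\<in>{1..n + 1}. \<forall>j\<in>{1..n + 1}.
      (f i, f j) \<in> E \<longleftrightarrow> (i, j) \<in> (path_edges n \<union> K \<times> {n + 1}) \<union> (path_edges n \<union> K \<times> {n + 1})\<inverse>"
    and K: "K = {k} \<or> K = {k, k + 1}" "K \<subseteq> {1..n}"
  shows "conn E I \<longleftrightarrow> I = {f (n + 1)} \<or> (\<exists>i j. i < j \<and> j \<le> n \<and> I = f ` {i + 1..j}) \<or>
    (\<exists>i j. i < j \<and> j \<le> n \<and> {i + 1..j} \<inter> K \<noteq> {} \<and> I = insert (f (n + 1)) (f ` {i + 1..j}))"
    (is "_ \<longleftrightarrow> ?pt \<or> ?seg \<or> ?ext")
proof
  let ?R = "(path_edges n \<union> K \<times> {n + 1}) \<union> (path_edges n \<union> K \<times> {n + 1})\<inverse>"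
  assume I: "conn E I"
  obtain J where J: "J \<subseteq> {1..n + 1}" "I = f ` J" using bij_betw_subset_image[OF f] by blast
  note cut = conn_index_cut[OF f adj J(1) I[unfolded J(2)]]
  let ?J' = "J - {n + 1}"
  have convex: "c \<in> ?J'" if abc: "a \<in> ?J'" "b \<in> ?J'" "a < c" "c < b" for a b c
  proof (rule ccontr)
    assume c: "c \<notin> ?J'"
    have b: "b \<le> n" using abc J(1) by force
    show False
    proof (cases "c \<le> k")
      case True
      have "\<exists>x\<in>J \<inter> {..<c}. \<exists>y\<in>J - {..<c}. (x, y) \<in> ?R"
        using abc by (intro cut[of a _ b]) auto
      then obtain x y where "x \<in> J \<inter> {..<c}" "y \<in> J - {..<c}" and R: "(x, y) \<in> ?R" by blast
      then have xy: "x \<in> J" "x < c" "y \<in> J" "c \<le> y" by auto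
      have cn: "c \<notin> J" "c \<le> n" using c b abc(4) by auto
      then have "y \<noteq> c" using xy(3) by auto
      then show False using xy(2,4) R cn(2) True K by (auto simp: path_edges_iff)
    next
      case False
      have "\<exists>x\<in>J \<inter> {c<..n}. \<exists>y\<in>J - {c<..n}. (x, y) \<in> ?R"
        using abc b by (intro cut[of b _ a]) auto
      then obtain x y where "x \<in> J \<inter> {c<..n}" and xy': "y \<in> J - {c<..n}" "(x, y) \<in> ?R" by blast
      then have xy: "c < x" "x \<le> n" "y \<in> J" "y \<notin> {c<..n}" by auto
      have "y \<noteq> c" using xy(3) c b abc(4) by auto
      then have "y < c \<or> n < y" using xy(4) by auto
      moreover have "x \<notin> K" using K(1) False xy(1) by auto
      ultimately show False using xy(1,2) xy'(2) by (auto simp: path_edges_iff)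
    qed
  qed
  have sub: "?J' \<subseteq> {1..n}" using J(1) by auto
  show "?pt \<or> ?seg \<or> ?ext"
  proof (cases "?J' = {}")
    case True
    then have "J = {n + 1}" using I J(2) by (auto simp: conn_def)
    then show ?thesis using J(2) by simp
  next
    case False
    have "\<exists>i j. i < j \<and> j \<le> n \<and> ?J' = {i + 1..j}"
      by (rule convex_interval[OF sub False]) (intro ballI allI impI, rule convex)
    then obtain i j where ij: "i < j" "j \<le> n" "?J' = {i + 1..j}"
      by (elim exE conjE) (rule that)
    show ?thesis
    proof (cases "n + 1 \<in> J")
      case False
      then have "?J' = J" by blast
      then have "I = f ` {i + 1..j}" unfolding J(2) ij(3)[symmetric] by (rule ssubst) (rule refl)
      then show ?thesis using ij(1,2) by blast
    next
      case True
      have jJ: "j \<in> ?J'" unfolding ij(3) using ij(1) by simp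
      have "\<exists>x\<in>J \<inter> ?J'. \<exists>y\<in>J - ?J'. (x, y) \<in> ?R"
        using True jJ by (intro cut[of j _ "n + 1"]) blast+
      then obtain x y where "x \<in> ?J'" "y \<in> J - ?J'" "(x, y) \<in> ?R" by blast
      then have "x \<in> ?J'" and xR: "(x, n + 1) \<in> ?R" by auto
      then have x: "x \<in> {i + 1..j}" unfolding ij(3) by simp
      then have "x \<in> {i + 1..j} \<inter> K" using xR ij(2) by (auto simp: path_edges_iff)
      then have "{i + 1..j} \<inter> K \<noteq> {}" by blast
      moreover have "J = insert (n + 1) {i + 1..j}" unfolding ij(3)[symmetric] using True by blast
      then have "I = insert (f (n + 1)) (f ` {i + 1..j})" unfolding J(2) by simp
      ultimately show ?thesis using ij(1,2) by blast
    qed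
  qed
next
  have seg: "conn E (f ` {i + 1..j})" if "i < j" "j \<le> n" for i j
    using that by (intro conn_segment) (auto simp: adj path_edges_iff)
  assume "?pt \<or> ?seg \<or> ?ext"
  then show "conn E I"
  proof (elim disjE exE conjE)
    fix i j assume ij: "i < j" "j \<le> n" "{i + 1..j} \<inter> K \<noteq> {}" "I = insert (f (n + 1)) (f ` {i + 1..j})"
    obtain x where x: "x \<in> {i + 1..j}" "x \<in> K" using ij(3) by blast
    have "(f x, f (n + 1)) \<in> E" using x K(2) ij by (subst adj[rule_format]) auto
    then show "conn E I" unfolding ij(4) using seg[OF ij(1,2)] x(1) by (intro conn_insert[OF sym]) auto
  qed (use seg in auto)
qed

text \<open>Without label \<open>n\<close> the cycle is a path and connected sets are intervals.
  With it, the complement cannot have a gap, since the labels in the gap would be cut off from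
  \<open>n\<close>.\<close>

lemma conn_cycle_iff:
  assumes f: "bij_betw f {1..n} UNIV" and n: "3 \<le> n"
    and adj: "\<forall>i\<in>{1..n}. \<forall>j\<in>{1..n}.
      (f i, f j) \<in> E \<longleftrightarrow> (i, j) \<in> (path_edges n \<union> {(n, 1)}) \<union> (path_edges n \<union> {(n, 1)})\<inverse>"
  shows "conn E I \<longleftrightarrow> (\<exists>i j. i < j \<and> j \<le> n - 1 \<and> I = f ` {i + 1..j}) \<or>
    (\<exists>i j. i \<le> j \<and> j \<le> n - 1 \<and> I = UNIV - f ` {i + 1..j})"
    (is "_ \<longleftrightarrow> ?seg \<or> ?co")
proof
  let ?R = "(path_edges n \<union> {(n, 1)}) \<union> (path_edges n \<union> {(n, 1)})\<inverse>"
  assume I: "conn E I"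
  obtain J where J: "J \<subseteq> {1..n}" "I = f ` J" using bij_betw_subset_image[OF f] by blast
  note cut = conn_index_cut[OF f adj J(1) I[unfolded J(2)]]
  have ne: "J \<noteq> {}" using I J(2) by (auto simp: conn_def)
  show "?seg \<or> ?co"
  proof (cases "n \<in> J")
    case False
    have sub: "J \<subseteq> {1..n - 1}"
    proof
      fix x assume "x \<in> J"
      then have "x \<noteq> n" "1 \<le> x" "x \<le> n" using False J(1) by auto
      then show "x \<in> {1..n - 1}" by simp
    qed
    have convex: "c \<in> J" if abc: "a \<in> J" "b \<in> J" "a < c" "c < b" for a b c
    proof (rule ccontr)
      assume c: "c \<notin> J"
      have "\<exists>x\<in>J \<inter> {..<c}. \<exists>y\<in>J - {..<c}. (x, y) \<in> ?R"
        using abc by (intro cut[of a _ b]) auto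
      then obtain x y where "x \<in> J \<inter> {..<c}" "y \<in> J - {..<c}" and R: "(x, y) \<in> ?R" by blast
      then have xy: "x \<in> J" "x < c" "y \<in> J" "c \<le> y" by auto
      then have "x \<noteq> n" "y \<noteq> n" "y \<noteq> c" using False c by auto
      then show False using xy(2,4) R by (auto simp: path_edges_iff)
    qed
    have "\<exists>i j. i < j \<and> j \<le> n - 1 \<and> J = {i + 1..j}"
      by (rule convex_interval[OF sub ne]) (intro ballI allI impI, rule convex)
    then show ?thesis using J(2) by blast
  next
    case True
    define C where "C = {1..n - 1} - J"
    have JC: "J = {1..n} - C"
    proof
      show "J \<subseteq> {1..n} - C" using J(1) by (auto simp: C_def)
      show "{1..n} - C \<subseteq> J"
      proof
        fix x assume x: "x \<in> {1..n} - C"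
        show "x \<in> J"
        proof (cases "x = n")
          case False
          then have "x \<in> {1..n - 1}" using x by auto
          then show ?thesis using x by (simp add: C_def)
        qed (use True in simp)
      qed
    qed
    have inj: "inj_on f {1..n}" and im: "f ` {1..n} = UNIV" using f by (auto simp: bij_betw_def)
    have "C \<subseteq> {1..n}" by (auto simp: C_def)
    then have I_eq: "I = UNIV - f ` C"
      unfolding J(2) JC im[symmetric] using inj by (intro inj_on_image_set_diff) auto
    show ?thesis
    proof (cases "C = {}")
      case True
      have "I = UNIV - f ` {0 + 1..0}" using I_eq True by simp
      moreover have "(0::nat) \<le> 0" "0 \<le> n - 1" by simp_all
      ultimately show ?thesis by blast
    next
      case False
      have convex: "c \<in> C" if abc: "a \<in> C" "b \<in> C" "a < c" "c < b" for a b c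
      proof (rule ccontr)
        assume c: "c \<notin> C"
        have ab: "a \<notin> J" "b \<notin> J" "1 \<le> a" "b \<le> n - 1" using abc by (auto simp: C_def)
        have "c \<in> J" using c abc ab by (auto simp: C_def)
        moreover have "n \<notin> {a<..<b}" using ab n by auto
        ultimately have "\<exists>x\<in>J \<inter> {a<..<b}. \<exists>y\<in>J - {a<..<b}. (x, y) \<in> ?R"
          using abc True by (intro cut[of c _ n]) auto
        then obtain x y where "x \<in> J \<inter> {a<..<b}" "y \<in> J - {a<..<b}" and R: "(x, y) \<in> ?R" by blast
        then have xy: "x \<in> J" "a < x" "x < b" "y \<in> J" "y \<notin> {a<..<b}" by auto
        have "y \<noteq> a" "y \<noteq> b" "x \<noteq> n" "x \<noteq> 1" using xy ab by auto
        then show False using xy(2,3,5) R by (auto simp: path_edges_iff)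
      qed
      have "C \<subseteq> {1..n - 1}" by (auto simp: C_def)
      then have "\<exists>i j. i < j \<and> j \<le> n - 1 \<and> C = {i + 1..j}"
        by (rule convex_interval[OF _ False]) (intro ballI allI impI, rule convex)
      then obtain i j where ij: "i < j" "j \<le> n - 1" "C = {i + 1..j}" by (elim exE conjE) (rule that)
      have "I = UNIV - f ` {i + 1..j}" unfolding I_eq ij(3) by (rule refl)
      then show ?thesis using ij(1,2) less_imp_le by blast
    qed
  qed
next
  have seg: "conn E (f ` {a..b})" if "a \<le> b" "1 \<le> a" "b \<le> n" for a b
    using that by (intro conn_segment) (auto simp: adj path_edges_iff)
  assume "?seg \<or> ?co"
  then show "conn E I"
  proof (elim disjE exE conjE)
    fix i j assume "i < j" "j \<le> n - 1" "I = f ` {i + 1..j}"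
    then show "conn E I" using seg[of "i + 1" j] by simp
  next
    fix i j assume ij: "i \<le> j" "j \<le> n - 1" "I = UNIV - f ` {i + 1..j}"
    have inj: "inj_on f {1..n}" and im: "f ` {1..n} = UNIV" using f by (auto simp: bij_betw_def)
    have "{1..n} - {i + 1..j} = {1..i} \<union> {j + 1..n}" using ij n by auto
    moreover have "I = f ` ({1..n} - {i + 1..j})"
      unfolding ij(3) im[symmetric] using inj ij n by (intro inj_on_image_set_diff[symmetric]) auto
    ultimately have I: "I = f ` {1..i} \<union> f ` {j + 1..n}" by (simp add: image_Un)
    have 2: "conn E (f ` {j + 1..n})" using ij n by (intro seg) auto
    show "conn E I"
    proof (cases "i = 0")
      case True
      then show ?thesis using 2 I by simp
    next
      case False
      then have 1: "conn E (f ` {1..i})" using ij n by (intro seg) auto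
      have "(f 1, f n) \<in> E" using n by (subst adj[rule_format]) auto
      then show ?thesis
        unfolding I using False ij n by (intro conn_Un[OF sym 1 2, of "f 1" "f n"]) auto
    qed
  qed
qed

section \<open>Freeness of the families\<close>

lemma empty_not_conn: "{} \<notin> {I. conn E I}"
  by (simp add: conn_def)

text \<open>With \<open>w\<close> the variable of the extra vertex, an interval together with it has
  the form \<open>y j - y i + w\<close>, up to sign \<open>y i - y j - w\<close>. The admissible
  pairs are a cut for one neighbour and two overlapping cuts for two.\<close>

lemma pendant_free:
  assumes f: "bij_betw f {1..n + 1} UNIV"
    and adj: "\<forall>i\<in>{1..n + 1}. \<forall>j\<in>{1..n + 1}.
      (f i, f j) \<in> E \<longleftrightarrow> (i, j) \<in> (path_edges n \<union> K \<times> {n + 1}) \<union> (path_edges n \<union> K \<times> {n + 1})\<inverse>"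
    and K: "K = {k} \<or> K = {k, k + 1}" "K \<subseteq> {1..n}"
  shows "multi_free (subset_arrangement {I. conn E I}) (\<lambda>_. 1)"
proof -
  interpret N: node_coordinates f n "ind {f (Suc n)}"
    by standard (use f in simp_all)
  define R where "R = {(i, j). i < j \<and> j \<le> n \<and> {i + 1..j} \<inter> K \<noteq> {}}"
  have k: "1 \<le> k" "k \<le> n" and k': "K = {k, k + 1} \<Longrightarrow> k < n" using K by auto
  have "N.nodes.free_nodes R"
    using K(1)
  proof
    assume "K = {k}"
    then have "R = {..<k} \<times> {k..n}" by (auto simp: R_def)
    then show ?thesis using N.nodes.free_nodes_cut[OF k] by simp
  next
    assume *: "K = {k, k + 1}"
    have "R = {(i, j). i \<le> k \<and> k \<le> j \<and> i < j \<and> j \<le> n}" by (auto simp: R_def *)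
    then show ?thesis using N.nodes.free_nodes_overlap[OF k(1) k'[OF *]] by simp
  qed
  moreover have ext: "ind (insert (f (n + 1)) (f ` {i + 1..j})) = - (N.yv i - N.yv j - ind {f (Suc n)})"
    if "i < j" "j \<le> n" for i j
  proof -
    have "f (n + 1) \<notin> f ` {i + 1..j}"
    proof
      assume "f (n + 1) \<in> f ` {i + 1..j}"
      then obtain x where "x \<in> {i + 1..j}" "f (n + 1) = f x" by auto
      then show False using N.\<sigma>_inj[of "n + 1" x] that by auto
    qed
    then have "ind (insert (f (n + 1)) (f ` {i + 1..j})) = ind (f ` {i + 1..j}) + ind {f (Suc n)}"
      by (auto simp: vec_eq_iff)
    then show ?thesis using N.ind_segment[of i j] that by simp
  qed
  note conn_iff = conn_pendant_iff[OF f adj K]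
  show ?thesis
  proof (rule N.multi_free_node_forms[OF empty_not_conn, of R])
    show "R \<subseteq> {..n} \<times> {..n}" by (auto simp: R_def)
    show "N.nodes.free_nodes R" by fact
    show "ind I \<in> N.node_forms R \<or> - ind I \<in> N.node_forms R" if "I \<in> {I. conn E I}" for I
    proof -
      from that show ?thesis
        unfolding mem_Collect_eq conn_iff
      proof (elim disjE exE conjE)
        assume "I = {f (n + 1)}"
        then show ?thesis by (simp add: N.node_forms_def)
      next
        fix i j assume 2: "i < j" "j \<le> n" "I = f ` {i + 1..j}"
        then have "ind I = N.yv j - N.yv i" using N.ind_segment[of i j] by simp
        then show ?thesis using 2 unfolding N.node_forms_def by blast
      next
        fix i j assume 3: "i < j" "j \<le> n" "{i + 1..j} \<inter> K \<noteq> {}" "I = insert (f (n + 1)) (f ` {i + 1..j})"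
        then have "- ind I = N.yv i - N.yv j - ind {f (Suc n)}" "(i, j) \<in> R"
          using ext[OF 3(1,2)] by (simp_all add: R_def)
        then show ?thesis unfolding N.node_forms_def by blast
      qed
    qed
    show "\<exists>I\<in>{I. conn E I}. c = ind I \<or> c = - ind I" if "c \<in> N.node_forms R" for c
    proof -
      from that consider i j where "c = N.yv j - N.yv i" "i < j" "j \<le> n" | "c = ind {f (Suc n)}"
        | i j where "c = N.yv i - N.yv j - ind {f (Suc n)}" "(i, j) \<in> R"
        unfolding N.node_forms_def by blast
      then show ?thesis
      proof cases
        case (1 i j)
        then have "c = ind (f ` {i + 1..j})" using N.ind_segment[of i j] by simp
        moreover have "conn E (f ` {i + 1..j})" unfolding conn_iff using 1 by blast
        ultimately show ?thesis by blast
      next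
        case 2
        then show ?thesis by (intro bexI[of _ "{f (Suc n)}"]) simp_all
      next
        case (3 i j)
        then have ij: "i < j" "j \<le> n" "{i + 1..j} \<inter> K \<noteq> {}" by (auto simp: R_def)
        have "c = - ind (insert (f (n + 1)) (f ` {i + 1..j}))" using 3(1) ext[OF ij(1,2)] by simp
        moreover have "conn E (insert (f (n + 1)) (f ` {i + 1..j}))" unfolding conn_iff using ij by blast
        ultimately show ?thesis by blast
      qed
    qed
  qed
qed

text \<open>With \<open>w\<close> minus the sum of all variables, the complement of an interval has
  the form \<open>y i - y j - w\<close>. All pairs \<open>i < j\<close> occur, and the full set
  gives \<open>- w\<close>.\<close>

lemma cycle_free:
  assumes f: "bij_betw f {1..n} UNIV" and n: "3 \<le> n"
    and adj: "\<forall>i\<in>{1..n}. \<forall>j\<in>{1..n}.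
      (f i, f j) \<in> E \<longleftrightarrow> (i, j) \<in> (path_edges n \<union> {(n, 1)}) \<union> (path_edges n \<union> {(n, 1)})\<inverse>"
  shows "multi_free (subset_arrangement {I. conn E I}) (\<lambda>_. 1)"
proof -
  interpret N: node_coordinates f "n - 1" "- ind UNIV"
    by standard (use f n in simp_all)
  define R where "R = {(i, j). i < j \<and> j \<le> n - 1}"
  have co: "ind (UNIV - f ` {i + 1..j}) = N.yv i - N.yv j - (- ind UNIV)" if "i \<le> j" "j \<le> n - 1" for i j
  proof -
    have "ind (UNIV - f ` {i + 1..j}) = ind UNIV - ind (f ` {i + 1..j})" by (auto simp: vec_eq_iff)
    then show ?thesis using N.ind_segment[OF that] by simp
  qed
  note conn_iff = conn_cycle_iff[OF f n adj]
  show ?thesis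
  proof (rule N.multi_free_node_forms[OF empty_not_conn, of R])
    show "R \<subseteq> {..n - 1} \<times> {..n - 1}" by (auto simp: R_def)
    show "N.nodes.free_nodes R" unfolding R_def by (rule N.nodes.free_nodes_shi)
    show "ind I \<in> N.node_forms R \<or> - ind I \<in> N.node_forms R" if "I \<in> {I. conn E I}" for I
    proof -
      from that show ?thesis
        unfolding mem_Collect_eq conn_iff
      proof (elim disjE exE conjE)
        fix i j assume 1: "i < j" "j \<le> n - 1" "I = f ` {i + 1..j}"
        then have "ind I = N.yv j - N.yv i" using N.ind_segment[of i j] by simp
        then show ?thesis using 1 unfolding N.node_forms_def by blast
      next
        fix i j assume 2: "i \<le> j" "j \<le> n - 1" "I = UNIV - f ` {i + 1..j}"
        then have I: "ind I = N.yv i - N.yv j - (- ind UNIV)" using co by simp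
        show ?thesis
        proof (cases "i = j")
          case True
          then have "- ind I = - ind UNIV" using I by simp
          then show ?thesis unfolding N.node_forms_def by blast
        next
          case False
          then have "(i, j) \<in> R" using 2 by (simp add: R_def)
          then show ?thesis using I unfolding N.node_forms_def by blast
        qed
      qed
    qed
    show "\<exists>I\<in>{I. conn E I}. c = ind I \<or> c = - ind I" if "c \<in> N.node_forms R" for c
    proof -
      from that consider i j where "c = N.yv j - N.yv i" "i < j" "j \<le> n - 1" | "c = - ind UNIV"
        | i j where "c = N.yv i - N.yv j - (- ind UNIV)" "(i, j) \<in> R"
        unfolding N.node_forms_def by blast
      then show ?thesis
      proof cases
        case (1 i j)
        then have "c = ind (f ` {i + 1..j})" using N.ind_segment[of i j] by simp
        moreover have "conn E (f ` {i + 1..j})" unfolding conn_iff using 1 by blast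
        ultimately show ?thesis by blast
      next
        case 2
        then show ?thesis using connected by blast
      next
        case (3 i j)
        then have ij: "i \<le> j" "j \<le> n - 1" by (auto simp: R_def)
        have "c = ind (UNIV - f ` {i + 1..j})" using 3(1) co[OF ij] by simp
        moreover have "conn E (UNIV - f ` {i + 1..j})" unfolding conn_iff using ij by blast
        ultimately show ?thesis by blast
      qed
    qed
  qed
qed

theorem in_family_free:
  assumes in_family and card: "5 \<le> CARD('v)"
  shows "multi_free (subset_arrangement {I. conn E I}) (\<lambda>_. 1)"
  using assms(1) unfolding in_family_def
proof (elim disjE exE conjE)
  fix n assume "1 \<le> n" "is_model E {1..n} (path_edges n)"
  then obtain f where f: "bij_betw f {1..n} UNIV" "\<forall>i\<in>{1..n}. \<forall>j\<in>{1..n}. (f i, f j) \<in> E \<longleftrightarrow> (i, j) \<in> path_edges n \<union> (path_edges n)\<inverse>"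
    unfolding is_model_def by blast
  have "n = CARD('v)" using bij_betw_same_card[OF f(1)] by simp
  then have n: "n = n - 1 + 1" "1 \<le> n - 1" using card by auto
  \<comment> \<open>The path is read as a shorter path whose last vertex carries the extra
    vertex.\<close>
  have edges: "path_edges n = path_edges (n - 1) \<union> {n - 1} \<times> {n - 1 + 1}"
    using n by (auto simp: path_edges_iff)
  show ?thesis
    using f unfolding edges n(1)[symmetric]
    by (intro pendant_free[of f "n - 1" "{n - 1}" "n - 1"]) (use n in auto)
next
  fix n assume "3 \<le> n" "is_model E {1..n} (path_edges n \<union> {(n, 1)})"
  then show ?thesis unfolding is_model_def using cycle_free by blast
next
  fix n k assume k: "1 \<le> k" "k \<le> n" and model: "is_model E {1..n + 1} (path_edges n \<union> {(k, n + 1)})"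
  have set: "{(k, n + 1)} = {k} \<times> {n + 1}" by auto
  from model obtain f where f: "bij_betw f {1..n + 1} UNIV" "\<forall>i\<in>{1..n + 1}. \<forall>j\<in>{1..n + 1}. (f i, f j) \<in> E \<longleftrightarrow>
      (i, j) \<in> (path_edges n \<union> {k} \<times> {n + 1}) \<union> (path_edges n \<union> {k} \<times> {n + 1})\<inverse>"
    unfolding is_model_def set by blast
  show ?thesis by (rule pendant_free[OF f(1), of "{k}" k]) (use f(2) k in auto)
next
  fix n k assume k: "1 \<le> k" "k < n" and model: "is_model E {1..n + 1} (path_edges n \<union> {(k, n + 1), (k + 1, n + 1)})"
  have set: "{(k, n + 1), (k + 1, n + 1)} = {k, k + 1} \<times> {n + 1}" by auto
  from model obtain f where f: "bij_betw f {1..n + 1} UNIV" "\<forall>i\<in>{1..n + 1}. \<forall>j\<in>{1..n + 1}. (f i, f j) \<in> E \<longleftrightarrow>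
      (i, j) \<in> (path_edges n \<union> {k, k + 1} \<times> {n + 1}) \<union> (path_edges n \<union> {k, k + 1} \<times> {n + 1})\<inverse>"
    unfolding is_model_def set by blast
  show ?thesis by (rule pendant_free[OF f(1), of "{k, k + 1}" k]) (use f(2) k in auto)
qed

end

section \<open>Digraphs and adjacency relations\<close>

text \<open>A cut that no edge leaves blocks reachability; conversely, the vertices reachable from
  \<open>u\<close> form a part that no edge leaves.\<close>

lemma connected_induce_subgraph_iff:
  assumes sym: "sym (parcs G)" and I: "I \<noteq> {}"
  shows "Digraph_Component.connected (induce_subgraph (with_proj G) I) \<longleftrightarrow> conn (parcs G) I"
proof -
  let ?R = "{(u, v). (u, v) \<in> parcs G \<and> u \<in> I \<and> v \<in> I}"
  have parcs: "parcs (mk_symmetric (induce_subgraph (with_proj G) I)) = ?R"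
    using sym by (auto simp: parcs_mk_symmetric induce_subgraph_def dest: symD)
  have "Digraph_Component.connected (induce_subgraph (with_proj G) I) \<longleftrightarrow>
      (\<forall>u\<in>I. \<forall>v\<in>I. (u, v) \<in> rtrancl_on I ?R)"
    using I by (simp add: Digraph_Component.connected_def strongly_connected_def reachable_def parcs)
  also have "\<dots> \<longleftrightarrow> conn (parcs G) I"
  proof
    assume reach: "\<forall>u\<in>I. \<forall>v\<in>I. (u, v) \<in> rtrancl_on I ?R"
    show "conn (parcs G) I"
      unfolding conn_def
    proof (intro conjI allI impI)
      fix U assume U: "U \<subseteq> I" "U \<noteq> {}" "U \<noteq> I"
      then obtain u w where uw: "u \<in> U" "w \<in> I" "w \<notin> U" by blast
      show "\<exists>u\<in>U. \<exists>v\<in>I - U. (u, v) \<in> parcs G"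
      proof (rule ccontr)
        assume closed: "\<not> ?thesis"
        have "(u, w) \<in> rtrancl_on I ?R" using reach U(1) uw by blast
        then have "w \<in> U" by (induction rule: rtrancl_on_induct) (use closed uw(1) in auto)
        then show False using uw(3) by simp
      qed
    qed (rule I)
  next
    assume conn: "conn (parcs G) I"
    show "\<forall>u\<in>I. \<forall>v\<in>I. (u, v) \<in> rtrancl_on I ?R"
    proof (intro ballI, rule ccontr)
      fix u v assume uv: "u \<in> I" "v \<in> I" "(u, v) \<notin> rtrancl_on I ?R"
      define W where "W = {w \<in> I. (u, w) \<in> rtrancl_on I ?R}"
      have W: "w \<in> W \<longleftrightarrow> w \<in> I \<and> (u, w) \<in> rtrancl_on I ?R" for w by (simp add: W_def)
      have "u \<in> W" "v \<notin> W" "W \<subseteq> I" using uv by (auto simp: W_def)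
      then have "\<exists>a\<in>W. \<exists>b\<in>I - W. (a, b) \<in> parcs G" using conn uv(2) unfolding conn_def by blast
      then obtain a b where ab: "a \<in> W" "b \<in> I" "b \<notin> W" "(a, b) \<in> parcs G" by blast
      then have "(a, b) \<in> ?R" "(u, a) \<in> rtrancl_on I ?R" using W by simp_all
      then have "(u, b) \<in> rtrancl_on I ?R" by (rule_tac rtrancl_on_into_rtrancl_on) (use ab(2) in simp_all)
      then show False using ab(2,3) W by simp
    qed
  qed
  finally show ?thesis .
qed

text \<open>Arcs are pairs on both sides, so equality of the head and tail maps forces the arc map
  of an isomorphism to be induced by the vertex map; only the inverse labelling remains.\<close>

lemma digraph_iso_undirected_iff:
  assumes wf: "pair_wf_digraph G" and verts: "pverts G = UNIV" and R: "R \<subseteq> V \<times> V"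
  shows "digraph_iso (with_proj G) (with_proj (undirected V R)) \<longleftrightarrow> is_model (parcs G) V R"
proof
  assume "digraph_iso (with_proj G) (with_proj (undirected V R))"
  then obtain hom where iso: "pre_digraph.digraph_isomorphism (with_proj G) hom"
    and eq: "with_proj (undirected V R) = app_iso hom (with_proj G)"
    unfolding digraph_iso_def by blast
  define h where "h = iso_verts hom"
  have inj: "inj h" using iso verts by (simp add: pre_digraph.digraph_isomorphism_def h_def)
  have range: "range h = V" using arg_cong[OF eq, of verts] verts by (simp add: h_def undirected_def)
  have arcs: "iso_arcs hom ` parcs G = R \<union> R\<inverse>"
    using arg_cong[OF eq, of arcs] by (simp add: undirected_def)
  have arc: "iso_arcs hom (u, v) = (h u, h v)" if "(u, v) \<in> parcs G" for u v
    using iso that arg_cong[OF eq, of tail] arg_cong[OF eq, of head]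
    by (auto simp: pre_digraph.digraph_isomorphism_def h_def prod_eq_iff)
  have edge: "(h u, h v) \<in> R \<union> R\<inverse> \<longleftrightarrow> (u, v) \<in> parcs G" for u v
  proof
    assume "(h u, h v) \<in> R \<union> R\<inverse>"
    then obtain x y where "(x, y) \<in> parcs G" "(h u, h v) = iso_arcs hom (x, y)"
      unfolding arcs[symmetric] by (metis imageE surj_pair)
    then show "(u, v) \<in> parcs G" using arc inj by (simp add: inj_eq)
  next
    assume "(u, v) \<in> parcs G"
    then show "(h u, h v) \<in> R \<union> R\<inverse>" unfolding arcs[symmetric] using arc by (metis imageI)
  qed
  have "bij_betw (inv h) V UNIV"
    using inj range by (intro bij_betw_inv_into) (simp add: bij_betw_def)
  moreover have "(inv h i, inv h j) \<in> parcs G \<longleftrightarrow> (i, j) \<in> R \<union> R\<inverse>" if "i \<in> V" "j \<in> V" for i j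
    using edge[of "inv h i" "inv h j"] that range by (simp add: f_inv_into_f)
  ultimately show "is_model (parcs G) V R" unfolding is_model_def by blast
next
  assume "is_model (parcs G) V R"
  then obtain f where f: "bij_betw f V UNIV"
    and adj: "\<forall>i\<in>V. \<forall>j\<in>V. (f i, f j) \<in> parcs G \<longleftrightarrow> (i, j) \<in> R \<union> R\<inverse>"
    unfolding is_model_def by blast
  define h where "h = inv_into V f"
  have h: "h u \<in> V" "f (h u) = u" for u
    using f by (auto simp: bij_betw_def h_def inv_into_into f_inv_into_f)
  have hf: "h (f i) = i" if "i \<in> V" for i using f that by (simp add: bij_betw_def h_def)
  have inj: "inj h" using h(2) by (metis injI)
  have range: "range h = V"
  proof
    show "range h \<subseteq> V" using h(1) by blast
    show "V \<subseteq> range h" using hf rangeI by (metis subsetI)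
  qed
  let ?hom = "\<lparr>iso_verts = h, iso_arcs = \<lambda>(u, v). (h u, h v), iso_head = snd, iso_tail = fst\<rparr>"
  have "wf_digraph (with_proj G)" using wf by (simp add: wf_digraph_wp_iff)
  moreover have "inj_on (\<lambda>(u, v). (h u, h v)) (parcs G)"
    using inj by (auto simp: inj_on_def)
  ultimately have "pre_digraph.digraph_isomorphism (with_proj G) ?hom"
    using inj by (auto simp: pre_digraph.digraph_isomorphism_def verts)
  moreover have "with_proj (undirected V R) = app_iso ?hom (with_proj G)"
  proof (rule pre_digraph.equality)
    show "verts (with_proj (undirected V R)) = verts (app_iso ?hom (with_proj G))"
      using range by (simp add: undirected_def verts)
    have "R \<union> R\<inverse> = (\<lambda>(u, v). (h u, h v)) ` parcs G"
    proof (intro set_eqI iffI)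
      fix e assume e: "e \<in> R \<union> R\<inverse>"
      then obtain i j where ij: "e = (i, j)" "i \<in> V" "j \<in> V" using R by auto
      then have "(f i, f j) \<in> parcs G" using adj e by blast
      then show "e \<in> (\<lambda>(u, v). (h u, h v)) ` parcs G"
        by (rule rev_image_eqI) (simp add: ij hf)
    next
      fix e assume "e \<in> (\<lambda>(u, v). (h u, h v)) ` parcs G"
      then obtain u v where uv: "(u, v) \<in> parcs G" "e = (h u, h v)" by auto
      then show "e \<in> R \<union> R\<inverse>" using adj[rule_format, OF h(1) h(1), of u v] h(2) by simp
    qed
    then show "arcs (with_proj (undirected V R)) = arcs (app_iso ?hom (with_proj G))"
      by (simp add: undirected_def)
  qed simp_all
  ultimately show "digraph_iso (with_proj G) (with_proj (undirected V R))"
    unfolding digraph_iso_def by blast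
qed

lemma path_edges_subset: "path_edges n \<subseteq> {1..n} \<times> {1..n}" "path_edges n \<subseteq> {1..n + 1} \<times> {1..n + 1}"
  by (auto simp: path_edges_def)

lemma (in sgraph) graph_family_iff:
  assumes "pair_wf_digraph G" "pverts G = UNIV" "parcs G = E"
  shows "is_path_graph G \<or> is_cycle_graph G \<or> is_almost_path_graph G \<or> is_path_with_triangle_graph G \<longleftrightarrow>
    in_family"
proof -
  note iso = digraph_iso_undirected_iff[OF assms(1,2), unfolded assms(3)]
  have "is_path_graph G \<longleftrightarrow> (\<exists>n\<ge>1. is_model E {1..n} (path_edges n))"
    unfolding is_path_graph_def path_graph_def using iso[OF path_edges_subset(1)] by blast
  moreover have "digraph_iso (with_proj G) (with_proj (cycle_graph n)) \<longleftrightarrow>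
      is_model E {1..n} (path_edges n \<union> {(n, 1)})" if "3 \<le> n" for n
    unfolding cycle_graph_def using that path_edges_subset(1)[of n] by (intro iso) auto
  then have "is_cycle_graph G \<longleftrightarrow> (\<exists>n\<ge>3. is_model E {1..n} (path_edges n \<union> {(n, 1)}))"
    unfolding is_cycle_graph_def by blast
  moreover have "digraph_iso (with_proj G) (with_proj (almost_path_graph n k)) \<longleftrightarrow>
      is_model E {1..n + 1} (path_edges n \<union> {(k, n + 1)})" if "1 \<le> k" "k \<le> n" for n k
    unfolding almost_path_graph_def using that path_edges_subset(2)[of n] by (intro iso) auto
  then have "is_almost_path_graph G \<longleftrightarrow>
      (\<exists>n k. 1 \<le> k \<and> k \<le> n \<and> is_model E {1..n + 1} (path_edges n \<union> {(k, n + 1)}))"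
    unfolding is_almost_path_graph_def by blast
  moreover have "digraph_iso (with_proj G) (with_proj (path_with_triangle_graph n k)) \<longleftrightarrow>
      is_model E {1..n + 1} (path_edges n \<union> {(k, n + 1), (k + 1, n + 1)})" if "1 \<le> k" "k < n" for n k
    unfolding path_with_triangle_graph_def using that path_edges_subset(2)[of n] by (intro iso) auto
  then have "is_path_with_triangle_graph G \<longleftrightarrow>
      (\<exists>n k. 1 \<le> k \<and> k < n \<and> is_model E {1..n + 1} (path_edges n \<union> {(k, n + 1), (k + 1, n + 1)}))"
    unfolding is_path_with_triangle_graph_def by blast
  ultimately show ?thesis unfolding in_family_def by blast
qed

theorem theorem3p3:
  fixes G :: "'v::finite pair_pre_digraph"
  assumes "pair_graph G" and "pverts G = UNIV"
    and "Digraph_Component.connected (with_proj G)"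
    and "CARD('v) \<ge> 5"
  shows "((\<exists>\<mu>. (\<forall>H\<in>connected_subgraph_arrangement G. \<mu> H \<ge> 1) \<and>
             multi_free (connected_subgraph_arrangement G) \<mu>) \<longleftrightarrow>
           is_path_graph G \<or> is_cycle_graph G \<or>
           is_almost_path_graph G \<or> is_path_with_triangle_graph G) \<and>
         (\<not> (is_path_graph G \<or> is_cycle_graph G \<or>
             is_almost_path_graph G \<or> is_path_with_triangle_graph G) \<longrightarrow>
           totally_non_free (connected_subgraph_arrangement G))"
proof -
  interpret G: pair_graph G by fact
  have sym: "sym (parcs G)" using G.pair_sym_arcs by (simp add: symmetric_def)
  have "induce_subgraph (with_proj G) UNIV = with_proj G"
    by (rule pre_digraph.equality) (simp_all add: induce_subgraph_def assms(2))
  then have "conn (parcs G) UNIV"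
    using assms(3) connected_induce_subgraph_iff[OF sym, of UNIV] by simp
  then interpret S: sgraph "parcs G"
    by unfold_locales (use sym G.pair_no_loops in force)+
  have arr: "connected_subgraph_arrangement G = subset_arrangement {I. conn (parcs G) I}"
  proof -
    have "I \<noteq> {} \<and> I \<subseteq> pverts G \<and> Digraph_Component.connected (induce_subgraph (with_proj G) I) \<longleftrightarrow>
        conn (parcs G) I" for I
      using connected_induce_subgraph_iff[OF sym, of I] by (auto simp: assms(2) conn_def)
    then show ?thesis unfolding connected_subgraph_arrangement_eq by simp
  qed
  note family = S.graph_family_iff[OF G.pair_wf_digraph_axioms assms(2) refl]
  show ?thesis
    unfolding arr family
    using S.TNF_or_in_family[OF assms(4)] S.in_family_free[OF _ assms(4)]
    unfolding totally_non_free_def by (metis order_refl)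
qed

end
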